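(* Let $M$ be an $H$-umbilical Lagrangian submanifold of the homogeneous nearly Kähler manifold $(\mathbb{S}^3\times\mathbb{S}^3,g,J)$. Then $M$ is totally geodesic, i.e., its second fundamental form vanishes identically.
   Context: The nearly Kähler $\mathbb{S}^3\times\mathbb{S}^3$: identify $\mathbb{S}^3$ with the set of unit quaternions, so that $T_p\mathbb{S}^3=\{p\alpha \mid \alpha \text{ is an imaginary quaternion}\}$ (quaternionic multiplication). A tangent vector to $\mathbb{S}^3\times\mathbb{S}^3$ at $(p,q)$ is then written as $(p\alpha,q\beta)$ with $\alpha,\beta$ imaginary quaternions. The almost complex structure $J$ is $$J_{(p,q)}(p\alpha,q\beta)=\frac{1}{\sqrt3}\,\big(p(2\beta-\alpha),\,q(\beta-2\alpha)\big),$$ and the metric $g$ is the Hermitian metric $$g_{(p,q)}\big((p\alpha,q\beta),(p\alpha',q\beta')\big)=\frac43\big(\langle\alpha,\alpha'\rangle+\langle\beta,\beta'\rangle\big)-\frac23\big(\langle\alpha,\beta'\rangle+\langle\alpha',\beta\rangle\big),$$ where $\langle\cdot,\cdot\rangle$ is the Euclidean inner product on the imaginary quaternions $\cong\mathbb{R}^3$. With $\tilde\nabla$ the Levi-Civita connection of $g$, the tensor $\tilde\nabla J$ is skew-symmetric, so $(\mathbb{S}^3\times\mathbb{S}^3,g,J)$ is nearly Kähler. Lagrangian submanifold: a submanifold $M$ such that $J$ maps tangent vectors to $M$ to normal vectors to $M$ and vice versa; in $\mathbb{S}^3\times\mathbb{S}^3$ such an $M$ is 3-dimensional. The second fundamental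 form $h$ of $M$ is defined by the Gauss formula $\tilde\nabla_XY=\nabla_XY+h(X,Y)$ for $X,Y$ tangent to $M$, where $\nabla$ is the Levi-Civita connection of the induced metric and $h(X,Y)$ is normal to $M$. $H$-umbilical: a Lagrangian submanifold $M$ of dimension $n\ge 2$ of an almost Hermitian manifold $(\tilde M,g,J)$ is called $H$-umbilical if, in a neighborhood of any point of $M$, there exist a local orthonormal frame $\{U_1,\dots,U_n\}$ on $M$ and local functions $\lambda$ and $\mu$ such that $$h(U_1,U_1)=\lambda JU_1,\qquad h(U_1,U_i)=\mu JU_i,\qquad h(U_i,U_j)=\mu\,\delta_{ij}\,JU_1$$ for all $i,j\in\{2,\dots,n\}$. (Here $n=3$.) *)

theory Defs
  imports "HOL-Analysis.Analysis"
begin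

unbundle no cross3_syntax

section \<open>Smooth maps between open subsets of normed spaces\<close>

primrec Ck_on :: "nat \<Rightarrow> 'a::real_normed_vector set \<Rightarrow> ('a \<Rightarrow> 'b::real_normed_vector) \<Rightarrow> bool" where
  "Ck_on 0 W f \<longleftrightarrow> continuous_on W f"
| "Ck_on (Suc k) W f \<longleftrightarrow>
     (\<forall>x\<in>W. f differentiable (at x)) \<and>
     (\<forall>v. Ck_on k W (\<lambda>x. frechet_derivative f (at x) v))"

definition smooth_on :: "'a::real_normed_vector set \<Rightarrow> ('a \<Rightarrow> 'b::real_normed_vector) \<Rightarrow> bool" where
  "smooth_on W f \<longleftrightarrow> (\<forall>k. Ck_on k W f)"


section \<open>Quaternions and the product of two 3-spheres\<close>

text \<open>The pair \<open>(a, u)\<close> is the quaternion with real part \<open>a\<close> and imaginary part \<open>u\<close>;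
  the product norm and inner product are the Euclidean ones.\<close>

type_synonym quat = "real \<times> (real^3)"

definition qmul :: "quat \<Rightarrow> quat \<Rightarrow> quat" (infixl \<open>\<otimes>\<^sub>q\<close> 70) where
  "x \<otimes>\<^sub>q y = (fst x * fst y - snd x \<bullet> snd y,
             fst x *\<^sub>R snd y + fst y *\<^sub>R snd x + cross3 (snd x) (snd y))"

definition qcnj :: "quat \<Rightarrow> quat" where
  "qcnj x = (fst x, - snd x)"

definition imq :: "real^3 \<Rightarrow> quat" where
  "imq \<alpha> = (0, \<alpha>)"

type_synonym quat2 = "quat \<times> quat"

text \<open>A pair \<open>(\<alpha>, \<beta>)\<close> of imaginary quaternions.\<close>

type_synonym imq2 = "(real^3) \<times> (real^3)"

definition S3S3 :: "quat2 set" where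
  "S3S3 = {(p, q). norm p = 1 \<and> norm q = 1}"

definition lt :: "quat2 \<Rightarrow> imq2 \<Rightarrow> quat2" where
  "lt z e = (fst z \<otimes>\<^sub>q imq (fst e), snd z \<otimes>\<^sub>q imq (snd e))"

text \<open>For \<open>z\<close> in \<open>S3S3\<close> this inverts \<open>lt z\<close> on the tangent space at \<open>z\<close>, since the inverse of a
  unit quaternion is its conjugate.\<close>

definition lt_inv :: "quat2 \<Rightarrow> quat2 \<Rightarrow> imq2" where
  "lt_inv z w = (snd (qcnj (fst z) \<otimes>\<^sub>q fst w), snd (qcnj (snd z) \<otimes>\<^sub>q snd w))"

definition TS :: "quat2 \<Rightarrow> quat2 set" where
  "TS z = {lt z (\<alpha>, \<beta>) | \<alpha> \<beta>. True}"

definition J :: "quat2 \<Rightarrow> quat2 \<Rightarrow> quat2" where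
  "J z w = (let (\<alpha>, \<beta>) = lt_inv z w
            in (1 / sqrt 3) *\<^sub>R lt z (2 *\<^sub>R \<beta> - \<alpha>, \<beta> - 2 *\<^sub>R \<alpha>))"

definition g :: "quat2 \<Rightarrow> quat2 \<Rightarrow> quat2 \<Rightarrow> real" where
  "g z w w' = (let (\<alpha>, \<beta>) = lt_inv z w; (\<alpha>', \<beta>') = lt_inv z w'
               in 4/3 * (\<alpha> \<bullet> \<alpha>' + \<beta> \<bullet> \<beta>') - 2/3 * (\<alpha> \<bullet> \<beta>' + \<alpha>' \<bullet> \<beta>))"


section \<open>The Levi-Civita connection of \<open>(S3S3, g)\<close>\<close>

text \<open>Maps on \<open>S3S3\<close> are differentiated after composing with the radial retraction \<open>retr\<close>. It is a
  smooth submersion from an open set onto \<open>S3S3\<close>, so a map is smooth on \<open>S3S3\<close> iff its composition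
  with \<open>retr\<close> is smooth; and the derivative of \<open>retr\<close> at a point \<open>z\<close> of \<open>S3S3\<close> is the identity on
  \<open>TS z\<close>, so \<open>dS f z v\<close> is the derivative of \<open>f\<close> in the direction \<open>v \<in> TS z\<close>. Values of maps and
  vector fields outside \<open>S3S3\<close> are irrelevant.\<close>

definition retr :: "quat2 \<Rightarrow> quat2" where
  "retr z = (fst z /\<^sub>R norm (fst z), snd z /\<^sub>R norm (snd z))"

definition smooth_S :: "(quat2 \<Rightarrow> 'b::real_normed_vector) \<Rightarrow> bool" where
  "smooth_S f \<longleftrightarrow> smooth_on {(p, q). p \<noteq> 0 \<and> q \<noteq> 0} (f \<circ> retr)"

definition dS :: "(quat2 \<Rightarrow> 'b::real_normed_vector) \<Rightarrow> quat2 \<Rightarrow> quat2 \<Rightarrow> 'b" where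
  "dS f z v = frechet_derivative (f \<circ> retr) (at z) v"

definition vfield :: "(quat2 \<Rightarrow> quat2) \<Rightarrow> bool" where
  "vfield X \<longleftrightarrow> smooth_S X \<and> (\<forall>z\<in>S3S3. X z \<in> TS z)"

definition lie_bracket :: "(quat2 \<Rightarrow> quat2) \<Rightarrow> (quat2 \<Rightarrow> quat2) \<Rightarrow> quat2 \<Rightarrow> quat2" where
  "lie_bracket X Y z = dS Y z (X z) - dS X z (Y z)"

type_synonym connection = "(quat2 \<Rightarrow> quat2) \<Rightarrow> (quat2 \<Rightarrow> quat2) \<Rightarrow> quat2 \<Rightarrow> quat2"

definition affine_connection :: "connection \<Rightarrow> bool" where
  "affine_connection nabla \<longleftrightarrow>
     (\<forall>X Y. vfield X \<longrightarrow> vfield Y \<longrightarrow> vfield (nabla X Y)) \<and>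
     (\<forall>X Y Z. vfield X \<longrightarrow> vfield Y \<longrightarrow> vfield Z \<longrightarrow> (\<forall>z\<in>S3S3.
        nabla (\<lambda>z. X z + Y z) Z z = nabla X Z z + nabla Y Z z \<and>
        nabla X (\<lambda>z. Y z + Z z) z = nabla X Y z + nabla X Z z)) \<and>
     (\<forall>f X Y. smooth_S f \<longrightarrow> vfield X \<longrightarrow> vfield Y \<longrightarrow> (\<forall>z\<in>S3S3.
        nabla (\<lambda>z. f z *\<^sub>R X z) Y z = f z *\<^sub>R nabla X Y z \<and>
        nabla X (\<lambda>z. f z *\<^sub>R Y z) z = dS f z (X z) *\<^sub>R Y z + f z *\<^sub>R nabla X Y z))"

definition levi_civita :: "connection \<Rightarrow> bool" where
  "levi_civita nabla \<longleftrightarrow>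
     affine_connection nabla \<and>
     (\<forall>X Y. vfield X \<longrightarrow> vfield Y \<longrightarrow> (\<forall>z\<in>S3S3.
        nabla X Y z - nabla Y X z = lie_bracket X Y z)) \<and>
     (\<forall>X Y Z. vfield X \<longrightarrow> vfield Y \<longrightarrow> vfield Z \<longrightarrow> (\<forall>z\<in>S3S3.
        dS (\<lambda>z. g z (Y z) (Z z)) z (X z) =
          g z (nabla X Y z) (Z z) + g z (Y z) (nabla X Z z)))"


section \<open>Immersed 3-dimensional submanifolds\<close>

text \<open>A submanifold is a topological space \<open>M\<close> with a map \<open>F\<close> into \<open>S3S3\<close> that is a smooth
  immersion in suitable local parametrizations. An immersion in this sense determines the smooth
  structure of \<open>M\<close>: local parametrizations in which \<open>F\<close> is a smooth immersion have smooth
  transition maps. An embedded submanifold \<open>M \<subseteq> S3S3\<close> is the case \<open>F = id\<close> with the subspace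
  topology.\<close>

definition local_param ::
  "'m topology \<Rightarrow> ('m \<Rightarrow> quat2) \<Rightarrow> (real^3) set \<Rightarrow> (real^3 \<Rightarrow> 'm) \<Rightarrow> bool" where
  "local_param M F V \<psi> \<longleftrightarrow>
     open V \<and> openin M (\<psi> ` V) \<and>
     homeomorphic_map (top_of_set V) (subtopology M (\<psi> ` V)) \<psi> \<and>
     smooth_on V (F \<circ> \<psi>) \<and>
     (\<forall>u\<in>V. inj (frechet_derivative (F \<circ> \<psi>) (at u)))"

definition submanifold3 :: "'m topology \<Rightarrow> ('m \<Rightarrow> quat2) \<Rightarrow> bool" where
  "submanifold3 M F \<longleftrightarrow>
     Hausdorff_space M \<and> second_countable M \<and> F ` topspace M \<subseteq> S3S3 \<and>
     (\<forall>x\<in>topspace M. \<exists>V \<psi>. local_param M F V \<psi> \<and> x \<in> \<psi> ` V)"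

text \<open>Below, \<open>\<phi> = F \<circ> \<psi>\<close> for a local parametrization \<open>\<psi>\<close> on \<open>V\<close>, and vector fields on the
  open subset \<open>\<psi> ` V\<close> of \<open>M\<close> are written as maps on \<open>V\<close>.\<close>

definition tangent_space :: "(real^3 \<Rightarrow> quat2) \<Rightarrow> real^3 \<Rightarrow> quat2 set" where
  "tangent_space \<phi> u = range (frechet_derivative \<phi> (at u))"

definition normal_space :: "(real^3 \<Rightarrow> quat2) \<Rightarrow> real^3 \<Rightarrow> quat2 set" where
  "normal_space \<phi> u = {w \<in> TS (\<phi> u). \<forall>v\<in>tangent_space \<phi> u. g (\<phi> u) w v = 0}"

definition tangent_field :: "(real^3 \<Rightarrow> quat2) \<Rightarrow> (real^3) set \<Rightarrow> (real^3 \<Rightarrow> quat2) \<Rightarrow> bool" where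
  "tangent_field \<phi> V Y \<longleftrightarrow> smooth_on V Y \<and> (\<forall>u\<in>V. Y u \<in> tangent_space \<phi> u)"

text \<open>The covariant derivative, induced by the connection \<open>nabla\<close> of \<open>S3S3\<close>, of a vector field
  \<open>Y\<close> along \<open>\<phi>\<close> in the direction of the tangent field \<open>X\<close>. With \<open>Y u = (\<Sum>b\<in>Basis. y\<^sub>b u *\<^sub>R E\<^sub>b (\<phi> u))\<close>
  for the global frame of left-invariant fields \<open>E\<^sub>b = (\<lambda>z. lt z b)\<close>, the Leibniz rule gives
  \<open>(\<Sum>b\<in>Basis. X y\<^sub>b *\<^sub>R E\<^sub>b + y\<^sub>b *\<^sub>R nabla\<^sub>X E\<^sub>b)\<close>; as \<open>nabla\<^sub>X E\<^sub>b\<close> depends only on \<open>X u\<close>, the first argument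
  of \<open>nabla\<close> may be any vector field with value \<open>X u\<close> at \<open>\<phi> u\<close>, here the left-invariant one.\<close>

definition cov_deriv ::
  "connection \<Rightarrow> (real^3 \<Rightarrow> quat2) \<Rightarrow>
   (real^3 \<Rightarrow> quat2) \<Rightarrow> (real^3 \<Rightarrow> quat2) \<Rightarrow> real^3 \<Rightarrow> quat2" where
  "cov_deriv nabla \<phi> X Y u =
     (let \<xi> = (THE \<xi>. frechet_derivative \<phi> (at u) \<xi> = X u);
          y = (\<lambda>u. lt_inv (\<phi> u) (Y u));
          x = lt_inv (\<phi> u) (X u)
      in lt (\<phi> u) (frechet_derivative y (at u) \<xi>) +
         (\<Sum>b\<in>Basis. (y u \<bullet> b) *\<^sub>R nabla (\<lambda>z. lt z x) (\<lambda>z. lt z b) (\<phi> u)))"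

text \<open>The normal part in the Gauss formula.\<close>

definition second_ff ::
  "connection \<Rightarrow> (real^3 \<Rightarrow> quat2) \<Rightarrow>
   (real^3 \<Rightarrow> quat2) \<Rightarrow> (real^3 \<Rightarrow> quat2) \<Rightarrow> real^3 \<Rightarrow> quat2" where
  "second_ff nabla \<phi> X Y u =
     (THE n. n \<in> normal_space \<phi> u \<and> cov_deriv nabla \<phi> X Y u - n \<in> tangent_space \<phi> u)"

definition lagrangian :: "'m topology \<Rightarrow> ('m \<Rightarrow> quat2) \<Rightarrow> bool" where
  "lagrangian M F \<longleftrightarrow>
     submanifold3 M F \<and>
     (\<forall>V \<psi>. local_param M F V \<psi> \<longrightarrow> (\<forall>u\<in>V.
        J (F (\<psi> u)) ` tangent_space (F \<circ> \<psi>) u \<subseteq> normal_space (F \<circ> \<psi>) u \<and>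
        J (F (\<psi> u)) ` normal_space (F \<circ> \<psi>) u \<subseteq> tangent_space (F \<circ> \<psi>) u))"

definition orthonormal_frame ::
  "(real^3 \<Rightarrow> quat2) \<Rightarrow> (real^3) set \<Rightarrow> (nat \<Rightarrow> real^3 \<Rightarrow> quat2) \<Rightarrow> bool" where
  "orthonormal_frame \<phi> V U \<longleftrightarrow>
     (\<forall>i\<in>{1..3}. tangent_field \<phi> V (U i)) \<and>
     (\<forall>i\<in>{1..3}. \<forall>j\<in>{1..3}. \<forall>u\<in>V. g (\<phi> u) (U i u) (U j u) = (if i = j then 1 else 0))"

definition H_umbilical ::
  "connection \<Rightarrow> 'm topology \<Rightarrow> ('m \<Rightarrow> quat2) \<Rightarrow> bool" where
  "H_umbilical nabla M F \<longleftrightarrow>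
     (\<forall>x\<in>topspace M. \<exists>V \<psi>. local_param M F V \<psi> \<and> x \<in> \<psi> ` V \<and>
       (\<exists>U l m. orthonormal_frame (F \<circ> \<psi>) V U \<and> smooth_on V l \<and> smooth_on V m \<and>
         (\<forall>u\<in>V.
            second_ff nabla (F \<circ> \<psi>) (U 1) (U 1) u = l u *\<^sub>R J (F (\<psi> u)) (U 1 u) \<and>
            (\<forall>i\<in>{2..3}.
               second_ff nabla (F \<circ> \<psi>) (U 1) (U i) u = m u *\<^sub>R J (F (\<psi> u)) (U i u)) \<and>
            (\<forall>i\<in>{2..3}. \<forall>j\<in>{2..3}.
               second_ff nabla (F \<circ> \<psi>) (U i) (U j) u =
                 (m u * (if i = j then 1 else 0)) *\<^sub>R J (F (\<psi> u)) (U 1 u)))))"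

definition totally_geodesic ::
  "connection \<Rightarrow> 'm topology \<Rightarrow> ('m \<Rightarrow> quat2) \<Rightarrow> bool" where
  "totally_geodesic nabla M F \<longleftrightarrow>
     (\<forall>V \<psi>. local_param M F V \<psi> \<longrightarrow>
       (\<forall>X Y. tangent_field (F \<circ> \<psi>) V X \<longrightarrow> tangent_field (F \<circ> \<psi>) V Y \<longrightarrow>
         (\<forall>u\<in>V. second_ff nabla (F \<circ> \<psi>) X Y u = 0)))"

end

theory Submission
  imports Defs
begin

text \<open>
  In the complex coordinate \<open>\<zeta> = -(\<alpha> + \<beta>)/\<surd>3 + \<i>(\<beta> - \<alpha>)\<close> on pairs of imaginary quaternions, \<open>J\<close> becomes
  multiplication by \<open>\<i>\<close> and \<open>g\<close> the real part of the standard Hermitian form of \<open>\<complex>\<^sup>3\<close>. An orthonormal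
  frame of a Lagrangian immersion thus becomes a unitary basis \<open>\<zeta>\<^sub>1, \<zeta>\<^sub>2, \<zeta>\<^sub>3\<close> of \<open>\<complex>\<^sup>3\<close>. Up to a real
  rotation, its derivative is \<open>\<Psi> \<zeta>\<close> with \<open>\<Psi>\<close> skew-Hermitian, and \<open>Im \<Psi>\<close> is the second fundamental form.
  The Gauss formula shows that \<open>det(\<zeta>\<^sub>1, \<zeta>\<^sub>2, \<zeta>\<^sub>3)\<close> is real, hence \<open>\<plusminus>1\<close>, so \<open>\<Psi>\<close> is trace free and
  \<open>\<lambda> = -2\<mu>\<close>.

  Let \<open>S\<close> be the symmetric unitary matrix of the bilinear products \<open>\<zeta>\<^sub>i \<cdot> \<zeta>\<^sub>j\<close>; it satisfies
  \<open>dS = \<Psi> S + S \<Psi>\<^sup>T\<close>, and the curvature term in the Codazzi equation is quadratic in \<open>S\<close>. Eliminating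
  \<open>d\<mu>\<close> and the connection coefficients from the Codazzi equation where \<open>\<mu> \<noteq> 0\<close> leaves four relations for
  \<open>S\<close>, which force \<open>S\<^sub>1\<^sub>2 = S\<^sub>1\<^sub>3 = 0\<close> or that all entries of \<open>S\<close> are real multiples of one unit complex
  number. If the latter holds on an open set, differentiating it along \<open>U\<^sub>1\<close> contradicts \<open>\<mu> \<noteq> 0\<close>. In
  the former case differentiating \<open>S\<^sub>1\<^sub>2 = S\<^sub>1\<^sub>3 = 0\<close> makes the connection coefficients of \<open>U\<^sub>1\<close> on the plane
  of \<open>U\<^sub>2, U\<^sub>3\<close> symmetric, whereas the remaining Codazzi equation makes them differ by \<open>\<plusminus>1/(2\<surd>3)\<close>.
\<close>

section \<open>Smooth maps and symmetry of second derivatives\<close>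

lemma Ck_on_cong:
  fixes f h :: "'a::real_normed_vector \<Rightarrow> 'b::real_normed_vector"
  assumes W: "open W" and eq: "\<And>x. x \<in> W \<Longrightarrow> f x = h x" and f: "Ck_on k W f"
  shows "Ck_on k W h"
  using eq f
proof (induction k arbitrary: f h)
  case 0
  then show ?case using continuous_on_cong[of W W f h] by simp
next
  case (Suc k)
  have der: "(h has_derivative frechet_derivative f (at x)) (at x)" if x: "x \<in> W" for x
  proof -
    have "(f has_derivative frechet_derivative f (at x)) (at x)"
      using Suc.prems(2) x frechet_derivative_works by auto
    then show ?thesis
      using has_derivative_transform_within_open[OF _ W x] Suc.prems(1) by blast
  qed
  then have fd: "frechet_derivative f (at x) = frechet_derivative h (at x)" if "x \<in> W" for x
    using that frechet_derivative_at by blast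
  have "Ck_on k W (\<lambda>x. frechet_derivative h (at x) v)" for v
    by (rule Suc.IH[of "\<lambda>x. frechet_derivative f (at x) v"]) (use fd Suc.prems(2) in auto)
  then show ?case using der by (auto simp: differentiable_def)
qed

lemma Ck_on_SucI:
  fixes f :: "'a::real_normed_vector \<Rightarrow> 'b::real_normed_vector"
  assumes "open W" and der: "\<And>x. x \<in> W \<Longrightarrow> (f has_derivative f' x) (at x)"
    and "\<And>v. Ck_on k W (\<lambda>x. f' x v)"
  shows "Ck_on (Suc k) W f"
proof -
  have "f' x = frechet_derivative f (at x)" if "x \<in> W" for x
    using der[OF that] frechet_derivative_at by blast
  then have "Ck_on k W (\<lambda>x. frechet_derivative f (at x) v)" for v
    by (intro Ck_on_cong[OF assms(1) _ assms(3)[of v]]) auto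
  then show ?thesis using der by (auto simp: differentiable_def)
qed

lemma Ck_on_Suc_has_derivative:
  assumes "Ck_on (Suc k) W f" "x \<in> W"
  shows "(f has_derivative frechet_derivative f (at x)) (at x)"
  using assms frechet_derivative_works by auto

lemma Ck_on_Suc_imp_Ck_on: "Ck_on (Suc k) W f \<Longrightarrow> Ck_on k W f"
proof (induction k arbitrary: f)
  case 0
  then show ?case
    by (auto intro!: continuous_at_imp_continuous_on differentiable_imp_continuous_within)
next
  case (Suc k)
  from Suc.prems have "Ck_on k W (\<lambda>x. frechet_derivative f (at x) v)" for v
    by (intro Suc.IH) simp
  moreover have "\<forall>x\<in>W. f differentiable at x" using Suc.prems by simp
  ultimately show ?case by simp
qed

lemma Ck_on_const: "Ck_on k W (\<lambda>x. c)"
proof (induction k arbitrary: c)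
  case (Suc k)
  have "frechet_derivative (\<lambda>x. c) (at x) = (\<lambda>v. 0)" for x :: 'a
    by (rule frechet_derivative_at[symmetric]) simp
  then show ?case using Suc by simp
qed simp

lemma Ck_on_bounded_linear:
  assumes T: "bounded_linear T" and W: "open W"
  shows "Ck_on k W f \<Longrightarrow> Ck_on k W (\<lambda>x. T (f x))"
proof (induction k arbitrary: f)
  case 0
  then show ?case using bounded_linear.continuous_on[OF T] by simp
next
  case (Suc k)
  show ?case
  proof (rule Ck_on_SucI[OF W])
    show "((\<lambda>x. T (f x)) has_derivative (\<lambda>v. T (frechet_derivative f (at x) v))) (at x)" if "x \<in> W" for x
      by (rule bounded_linear.has_derivative[OF T Ck_on_Suc_has_derivative[OF Suc.prems that]])
    show "Ck_on k W (\<lambda>x. T (frechet_derivative f (at x) v))" for v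
      using Suc by simp
  qed
qed

lemma Ck_on_add:
  assumes W: "open W"
  shows "Ck_on k W f \<Longrightarrow> Ck_on k W h \<Longrightarrow> Ck_on k W (\<lambda>x. f x + h x)"
proof (induction k arbitrary: f h)
  case 0
  then show ?case by (simp add: continuous_on_add)
next
  case (Suc k)
  show ?case
  proof (rule Ck_on_SucI[OF W])
    show "((\<lambda>x. f x + h x) has_derivative
        (\<lambda>v. frechet_derivative f (at x) v + frechet_derivative h (at x) v)) (at x)" if "x \<in> W" for x
      by (intro has_derivative_add Ck_on_Suc_has_derivative[OF Suc.prems(1) that]
          Ck_on_Suc_has_derivative[OF Suc.prems(2) that])
    show "Ck_on k W (\<lambda>x. frechet_derivative f (at x) v + frechet_derivative h (at x) v)" for v
      using Suc by simp
  qed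
qed

lemma Ck_on_bounded_bilinear:
  assumes B: "bounded_bilinear B" and W: "open W"
  shows "Ck_on k W f \<Longrightarrow> Ck_on k W h \<Longrightarrow> Ck_on k W (\<lambda>x. B (f x) (h x))"
proof (induction k arbitrary: f h)
  case 0
  then show ?case using bounded_bilinear.continuous_on[OF B] by simp
next
  case (Suc k)
  show ?case
  proof (rule Ck_on_SucI[OF W])
    show "((\<lambda>x. B (f x) (h x)) has_derivative
        (\<lambda>v. B (f x) (frechet_derivative h (at x) v) + B (frechet_derivative f (at x) v) (h x))) (at x)"
      if "x \<in> W" for x
      by (intro bounded_bilinear.FDERIV[OF B] Ck_on_Suc_has_derivative[OF Suc.prems(1) that]
          Ck_on_Suc_has_derivative[OF Suc.prems(2) that])
    \<comment> \<open>Each summand pairs a derivative of order k with an undifferentiated factor of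
      order \<open>Suc k\<close>, whose order is lowered before the induction hypothesis
      applies.\<close>
    show "Ck_on k W (\<lambda>x. B (f x) (frechet_derivative h (at x) v) + B (frechet_derivative f (at x) v) (h x))" for v
      using Suc.prems Ck_on_Suc_imp_Ck_on[OF Suc.prems(1)] Ck_on_Suc_imp_Ck_on[OF Suc.prems(2)]
      by (intro Ck_on_add[OF W] Suc.IH) auto
  qed
qed

text \<open>The derivative is a product of powers of the same inverse norm with a factor linear in
  \<open>T x\<close>, so the induction on the order closes.\<close>

lemma Ck_on_inverse_norm:
  fixes T :: "'a::real_normed_vector \<Rightarrow> 'b::real_inner"
  assumes T: "bounded_linear T" and W: "open W" and nz: "\<And>x. x \<in> W \<Longrightarrow> T x \<noteq> 0"
  shows "Ck_on k W (\<lambda>x. inverse (norm (T x)))"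
proof (induction k)
  case 0
  then show ?case
    using nz by (auto intro!: continuous_intros bounded_linear.continuous_on[OF T])
next
  case (Suc k)
  let ?i = "\<lambda>x. inverse (norm (T x))"
  have TC: "Ck_on k W T" 
  proof (rule Ck_on_bounded_linear[OF T W])
    show "Ck_on k W (\<lambda>x. x)"
    proof (cases k)
      case (Suc l)
      then show ?thesis by (auto intro!: Ck_on_SucI[OF W, of "\<lambda>x. x" "\<lambda>_ v. v"] Ck_on_const)
    qed simp
  qed
  show ?case
  proof (rule Ck_on_SucI[OF W])
    fix x assume x: "x \<in> W"
    have 1: "((\<lambda>x. norm (T x)) has_derivative (\<lambda>v. T v \<bullet> sgn (T x))) (at x)"
      by (rule has_derivative_compose[OF bounded_linear_imp_has_derivative[OF T], of norm "\<lambda>v. v \<bullet> sgn (T x)" x UNIV])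
        (use has_derivative_norm[OF nz[OF x]] in \<open>simp\<close>)
    have "(?i has_derivative (\<lambda>v. - (?i x * (T v \<bullet> sgn (T x)) * ?i x))) (at x)"
      by (rule Deriv.has_derivative_inverse[OF _ 1]) (use nz[OF x] in simp)
    moreover have "(\<lambda>v. - (?i x * (T v \<bullet> sgn (T x)) * ?i x)) = (\<lambda>v. (?i x * (?i x * ?i x)) * (T x \<bullet> (- T v)))"
      by (auto simp: sgn_div_norm fun_eq_iff inner_commute field_simps)
    ultimately show "(?i has_derivative (\<lambda>v. (?i x * (?i x * ?i x)) * (T x \<bullet> (- T v)))) (at x)"
      by simp
  next
    fix v
    show "Ck_on k W (\<lambda>x. (?i x * (?i x * ?i x)) * (T x \<bullet> (- T v)))"
      by (intro Ck_on_bounded_bilinear[OF bounded_bilinear_mult W] Suc.IH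
          Ck_on_bounded_bilinear[OF bounded_bilinear_inner W] TC Ck_on_const)
  qed
qed

lemma smooth_onD:
  assumes "smooth_on W f" "x \<in> W"
  shows "(f has_derivative frechet_derivative f (at x)) (at x)"
  using assms Ck_on_Suc_has_derivative unfolding smooth_on_def by blast

lemma smooth_on_frechet_derivative:
  "smooth_on W f \<Longrightarrow> smooth_on W (\<lambda>x. frechet_derivative f (at x) v)"
  unfolding smooth_on_def by (metis Ck_on.simps(2))

lemma smooth_on_continuous_on: "smooth_on W f \<Longrightarrow> continuous_on W f"
  unfolding smooth_on_def by (metis Ck_on.simps(1))

lemma smooth_on_bounded_bilinear:
  "bounded_bilinear B \<Longrightarrow> open W \<Longrightarrow> smooth_on W f \<Longrightarrow> smooth_on W h \<Longrightarrow> smooth_on W (\<lambda>x. B (f x) (h x))"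
  unfolding smooth_on_def by (blast intro: Ck_on_bounded_bilinear)

text \<open>The second difference of \<open>f\<close> over the parallelogram spanned by small
  multiples of \<open>h\<close> and \<open>k\<close> is symmetric in the two vectors. Two mean value
  steps, taken in either order, turn it into \<open>d * d\<close> times a mixed derivative at a
  nearby point, and continuity identifies the limits.\<close>

lemma symmetric_second_derivative_real:
  fixes f :: "'a::real_normed_vector \<Rightarrow> real"
  assumes W: "open W" and x: "x \<in> W"
    and f: "\<And>y. y \<in> W \<Longrightarrow> (f has_derivative f' y) (at y)"
    and fh: "\<And>y. y \<in> W \<Longrightarrow> ((\<lambda>y. f' y h) has_derivative Dh y) (at y)"
    and fk: "\<And>y. y \<in> W \<Longrightarrow> ((\<lambda>y. f' y k) has_derivative Dk y) (at y)"
    and ch: "continuous_on W (\<lambda>y. Dh y k)" and ck: "continuous_on W (\<lambda>y. Dk y h)"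
  shows "Dh x k = Dk x h"
proof -
  obtain e where e: "e > 0" "ball x e \<subseteq> W" using W x open_contains_ball by blast
  \<comment> \<open>Points of the parallelogram with coefficients at most \<open>d\<close> lie
    within \<open>d * c\<close> of \<open>x\<close>; the summand 1 keeps \<open>c\<close> positive
    even if both vectors vanish.\<close>
  define c where "c = norm h + norm k + 1"
  have c: "c > 0" unfolding c_def by (simp add: add_nonneg_pos)
  have inW: "x + s *\<^sub>R h + t *\<^sub>R k \<in> W" if "\<bar>s\<bar> \<le> d" "\<bar>t\<bar> \<le> d" "d * c < e" for s t d
  proof -
    have "norm (s *\<^sub>R h + t *\<^sub>R k) \<le> \<bar>s\<bar> * norm h + \<bar>t\<bar> * norm k"
      using norm_triangle_ineq[of "s *\<^sub>R h" "t *\<^sub>R k"] by simp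
    also have "\<dots> \<le> d * norm h + d * norm k"
      using that by (intro add_mono mult_right_mono) auto
    also have "\<dots> \<le> d * c" unfolding c_def using that by (simp add: algebra_simps)
    finally have "dist (x + s *\<^sub>R h + t *\<^sub>R k) x < e" using that by (simp add: dist_norm add.assoc)
    then show ?thesis using e by (auto simp: dist_commute)
  qed
  \<comment> \<open>The vectors are generalized here so that the same mean value argument serves
    both orders of differentiation.\<close>
  have key: "\<exists>s t. 0 < s \<and> s < d \<and> 0 < t \<and> t < d \<and>
      f (x + d *\<^sub>R h + d *\<^sub>R k) - f (x + d *\<^sub>R h) - f (x + d *\<^sub>R k) + f x = d * d * D (x + s *\<^sub>R h + t *\<^sub>R k)"
    if d: "0 < d" "d * (norm h + norm k + 1) < e" 
      and in': "\<And>s t. \<bar>s\<bar> \<le> d \<Longrightarrow> \<bar>t\<bar> \<le> d \<Longrightarrow> x + s *\<^sub>R h + t *\<^sub>R k \<in> W"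
      and D: "\<And>y. y \<in> W \<Longrightarrow> ((\<lambda>y. f' y h) has_derivative E y) (at y)" "\<And>y. E y k = D y"
    for d h k D E
  proof -
    let ?g = "\<lambda>s. f (x + s *\<^sub>R h + d *\<^sub>R k) - f (x + s *\<^sub>R h + 0 *\<^sub>R k)"
    have 1: "((\<lambda>s. f (x + s *\<^sub>R h + t *\<^sub>R k)) has_real_derivative f' (x + s *\<^sub>R h + t *\<^sub>R k) h) (at s)"
      if "\<bar>s\<bar> \<le> d" "\<bar>t\<bar> \<le> d" for s t
    proof -
      have "((\<lambda>s. f (x + s *\<^sub>R h + t *\<^sub>R k)) has_derivative (\<lambda>z. f' (x + s *\<^sub>R h + t *\<^sub>R k) (z *\<^sub>R h))) (at s)"
        by (rule has_derivative_compose[where g = f and f = "\<lambda>s. x + s *\<^sub>R h + t *\<^sub>R k", OF _ f[OF in'[OF that]]]) (auto intro!: derivative_eq_intros)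
      moreover have "(\<lambda>z. f' (x + s *\<^sub>R h + t *\<^sub>R k) (z *\<^sub>R h)) = (*) (f' (x + s *\<^sub>R h + t *\<^sub>R k) h)"
        using linear_cmul[OF has_derivative_linear[OF f[OF in'[OF that]]]] by (simp add: fun_eq_iff)
      ultimately show ?thesis by (simp add: has_field_derivative_def)
    qed
    have "\<exists>s>0. s < d \<and> ?g d - ?g 0 = (d - 0) * (f' (x + s *\<^sub>R h + d *\<^sub>R k) h - f' (x + s *\<^sub>R h + 0 *\<^sub>R k) h)"
      by (rule MVT2) (use d in \<open>auto intro!: DERIV_diff 1[of _ d] 1[of _ 0, simplified]\<close>)
    then obtain s where s: "0 < s" "s < d" "?g d - ?g 0 = d * (f' (x + s *\<^sub>R h + d *\<^sub>R k) h - f' (x + s *\<^sub>R h + 0 *\<^sub>R k) h)"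
      by auto
    have 2: "((\<lambda>t. f' (x + s *\<^sub>R h + t *\<^sub>R k) h) has_real_derivative D (x + s *\<^sub>R h + t *\<^sub>R k)) (at t)"
      if "\<bar>t\<bar> \<le> d" for t
    proof -
      have i: "x + s *\<^sub>R h + t *\<^sub>R k \<in> W" using in'[of s t] s that by auto
      have "((\<lambda>t. f' (x + s *\<^sub>R h + t *\<^sub>R k) h) has_derivative (\<lambda>z. E (x + s *\<^sub>R h + t *\<^sub>R k) (z *\<^sub>R k))) (at t)"
        by (rule has_derivative_compose[where g = "\<lambda>y. f' y h" and f = "\<lambda>t. x + s *\<^sub>R h + t *\<^sub>R k", OF _ D(1)[OF i]]) (auto intro!: derivative_eq_intros)
      moreover have "(\<lambda>z. E (x + s *\<^sub>R h + t *\<^sub>R k) (z *\<^sub>R k)) = (*) (D (x + s *\<^sub>R h + t *\<^sub>R k))"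
        using linear_cmul[OF has_derivative_linear[OF D(1)[OF i]]] D(2) by (simp add: fun_eq_iff)
      ultimately show ?thesis by (simp add: has_field_derivative_def)
    qed
    have "\<exists>t>0. t < d \<and> f' (x + s *\<^sub>R h + d *\<^sub>R k) h - f' (x + s *\<^sub>R h + 0 *\<^sub>R k) h = (d - 0) * D (x + s *\<^sub>R h + t *\<^sub>R k)"
      by (rule MVT2) (use d in \<open>auto intro!: 2\<close>)
    then obtain t where t: "0 < t" "t < d"
      "f' (x + s *\<^sub>R h + d *\<^sub>R k) h - f' (x + s *\<^sub>R h + 0 *\<^sub>R k) h = d * D (x + s *\<^sub>R h + t *\<^sub>R k)"
      by auto
    have "f (x + d *\<^sub>R h + d *\<^sub>R k) - f (x + d *\<^sub>R h) - f (x + d *\<^sub>R k) + f x = d * d * D (x + s *\<^sub>R h + t *\<^sub>R k)"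
      using s(3) unfolding t(3) by simp
    then show ?thesis using s(1,2) t(1,2) by blast
  qed
  show ?thesis
  proof (rule ccontr)
    assume ne: "Dh x k \<noteq> Dk x h"
    \<comment> \<open>Half the gap: equal values lying within \<open>\<epsilon>\<close> of the two
      derivatives would force the gap below itself.\<close>
    define \<epsilon> where "\<epsilon> = \<bar>Dh x k - Dk x h\<bar> / 2"
    have \<epsilon>: "\<epsilon> > 0" using ne unfolding \<epsilon>_def by simp
    have "isCont (\<lambda>y. Dh y k) x" "isCont (\<lambda>y. Dk y h) x"
      using ch ck W x continuous_on_eq_continuous_at by blast+
    then obtain d1 d2 where d1: "d1 > 0" "\<And>y. dist y x < d1 \<Longrightarrow> dist (Dh y k) (Dh x k) < \<epsilon>"
      and d2: "d2 > 0" "\<And>y. dist y x < d2 \<Longrightarrow> dist (Dk y h) (Dk x h) < \<epsilon>"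
      unfolding continuous_at_eps_delta using \<epsilon> by metis
    define m where "m = min e (min d1 d2)"
    \<comment> \<open>Then \<open>d * c\<close> is half of \<open>m\<close>, so all intermediate
      points lie in the domain and within both continuity radii.\<close>
    define d where "d = m / (2 * c)"
    have m: "m > 0" using e d1 d2 unfolding m_def by simp
    have d: "d > 0" "d * c < m" using m c unfolding d_def by (auto simp: field_simps)
    have near: "dist (x + s *\<^sub>R h + t *\<^sub>R k) x < m" if "0 < s" "s < d" "0 < t" "t < d" for s t
    proof -
      have "norm (s *\<^sub>R h + t *\<^sub>R k) \<le> \<bar>s\<bar> * norm h + \<bar>t\<bar> * norm k"
        using norm_triangle_ineq[of "s *\<^sub>R h" "t *\<^sub>R k"] by simp
      also have "\<dots> \<le> d * norm h + d * norm k"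
        using that by (intro add_mono mult_right_mono) auto
      also have "\<dots> \<le> d * c" unfolding c_def using d by (simp add: algebra_simps)
      finally show ?thesis using d by (simp add: dist_norm add.assoc)
    qed
    have dce: "d * c < e" using d m_def by simp
    obtain s t where st: "0 < s" "s < d" "0 < t" "t < d"
      "f (x + d *\<^sub>R h + d *\<^sub>R k) - f (x + d *\<^sub>R h) - f (x + d *\<^sub>R k) + f x = d * d * Dh (x + s *\<^sub>R h + t *\<^sub>R k) k"
      using key[of d h k Dh "\<lambda>y. Dh y k"] d(1) dce inW[OF _ _ dce] fh unfolding c_def by blast
    have inW': "x + s *\<^sub>R k + t *\<^sub>R h \<in> W" if "\<bar>s\<bar> \<le> d" "\<bar>t\<bar> \<le> d" for s t
      using inW[OF that(2,1) dce] by (simp add: algebra_simps)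
    obtain s' t' where st': "0 < s'" "s' < d" "0 < t'" "t' < d"
      "f (x + d *\<^sub>R k + d *\<^sub>R h) - f (x + d *\<^sub>R k) - f (x + d *\<^sub>R h) + f x = d * d * Dk (x + s' *\<^sub>R k + t' *\<^sub>R h) h"
      using key[of d k h Dk "\<lambda>y. Dk y h"] d(1) dce inW' fk unfolding c_def by (metis add.commute)
    have "d * d * Dh (x + s *\<^sub>R h + t *\<^sub>R k) k = d * d * Dk (x + t' *\<^sub>R h + s' *\<^sub>R k) h"
      using st(5) st'(5) by (simp add: algebra_simps)
    then have "Dh (x + s *\<^sub>R h + t *\<^sub>R k) k = Dk (x + t' *\<^sub>R h + s' *\<^sub>R k) h" using d by simp
    moreover have "dist (Dh (x + s *\<^sub>R h + t *\<^sub>R k) k) (Dh x k) < \<epsilon>"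
      using d1 near[OF st(1-4)] unfolding m_def by simp
    moreover have "dist (Dk (x + t' *\<^sub>R h + s' *\<^sub>R k) h) (Dk x h) < \<epsilon>"
      using d2 near[OF st'(3,4,1,2)] unfolding m_def by simp
    ultimately show False unfolding \<epsilon>_def dist_real_def by (simp add: abs_if split: if_splits)
  qed
qed

lemma smooth_on_second_derivative_symmetric:
  fixes f :: "'a::real_normed_vector \<Rightarrow> 'b::euclidean_space"
  assumes W: "open W" and x: "x \<in> W" and f: "smooth_on W f"
  shows "frechet_derivative (\<lambda>y. frechet_derivative f (at y) h) (at x) k =
    frechet_derivative (\<lambda>y. frechet_derivative f (at y) k) (at x) h" (is "?L = ?R")
proof (rule euclidean_eqI)
  fix b :: 'b assume "b \<in> Basis"
  let ?D = "\<lambda>h y. frechet_derivative (\<lambda>y. frechet_derivative f (at y) h) (at y)"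
  note s = smooth_on_frechet_derivative
  have lin: "bounded_linear (\<lambda>v::'b. v \<bullet> b)" by (rule bounded_linear_inner_left)
  have c: "continuous_on W (\<lambda>y. ?D h y k \<bullet> b)" for h k
    using smooth_on_continuous_on[OF s[OF s[OF f]]] by (intro continuous_intros)
  show "?L \<bullet> b = ?R \<bullet> b"
    by (rule symmetric_second_derivative_real[OF W x, of "\<lambda>y. f y \<bullet> b" "\<lambda>y v. frechet_derivative f (at y) v \<bullet> b"
        h "\<lambda>y v. ?D h y v \<bullet> b" k "\<lambda>y v. ?D k y v \<bullet> b"])
      (auto intro!: bounded_linear.has_derivative[OF lin] smooth_onD[OF f] smooth_onD[OF s[OF f]] c)
qed

section \<open>Bilinear algebra of complex 3-space\<close>

definition ccross :: "complex^3 \<Rightarrow> complex^3 \<Rightarrow> complex^3" where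
  "ccross a b = vector [a$2 * b$3 - a$3 * b$2, a$3 * b$1 - a$1 * b$3, a$1 * b$2 - a$2 * b$1]"

text \<open>Complex bilinear, without conjugation; the Hermitian product is written
  \<open>bdot a (vcnj b)\<close>.\<close>

definition bdot :: "complex^3 \<Rightarrow> complex^3 \<Rightarrow> complex" where
  "bdot a b = (\<Sum>i\<in>UNIV. a$i * b$i)"

definition vcnj :: "complex^3 \<Rightarrow> complex^3" where
  "vcnj a = (\<chi> i. cnj (a$i))"

lemma vcnj_nth [simp]: "vcnj a $ i = cnj (a $ i)"
  by (simp add: vcnj_def)

lemmas cvec_simps = ccross_def bdot_def vec_eq_iff forall_3 sum_3 vector_3 scaleR_conv_of_real[where 'a = complex]

lemma vcnj_vcnj [simp]: "vcnj (vcnj a) = a"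
  by (simp add: vec_eq_iff)

lemma vcnj_linear:
  "vcnj (a + b) = vcnj a + vcnj b" "vcnj (a - b) = vcnj a - vcnj b" "vcnj (c *s a) = cnj c *s vcnj a"
  "vcnj (r *\<^sub>R a) = r *\<^sub>R vcnj a"
  by (simp_all add: cvec_simps)

lemma bdot_linear:
  "bdot (a + b) c = bdot a c + bdot b c" "bdot (a - b) c = bdot a c - bdot b c"
  "bdot (k *s a) c = k * bdot a c" "bdot c (a + b) = bdot c a + bdot c b"
  "bdot c (a - b) = bdot c a - bdot c b" "bdot c (k *s a) = k * bdot c a"
  "bdot (r *\<^sub>R a) c = of_real r * bdot a c" "bdot c (r *\<^sub>R a) = of_real r * bdot c a"
  by (simp_all add: cvec_simps algebra_simps)

lemma ccross_linear:
  "ccross (a + b) c = ccross a c + ccross b c" "ccross (a - b) c = ccross a c - ccross b c"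
  "ccross (k *s a) c = k *s ccross a c" "ccross c (a + b) = ccross c a + ccross c b"
  "ccross c (a - b) = ccross c a - ccross c b" "ccross c (k *s a) = k *s ccross c a"
  "ccross (r *\<^sub>R a) c = r *\<^sub>R ccross a c" "ccross c (r *\<^sub>R a) = r *\<^sub>R ccross c a"
  by (simp_all add: cvec_simps algebra_simps)

lemma vcnj_ccross: "vcnj (ccross a b) = ccross (vcnj a) (vcnj b)"
  by (simp add: cvec_simps)

lemma cnj_bdot: "cnj (bdot a b) = bdot (vcnj a) (vcnj b)"
  by (simp add: cvec_simps)

lemma bdot_commute: "bdot a b = bdot b a"
  by (simp add: cvec_simps algebra_simps)

lemma bdot_ccross_ccross: "bdot (ccross a b) (ccross c d) = bdot a c * bdot b d - bdot a d * bdot b c"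
  by (simp add: cvec_simps algebra_simps)

lemma bdot_ccross_left: "bdot (ccross a b) c = bdot a (ccross b c)"
  by (simp add: cvec_simps algebra_simps)

lemma ccross_skew: "ccross a b = - ccross b a"
  by (simp add: cvec_simps algebra_simps)

lemma ccross_jacobi: "ccross a (ccross b c) - ccross b (ccross a c) = ccross (ccross a b) c"
  by (simp add: cvec_simps algebra_simps)

lemma bdot_ccross_skew: "bdot (ccross r a) b = - bdot a (ccross r b)"
  by (simp add: cvec_simps algebra_simps)

lemma bounded_linear_vcnj: "bounded_linear vcnj"
  by (auto simp: linear_conv_bounded_linear[symmetric] linear_iff vcnj_linear)

lemma bounded_bilinear_bdot: "bounded_bilinear bdot"
  by (auto simp: bilinear_conv_bounded_bilinear[symmetric] bilinear_def linear_iff bdot_linear scaleR_conv_of_real[where 'a = complex])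

lemma bounded_bilinear_ccross: "bounded_bilinear ccross"
  by (auto simp: bilinear_conv_bounded_bilinear[symmetric] bilinear_def linear_iff ccross_linear)

section \<open>Unitary bases and the algebra of their derivatives\<close>

definition unitary_basis :: "(3 \<Rightarrow> complex^3) \<Rightarrow> bool" where
  "unitary_basis z \<longleftrightarrow> (\<forall>i j. bdot (z i) (vcnj (z j)) = (if i = j then 1 else 0))"

text \<open>Orthonormality says that the matrix with rows \<open>z i\<close> times its adjoint is
  the identity. A one-sided inverse of a square matrix is two-sided, and the reverse product is the
  completeness relation.\<close>

lemma unitary_basis_expand:
  assumes "unitary_basis z"
  shows "x = (\<Sum>l\<in>UNIV. bdot x (vcnj (z l)) *s z l)"
proof -
  define A :: "complex^3^3" where "A = (\<chi> i j. z i $ j)"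
  define B :: "complex^3^3" where "B = (\<chi> i j. cnj (z j $ i))"
  have "A ** B = mat 1"
    using assms unfolding unitary_basis_def bdot_def
    by (simp add: matrix_matrix_mult_def A_def B_def vec_eq_iff mat_def)
  then have "B ** A = mat 1" by (rule matrix_left_right_inverse[THEN iffD1])
  then have BA: "(\<Sum>l\<in>UNIV. cnj (z l $ i) * z l $ j) = (if i = j then 1 else 0)" for i j
    by (simp add: matrix_matrix_mult_def A_def B_def vec_eq_iff mat_def)
  have "(\<Sum>l\<in>UNIV. bdot x (vcnj (z l)) *s z l) $ j = x $ j" for j
  proof -
    have "(\<Sum>l\<in>UNIV. bdot x (vcnj (z l)) *s z l) $ j = (\<Sum>l\<in>UNIV. \<Sum>i\<in>UNIV. x $ i * (cnj (z l $ i) * z l $ j))"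
      by (simp add: bdot_def sum_distrib_right mult.assoc)
    also have "\<dots> = (\<Sum>i\<in>UNIV. x $ i * (\<Sum>l\<in>UNIV. cnj (z l $ i) * z l $ j))"
      by (subst sum.swap) (simp add: sum_distrib_left)
    also have "\<dots> = x $ j" by (simp add: BA if_distrib cong: if_cong)
    finally show ?thesis .
  qed
  then show ?thesis by (simp add: vec_eq_iff)
qed

lemma unitary_basis_vcnj: "unitary_basis z \<Longrightarrow> unitary_basis (\<lambda>i. vcnj (z i))"
  unfolding unitary_basis_def using bdot_commute by simp

lemma unitary_basis_parseval:
  assumes "unitary_basis z"
  shows "(\<Sum>l\<in>UNIV. bdot x (vcnj (z l)) * bdot y (z l)) = bdot x y"
proof -
  have "bdot x y = bdot (\<Sum>l\<in>UNIV. bdot x (vcnj (z l)) *s z l) y"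
    using unitary_basis_expand[OF assms, of x] by simp
  then show ?thesis by (simp add: sum_3 bdot_linear bdot_commute[of _ y])
qed

text \<open>With \<open>Z\<close> the unitary matrix whose rows are the basis vectors, the Gram
  matrix is \<open>Z\<close> times its transpose, a product of unitary matrices.\<close>

lemma gram_unitary:
  assumes "unitary_basis z"
  shows "(\<Sum>l\<in>UNIV. bdot (z i) (z l) * cnj (bdot (z j) (z l))) = (if i = j then 1 else 0)"
  using unitary_basis_parseval[OF unitary_basis_vcnj[OF assms], of "z i" "vcnj (z j)"] assms
  by (simp add: cnj_bdot unitary_basis_def)

text \<open>A cross product has zero bilinear product with both factors, so its expansion in the
  conjugate basis has a single term. The Lagrange identity gives the modulus of
  \<open>\<delta>\<close>.\<close>

lemma unitary_basis_cross:
  assumes z: "unitary_basis z"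
  defines "\<delta> \<equiv> bdot (ccross (z 1) (z 2)) (z 3)"
  shows "ccross (z 1) (z 2) = \<delta> *s vcnj (z 3)" "ccross (z 2) (z 3) = \<delta> *s vcnj (z 1)"
    "ccross (z 3) (z 1) = \<delta> *s vcnj (z 2)" "\<delta> * cnj \<delta> = 1"
proof -
  have det: "bdot (ccross (z 2) (z 3)) (z 1) = \<delta>" "bdot (ccross (z 3) (z 1)) (z 2) = \<delta>"
    "bdot (ccross a b) a = 0" "bdot (ccross a b) b = 0" for a b
    unfolding \<delta>_def by (simp_all add: cvec_simps algebra_simps)
  note ex = unitary_basis_expand[OF unitary_basis_vcnj[OF z]]
  show 1: "ccross (z 1) (z 2) = \<delta> *s vcnj (z 3)" "ccross (z 2) (z 3) = \<delta> *s vcnj (z 1)"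
    "ccross (z 3) (z 1) = \<delta> *s vcnj (z 2)"
    using ex[of "ccross (z 1) (z 2)"] ex[of "ccross (z 2) (z 3)"] ex[of "ccross (z 3) (z 1)"]
    by (simp_all add: sum_3 det \<delta>_def[symmetric])
  have "bdot (ccross (z 1) (z 2)) (ccross (vcnj (z 1)) (vcnj (z 2))) = 1"
    using z by (simp add: bdot_ccross_ccross unitary_basis_def)
  then show "\<delta> * cnj \<delta> = 1"
    using z by (simp add: vcnj_ccross[symmetric] 1 vcnj_linear bdot_linear bdot_commute mult.commute unitary_basis_def)
qed

text \<open>Algebraic core of the exterior derivative of the connection matrix \<open>P\<close>:
  \<open>a\<close> and \<open>a'\<close> are frame derivatives in two directions, \<open>x\<close>
  is their common second derivative, \<open>s\<close> and \<open>s'\<close> are the derivatives of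
  \<open>r'\<close> and \<open>r\<close>. The term \<open>x\<close> cancels, and the rotations
  survive only through their curvature \<open>s - s' - ccross r r'\<close>.\<close>

lemma curvature_algebra:
  assumes z: "unitary_basis z"
    and a: "\<And>j. a j = ccross r (z j) + (\<Sum>m\<in>UNIV. P j m *s z m)"
    and a': "\<And>j. a' j = ccross r' (z j) + (\<Sum>m\<in>UNIV. P' j m *s z m)"
    and P: "\<And>l m. cnj (P l m) = - P m l" and P': "\<And>l m. cnj (P' l m) = - P' m l"
    and r: "vcnj r = r" "vcnj r' = r'"
  shows "bdot (x - ccross s (z j) - ccross r' (a j)) (vcnj (z l)) + bdot (a' j - ccross r' (z j)) (vcnj (a l))
    - (bdot (x - ccross s' (z j) - ccross r (a' j)) (vcnj (z l)) + bdot (a j - ccross r (z j)) (vcnj (a' l)))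
    = (\<Sum>m\<in>UNIV. P j m * P' m l - P' j m * P m l) - bdot (ccross (s - s' - ccross r r') (z j)) (vcnj (z l))"
proof -
  define H where "H x y = bdot x (vcnj y)" for x y
  have Hl: "H (x + y) w = H x w + H y w" "H (x - y) w = H x w - H y w" "H (c *s x) w = c * H x w"
    "H w (x + y) = H w x + H w y" "H w (c *s x) = cnj c * H w x" for x y w c
    by (simp_all add: H_def bdot_linear vcnj_linear)
  have Hz: "H (z i) (z j) = (if i = j then 1 else 0)" for i j
    using z by (simp add: H_def unitary_basis_def)
  have Hr: "H x (ccross r y) = - H (ccross r x) y" "H x (ccross r' y) = - H (ccross r' x) y" for x y
    by (simp_all add: H_def vcnj_ccross r bdot_ccross_skew)
  \<comment> \<open>By the Jacobi identity the commutator of two infinitesimal rotations is the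
    rotation by their cross product.\<close>
  have jac: "H (ccross r' (ccross r (z j))) (z l) = H (ccross r (ccross r' (z j))) (z l) - H (ccross (ccross r r') (z j)) (z l)"
    by (simp add: ccross_jacobi[symmetric] Hl)
  have "j = 1 \<or> j = 2 \<or> j = 3" "l = 1 \<or> l = 2 \<or> l = 3" using exhaust_3 by blast+
  then show ?thesis
    unfolding H_def[symmetric] a a'
    by (auto simp: sum_3 ccross_linear Hl Hz Hr P P' jac algebra_simps)
qed

section \<open>Unitary symmetric matrices\<close>

lemma Im_mult_cnj_eq_0: "Im (x * cnj y) = 0 \<Longrightarrow> x * cnj y = y * cnj x"
  by (simp add: complex_eq_iff algebra_simps)

text \<open>The relations \<open>c1\<close> to \<open>c4\<close> come from the Codazzi equation.
  Comparing moduli of the null components gives \<open>cmod p = cmod q\<close> and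
  \<open>cmod r = cmod s\<close>; a square root of \<open>p / cnj q\<close> is then a phase that
  makes these components conjugate pairs, and unitarity settles the remaining entries.\<close>

lemma gram_common_phase:
  fixes S :: "3 \<Rightarrow> 3 \<Rightarrow> complex"
  assumes sym: "\<And>i j. S i j = S j i"
    and unit: "\<And>i j. (\<Sum>l\<in>UNIV. S i l * cnj (S j l)) = (if i = j then 1 else 0)"
    and c1: "Im ((S 1 1 + 2 * (S 2 2 + S 3 3)) * cnj (S 2 2 - S 3 3)) = 0"
    and c2: "Im ((S 1 1 + 2 * (S 2 2 + S 3 3)) * cnj (S 2 3)) = 0"
    and c3: "Im (S 1 2 * cnj (S 2 2 - S 3 3)) = 2 * Im (S 1 3 * cnj (S 2 3))"
    and c4: "Im (S 1 3 * cnj (S 2 2 - S 3 3)) = - 2 * Im (S 1 2 * cnj (S 2 3))"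
    and nz: "S 1 2 \<noteq> 0 \<or> S 1 3 \<noteq> 0"
  obtains \<epsilon> R where "\<epsilon> * cnj \<epsilon> = 1" "\<And>i j. S i j = \<epsilon> * of_real (R i j)"
proof -
  define a b c d f m where "a = S 1 1" and "b = S 1 2" and "c = S 1 3" and "d = S 2 2 - S 3 3"
    and "f = S 2 3" and "m = S 2 2 + S 3 3"
  note defs = a_def b_def c_def d_def f_def m_def
  \<comment> \<open>Components of \<open>S\<close> on \<open>e\<^sub>1\<close> and the null vectors \<open>e\<^sub>2 \<plusminus> \<i> e\<^sub>3\<close>, in which the hypotheses become
    the two equations \<open>k1\<close> and \<open>k2\<close>.\<close>
  define p q r s z where "p = b + \<i> * c" and "q = b - \<i> * c" and "r = d + 2 * \<i> * f"
    and "s = d - 2 * \<i> * f" and "z = a + 2 * m"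
  note defs' = p_def q_def r_def s_def z_def
  have ii: "\<i> * (\<i> * x) = - x" for x by (simp add: mult.assoc[symmetric])
  define U where "U i j = (\<Sum>l\<in>UNIV. S i l * cnj (S j l))" for i j
  have U: "U i j = (if i = j then 1 else 0)" for i j using unit by (simp add: U_def)
  have syms: "S 2 1 = S 1 2" "S 3 1 = S 1 3" "S 3 2 = S 2 3" using sym by auto
  have zd: "z * cnj d = d * cnj z" "z * cnj f = f * cnj z"
    unfolding z_def a_def m_def d_def f_def
    by (rule Im_mult_cnj_eq_0[OF c1], rule Im_mult_cnj_eq_0[OF c2])
  have k1: "r * cnj z = cnj s * z"
  proof -
    have "r * cnj z - cnj s * z = (d * cnj z - z * cnj d) + 2 * \<i> * (f * cnj z - z * cnj f)"
      by (simp add: r_def s_def algebra_simps)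
    then show ?thesis using zd by simp
  qed
  have k2: "r * cnj q = cnj s * p"
  proof -
    have "r * cnj q - cnj s * p = ((d * cnj b - cnj d * b) - 2 * (f * cnj c - cnj f * c))
        + \<i> * (2 * (f * cnj b - cnj f * b) + (d * cnj c - cnj d * c))"
      by (simp add: r_def s_def p_def q_def algebra_simps ii)
    moreover have "(d * cnj b - cnj d * b) - 2 * (f * cnj c - cnj f * c) = 0"
      "2 * (f * cnj b - cnj f * b) + (d * cnj c - cnj d * c) = 0"
      using c3 c4 by (simp_all add: defs complex_eq_iff algebra_simps)
    ultimately show ?thesis by simp
  qed
  have u1: "2 * a * cnj q + p * cnj m + q * cnj s = 0"
  proof -
    have "2 * a * cnj q + p * cnj m + q * cnj s = 2 * (U 1 2 + \<i> * U 1 3)"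
      by (simp add: defs' defs U_def sum_3 syms algebra_simps ii)
    then show ?thesis by (simp add: U)
  qed
  have u2: "2 * p * cnj q + r * cnj m + m * cnj s = 0"
  proof -
    have "2 * p * cnj q + r * cnj m + m * cnj s = 2 * (U 2 2 - U 3 3 + \<i> * (U 2 3 + U 3 2))"
      by (simp add: defs' defs U_def sum_3 syms algebra_simps ii)
    then show ?thesis by (simp add: U)
  qed
  have n1: "2 * (p * cnj p) + r * cnj r + m * cnj m = 4"
  proof -
    have "2 * (p * cnj p) + r * cnj r + m * cnj m = 2 * (U 2 2 + U 3 3 - \<i> * (U 2 3 - U 3 2))"
      by (simp add: defs' defs U_def sum_3 syms algebra_simps ii)
    then show ?thesis by (simp add: U)
  qed
  have n2: "2 * (q * cnj q) + s * cnj s + m * cnj m = 4"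
  proof -
    have "2 * (q * cnj q) + s * cnj s + m * cnj m = 2 * (U 2 2 + U 3 3 + \<i> * (U 2 3 - U 3 2))"
      by (simp add: defs' defs U_def sum_3 syms algebra_simps ii)
    then show ?thesis by (simp add: U)
  qed
  have cn: "2 * (cmod p)\<^sup>2 + (cmod r)\<^sup>2 = 2 * (cmod q)\<^sup>2 + (cmod s)\<^sup>2"
  proof -
    have "complex_of_real (2 * (cmod p)\<^sup>2 + (cmod r)\<^sup>2) = complex_of_real (2 * (cmod q)\<^sup>2 + (cmod s)\<^sup>2)"
      using n1 n2 by (simp only: of_real_add of_real_mult complex_norm_square of_real_numeral)
        (metis add_right_cancel)
    then show ?thesis using of_real_eq_iff by blast
  qed
  have prod: "cmod r * cmod q = cmod s * cmod p"
    using arg_cong[OF k2, of cmod] by (simp add: norm_mult)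
  \<comment> \<open>If one of the moduli of \<open>p\<close>, \<open>q\<close> were larger,
    \<open>cn\<close> would order those of \<open>r\<close>, \<open>s\<close> the opposite way, and
    the two products in \<open>prod\<close> would differ.\<close>
  have pq: "cmod p = cmod q"
  proof (rule ccontr)
    assume "cmod p \<noteq> cmod q"
    then consider "cmod q < cmod p" | "cmod p < cmod q" by linarith
    then show False
    proof cases
      case 1
      then have "(cmod q)\<^sup>2 < (cmod p)\<^sup>2" by (simp add: power_strict_mono)
      then have "(cmod r)\<^sup>2 < (cmod s)\<^sup>2" using cn by linarith
      then have "cmod r < cmod s" by (simp add: power_less_imp_less_base)
      then show ?thesis using 1 prod mult_strict_mono'[of "cmod r" "cmod s" "cmod q" "cmod p"] by simp
    next
      case 2
      then have "(cmod p)\<^sup>2 < (cmod q)\<^sup>2" by (simp add: power_strict_mono)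
      then have "(cmod s)\<^sup>2 < (cmod r)\<^sup>2" using cn by linarith
      then have "cmod s < cmod r" by (simp add: power_less_imp_less_base)
      then show ?thesis using 2 prod mult_strict_mono'[of "cmod s" "cmod r" "cmod p" "cmod q"] by simp
    qed
  qed
  have rs: "cmod r = cmod s" using cn pq by simp
  have p0: "p \<noteq> 0"
  proof
    assume "p = 0"
    then have "p = 0" "q = 0" using pq by auto
    moreover have "2 * b = p + q" "2 * \<i> * c = p - q" by (simp_all add: p_def q_def)
    ultimately show False using nz by (simp add: b_def c_def)
  qed
  then have q0: "q \<noteq> 0" using pq by auto
  \<comment> \<open>If \<open>s\<close> vanished, so would \<open>r\<close>, and \<open>u2\<close>
    would leave \<open>2 * p * cnj q = 0\<close>.\<close>
  have s0: "s \<noteq> 0" using u2 p0 q0 rs by auto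
  \<comment> \<open>Dividing \<open>S\<close> by this phase makes \<open>p\<close>, \<open>q\<close>
    conjugate to each other; \<open>k2\<close> carries this over to \<open>r\<close>,
    \<open>s\<close>, and then \<open>k1\<close> makes \<open>z\<close> real.\<close>
  define \<epsilon> where "\<epsilon> = csqrt (p / cnj q)"
  have e2: "\<epsilon> * \<epsilon> * cnj q = p" using q0 unfolding \<epsilon>_def by (simp add: power2_eq_square[symmetric])
  have "(cmod \<epsilon>)\<^sup>2 = cmod (\<epsilon>\<^sup>2)" by (simp add: norm_power)
  also have "\<dots> = 1" using pq q0 unfolding \<epsilon>_def by (simp add: norm_divide)
  finally have ee: "\<epsilon> * cnj \<epsilon> = 1" using complex_norm_square[of \<epsilon>] by simp
  have r2: "r = \<epsilon> * \<epsilon> * cnj s"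
  proof -
    have "(r - \<epsilon> * \<epsilon> * cnj s) * cnj q = 0" using k2 e2 by (simp add: algebra_simps)
    then show ?thesis using q0 by simp
  qed
  have z2: "z = \<epsilon> * \<epsilon> * cnj z"
  proof -
    have "(z - \<epsilon> * \<epsilon> * cnj z) * cnj s = 0" using k1 r2 by (auto simp: algebra_simps)
    then show ?thesis using s0 by simp
  qed
  define e where "e = cnj \<epsilon>"
  have ce: "cnj e = \<epsilon>" "e * \<epsilon> = 1" "\<epsilon> * e = 1" using ee by (simp_all add: e_def mult.commute)
  have eex: "\<epsilon> * (e * x) = x" "e * (\<epsilon> * x) = x" for x using ce by (simp_all add: mult.assoc[symmetric])
  define P Q where "P = e * p" and "Q = e * q"
  define A M where "A = e * a" and "M = e * m"
  define T where "T = e * r"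
  have PQ: "P = cnj Q"
    unfolding P_def Q_def e2[symmetric] using ce by (simp add: mult.assoc[symmetric])
  have Ts: "T = cnj (e * s)" unfolding T_def r2 using ce by (simp add: mult.assoc[symmetric])
  have Zr: "e * z = cnj (e * z)"
  proof -
    have "e * z = e * (\<epsilon> * \<epsilon> * cnj z)" using z2 by simp
    also have "\<dots> = \<epsilon> * cnj z" using ce by (simp add: mult.assoc[symmetric])
    also have "\<dots> = cnj (e * z)" by (simp add: ce)
    finally show ?thesis .
  qed
  have u2': "P * P + T * of_real (Re M) = 0"
  proof -
    have "2 * p * cnj q + r * cnj m + m * cnj s = 2 * (P * cnj Q) + T * cnj M + M * cnj (e * s)"
      unfolding P_def Q_def T_def M_def by (simp add: ce eex algebra_simps)
    also have "\<dots> = 2 * (P * P) + T * (M + cnj M)" by (simp add: PQ Ts algebra_simps)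
    also have "\<dots> = 2 * (P * P + T * of_real (Re M))" unfolding complex_add_cnj by (simp add: algebra_simps)
    finally have "2 * (P * P + T * of_real (Re M)) = 0" unfolding u2 by (rule HOL.sym)
    then show ?thesis by (simp only: mult_eq_0_iff) simp
  qed
  have u1': "2 * A * P + P * cnj M + cnj P * T = 0"
  proof -
    have "2 * a * cnj q + p * cnj m + q * cnj s = 2 * A * cnj Q + P * cnj M + Q * cnj (e * s)"
      unfolding P_def Q_def A_def M_def by (simp add: ce eex algebra_simps)
    then show ?thesis using u1 PQ Ts by simp
  qed
  have P0: "P \<noteq> 0" using p0 ce unfolding P_def by auto
  \<comment> \<open>Eliminating \<open>T\<close> between \<open>u1'\<close> and \<open>u2'\<close>
    shows that \<open>Re M\<close> times \<open>2 * A + cnj M\<close> is the real number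
    \<open>P * cnj P\<close>. Together with the reality of \<open>e * z\<close>, this forces both
    imaginary parts to vanish.\<close>
  have "2 * (Im A) = Im M"
  proof -
    have ReM: "Re M \<noteq> 0" using u2' P0 by auto
    have "P * (of_real (Re M) * (2 * A + cnj M) - P * cnj P) = of_real (Re M) * (2 * A * P + P * cnj M + cnj P * T)
        - cnj P * (P * P + T * of_real (Re M))"
      by (simp add: algebra_simps)
    then have "of_real (Re M) * (2 * A + cnj M) = P * cnj P" using u1' u2' P0 by simp
    then have "Im (of_real (Re M) * (2 * A + cnj M)) = 0" by simp
    then show ?thesis using ReM by simp
  qed
  moreover have "Im A + 2 * Im M = 0"
  proof -
    have "Im (cnj (e * z)) = - Im (e * z)" by (rule cnj.simps)
    then have "Im (e * z) = 0" using arg_cong[OF Zr, of Im] by linarith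
    then show ?thesis by (simp add: z_def A_def M_def algebra_simps)
  qed
  ultimately have AM: "Im A = 0" "Im M = 0" by auto
  have bc: "Im (e * b) = 0" "Im (e * c) = 0"
  proof -
    have "2 * (e * b) = P + Q" "2 * \<i> * (e * c) = P - Q"
      by (simp_all add: P_def Q_def p_def q_def algebra_simps)
    then have "2 * (e * b) = cnj Q + Q" "2 * \<i> * (e * c) = cnj Q - Q" by (simp_all only: PQ)
    then show "Im (e * b) = 0" "Im (e * c) = 0" by (auto simp: complex_eq_iff algebra_simps)
  qed
  have df: "Im (e * d) = 0" "Im (e * f) = 0"
  proof -
    have "2 * (e * d) = T + e * s" "4 * \<i> * (e * f) = T - e * s"
      by (simp_all add: T_def r_def s_def algebra_simps)
    then have "2 * (e * d) = cnj (e * s) + e * s" "4 * \<i> * (e * f) = cnj (e * s) - e * s" by (simp_all only: Ts)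
    then show "Im (e * d) = 0" "Im (e * f) = 0" by (auto simp: complex_eq_iff algebra_simps)
  qed
  have dm: "Im (e * S 2 2) = 0" "Im (e * S 3 3) = 0"
  proof -
    have "2 * (e * S 2 2) = M + e * d" "2 * (e * S 3 3) = M - e * d"
      by (simp_all add: M_def m_def d_def algebra_simps)
    then show "Im (e * S 2 2) = 0" "Im (e * S 3 3) = 0" using AM df by (auto simp: complex_eq_iff algebra_simps)
  qed
  have im: "Im (e * S i j) = 0" for i j
    using AM bc df dm exhaust_3[of i] exhaust_3[of j] unfolding A_def defs by (auto simp: syms)
  have "S i j = \<epsilon> * of_real (Re (e * S i j))" for i j
  proof -
    have "of_real (Re (e * S i j)) = e * S i j" using im[of i j] by (simp add: complex_eq_iff)
    then show ?thesis using ce by (simp add: mult.assoc[symmetric])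
  qed
  then show thesis using that[OF ee, of "\<lambda>i j. Re (e * S i j)"] by blast
qed

text \<open>The imaginary part of \<open>P\<close> turns the phase of entry (i,j) at the rate
  \<open>c i + c j\<close>, and nonzero entries that keep a common phase must turn at equal rates.
  The rates are -4\<mu> at (1,1), -\<mu> at (1,2) and (1,3), and 2\<mu> on the lower block, so only
  (1,2), (1,3) and their transposes could be nonzero.\<close>

lemma common_phase_derivative:
  fixes S D :: "3 \<Rightarrow> 3 \<Rightarrow> complex" and R :: "3 \<Rightarrow> 3 \<Rightarrow> real"
  assumes sym: "\<And>i j. S i j = S j i"
    and unit: "\<And>i j. (\<Sum>l\<in>UNIV. S i l * cnj (S j l)) = (if i = j then 1 else 0)"
    and S: "\<And>i j. S i j = \<epsilon> * of_real (R i j)" and e: "\<epsilon> * cnj \<epsilon> = 1"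
    and D: "\<And>i j. D i j = (\<Sum>m\<in>UNIV. P i m * S m j + P j m * S i m)"
    and P: "\<And>i j. Im (P i j) = (if i = j then (if i = 1 then - 2 * \<mu> else \<mu>) else 0)"
    and der: "\<And>i j k l. Im (D i j * cnj (S k l) + S i j * cnj (D k l)) = 0"
    and nz: "S 1 2 \<noteq> 0 \<or> S 1 3 \<noteq> 0"
  shows "\<mu> = 0"
proof (rule ccontr)
  assume mu: "\<mu> \<noteq> 0"
  define c where "c i = (if i = 1 then - 2 * \<mu> else \<mu>)" for i :: 3
  define G where "G i j = (\<Sum>m\<in>UNIV. Re (P i m) * R m j + Re (P j m) * R i m)" for i j
  have e0: "\<epsilon> \<noteq> 0" using e by auto
  have Rsym: "R i j = R j i" for i j using sym[of i j] S e0 by simp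
  have Peq: "P i j = of_real (Re (P i j)) + \<i> * of_real (if i = j then c i else 0)" for i j
    using P[of i j] by (auto simp: complex_eq_iff c_def)
  have D': "D i j = \<epsilon> * (of_real (G i j) + \<i> * of_real ((c i + c j) * R i j))" for i j
  proof -
    have "D i j = (\<Sum>m\<in>UNIV. \<epsilon> * (of_real (Re (P i m) * R m j + Re (P j m) * R i m)
        + \<i> * of_real ((if i = m then c i * R i j else 0) + (if j = m then c j * R i j else 0))))"
      unfolding D S by (intro sum.cong refl) (subst (1 2) Peq, auto simp: algebra_simps)
    also have "\<dots> = \<epsilon> * (of_real (G i j) + \<i> * of_real ((c i + c j) * R i j))"
      by (simp add: sum_distrib_left[symmetric] sum.distrib G_def of_real_sum[symmetric] del: of_real_sum) (simp add: algebra_simps)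
    finally show ?thesis .
  qed
  have key: "(c i + c j) * R i j * R k l = (c k + c l) * R i j * R k l" for i j k l
  proof -
    have "D i j * cnj (S k l) + S i j * cnj (D k l) =
        (\<epsilon> * cnj \<epsilon>) * ((of_real (G i j) + \<i> * of_real ((c i + c j) * R i j)) * of_real (R k l)
          + of_real (R i j) * (of_real (G k l) - \<i> * of_real ((c k + c l) * R k l)))"
      unfolding D' S by (simp add: algebra_simps)
    then have "Im (D i j * cnj (S k l) + S i j * cnj (D k l)) = (c i + c j) * R i j * R k l - (c k + c l) * R i j * R k l"
      unfolding e by simp
    then show ?thesis using der[of i j k l] by simp
  qed
  have z: "R 1 1 = 0 \<and> R 2 2 = 0 \<and> R 2 3 = 0 \<and> R 3 3 = 0"
  proof -
    consider "R 1 2 \<noteq> 0" | "R 1 3 \<noteq> 0" using nz S by auto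
    then show ?thesis
      by cases (use mu key[of 1 2 1 1] key[of 1 2 2 2] key[of 1 2 2 3] key[of 1 2 3 3]
          key[of 1 3 1 1] key[of 1 3 2 2] key[of 1 3 2 3] key[of 1 3 3 3] in \<open>auto simp: c_def\<close>)
  qed
  have u: "(\<Sum>l\<in>UNIV. R i l * R i l) = 1" for i
  proof -
    have "(\<Sum>l\<in>UNIV. S i l * cnj (S i l)) = (\<epsilon> * cnj \<epsilon>) * of_real (\<Sum>l\<in>UNIV. R i l * R i l)"
      unfolding S by (simp add: sum_distrib_left algebra_simps)
    then have "complex_of_real (\<Sum>l\<in>UNIV. R i l * R i l) = 1" unfolding e using unit[of i i] by simp
    then show ?thesis using of_real_eq_1_iff by blast
  qed
  \<comment> \<open>Rows two and three make the squares of \<open>R 1 2\<close> and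
    \<open>R 1 3\<close> equal to 1, while row one makes their sum equal to 1.\<close>
  show False using u[of 1] u[of 2] u[of 3] z Rsym[of 2 1] Rsym[of 3 1] Rsym[of 3 2] by (simp add: sum_3)
qed

text \<open>After adding \<open>\<i> * \<mu>\<close> to the diagonal of \<open>v\<close>, the
  hypotheses say that this matrix times the symmetric matrix with diagonal \<open>S22 - a\<close>,
  \<open>S33 - a\<close> is the nonzero scalar \<open>c\<close>. It is thus a multiple of the
  inverse of a symmetric matrix.\<close>

lemma eigenvector_frame_symmetric:
  fixes a :: complex
  assumes e: "v22 * (S22 - a) + v23 * S23 + \<i> * \<mu> * (S22 + a) = 0"
    "v22 * S23 + v23 * (S33 - a) + \<i> * \<mu> * S23 = 0"
    "v32 * (S22 - a) + v33 * S23 + \<i> * \<mu> * S23 = 0"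
    "v32 * S23 + v33 * (S33 - a) + \<i> * \<mu> * (S33 + a) = 0"
    and "\<mu> \<noteq> 0" "a \<noteq> 0"
  shows "v23 = v32"
proof -
  define n22 n33 c where "n22 = v22 + \<i> * \<mu>" and "n33 = v33 + \<i> * \<mu>" and "c = - 2 * \<i> * \<mu> * a"
  have n: "n22 * (S22 - a) + v23 * S23 = c" "n22 * S23 + v23 * (S33 - a) = 0"
    "v32 * (S22 - a) + n33 * S23 = 0" "v32 * S23 + n33 * (S33 - a) = c"
    using e unfolding n22_def n33_def c_def by algebra+
  have "c * v23 = (v32 * S23 + n33 * (S33 - a)) * v23" "c * v32 = (n22 * (S22 - a) + v23 * S23) * v32"
    by (simp_all add: n)
  then have "c * (v23 - v32) = n33 * (n22 * S23 + v23 * (S33 - a)) - n22 * (v32 * (S22 - a) + n33 * S23)"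
    by (simp add: algebra_simps)
  then have "c * (v23 - v32) = 0" by (simp add: n)
  then show ?thesis using assms unfolding c_def by simp
qed

section \<open>Complex coordinates on the Lie algebra\<close>

definition cz :: "imq2 \<Rightarrow> complex^3" where
  "cz x = (\<chi> i. Complex (- (fst x $ i + snd x $ i) / sqrt 3) (snd x $ i - fst x $ i))"

definition cz_inv :: "complex^3 \<Rightarrow> imq2" where
  "cz_inv c = ((\<chi> i. - (sqrt 3 * Re (c $ i) + Im (c $ i)) / 2), (\<chi> i. (Im (c $ i) - sqrt 3 * Re (c $ i)) / 2))"

lemma cz_inv_cz [simp]: "cz_inv (cz x) = x"
  by (simp add: cz_def cz_inv_def prod_eq_iff vec_eq_iff)

lemma cz_cz_inv [simp]: "cz (cz_inv c) = c"
  by (simp add: cz_def cz_inv_def vec_eq_iff complex_eq_iff field_simps)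

lemma cz_eq_iff: "cz x = cz y \<longleftrightarrow> x = y"
  by (metis cz_inv_cz)

lemma cz_linear: "cz (x + y) = cz x + cz y" "cz (x - y) = cz x - cz y" "cz (r *\<^sub>R x) = r *\<^sub>R cz x"
  by (simp_all add: cz_def vec_eq_iff complex_eq_iff field_simps)

lemma bounded_linear_cz: "bounded_linear cz"
  by (auto simp: linear_conv_bounded_linear[symmetric] linear_iff cz_linear)

definition gi :: "imq2 \<Rightarrow> imq2 \<Rightarrow> real" where
  "gi x y = 4/3 * (fst x \<bullet> fst y + snd x \<bullet> snd y) - 2/3 * (fst x \<bullet> snd y + fst y \<bullet> snd x)"

lemma gi_cz: "gi x y = Re (bdot (cz x) (vcnj (cz y)))"
  by (simp add: gi_def cz_def bdot_def sum_3 inner_vec_def field_simps)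

definition Ji :: "imq2 \<Rightarrow> imq2" where
  "Ji x = (1 / sqrt 3) *\<^sub>R (2 *\<^sub>R snd x - fst x, snd x - 2 *\<^sub>R fst x)"

lemma cz_Ji: "cz (Ji x) = \<i> *s cz x"
  by (simp add: Ji_def cz_def vec_eq_iff complex_eq_iff field_simps)

text \<open>The Lie algebra bracket: the commutator of imaginary quaternions is twice their cross
  product.\<close>

definition brk :: "imq2 \<Rightarrow> imq2 \<Rightarrow> imq2" where
  "brk x y = (2 *\<^sub>R cross3 (fst x) (fst y), 2 *\<^sub>R cross3 (snd x) (snd y))"

lemma cz_brk: "cz (brk x y) = (- 1 / sqrt 3) *\<^sub>R (2 *\<^sub>R ccross (cz x) (cz y) + ccross (cz x) (vcnj (cz y))
    + ccross (vcnj (cz x)) (cz y) - ccross (vcnj (cz x)) (vcnj (cz y)))"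
  by (simp add: brk_def cz_def cvec_simps cross3_def complex_eq_iff field_simps)

text \<open>Obtained by solving the Koszul formula. The first summand acts on \<open>y\<close> as a real rotation, the second
  one is the nearly Kaehler torsion.\<close>

definition lc :: "complex^3 \<Rightarrow> complex^3 \<Rightarrow> complex^3" where
  "lc x y = (- 1 / (2 * sqrt 3)) *\<^sub>R (2 *\<^sub>R ccross (x + vcnj x) y - ccross (vcnj x) (vcnj y))"

lemma bdot_vcnj_definite: "(\<And>y. Re (bdot x (vcnj y)) = 0) \<Longrightarrow> x = 0"
proof -
  assume "\<And>y. Re (bdot x (vcnj y)) = 0"
  then have "Re (bdot x (vcnj x)) = 0" .
  then have "(\<Sum>i\<in>UNIV. (cmod (x $ i))\<^sup>2) = 0"
    by (simp add: bdot_def complex_norm_square[symmetric] cmod_power2)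
  then show "x = 0" by (simp add: sum_nonneg_eq_0_iff vec_eq_iff)
qed

text \<open>With constant metric coefficients the Koszul formula has bracket terms only, so torsion
  and metric compatibility determine all inner products of \<open>n a b\<close>. The map
  \<open>lc\<close> has the same ones, and the metric is definite.\<close>

lemma koszul_lc:
  fixes n :: "imq2 \<Rightarrow> imq2 \<Rightarrow> imq2"
  assumes tor: "\<And>a b. n a b - n b a = brk a b"
    and met: "\<And>a b c. gi (n a b) c + gi b (n a c) = 0"
  shows "cz (n a b) = lc (cz a) (cz b)"
proof -
  have gis: "gi x y = gi y x" for x y by (simp add: gi_def inner_commute)
  have gil: "gi (x - y) w = gi x w - gi y w" for x y w by (simp add: gi_def inner_diff algebra_simps)
  have kos: "2 * gi (n a b) c = gi (brk a b) c - gi (brk b c) a + gi (brk c a) b" for c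
    using met[of a b c] met[of b a c] met[of c a b] gis[of "n b c" a] gis[of b "n a c"] gis[of "n c a" b] gis[of a "n b c"] gis[of a "n c b"]
    unfolding tor[symmetric] gil by linarith
  have "Re (bdot (cz (n a b) - lc (cz a) (cz b)) (vcnj y)) = 0" for y
  proof -
    define c where "c = cz_inv y"
    have y: "y = cz c" by (simp add: c_def)
    let ?B = "\<lambda>x y. 2 *\<^sub>R ccross x y + ccross x (vcnj y) + ccross (vcnj x) y - ccross (vcnj x) (vcnj y)"
    have "Re (bdot (2 *\<^sub>R ccross (u + vcnj u) v - ccross (vcnj u) (vcnj v)) (vcnj y)) =
        Re (bdot (?B u v) (vcnj y)) - Re (bdot (?B v y) (vcnj u)) + Re (bdot (?B y u) (vcnj v))" for u v
      by (simp add: cvec_simps algebra_simps)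
    then have "2 * Re (bdot (lc (cz a) (cz b)) (vcnj y)) = gi (brk a b) c - gi (brk b c) a + gi (brk c a) b"
      unfolding gi_cz cz_brk y[symmetric] lc_def bdot_linear(7) by (simp add: diff_divide_distrib add_divide_distrib)
    then show ?thesis using kos[of c] unfolding gi_cz y by (simp add: bdot_linear)
  qed
  then show ?thesis using bdot_vcnj_definite by fastforce
qed

section \<open>Quaternions and the Levi-Civita connection on left-invariant fields\<close>

lemma qmul_linear:
  "(x + y) \<otimes>\<^sub>q w = x \<otimes>\<^sub>q w + y \<otimes>\<^sub>q w" "w \<otimes>\<^sub>q (x + y) = w \<otimes>\<^sub>q x + w \<otimes>\<^sub>q y"
  "(x - y) \<otimes>\<^sub>q w = x \<otimes>\<^sub>q w - y \<otimes>\<^sub>q w" "w \<otimes>\<^sub>q (x - y) = w \<otimes>\<^sub>q x - w \<otimes>\<^sub>q y"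
  "(r *\<^sub>R x) \<otimes>\<^sub>q w = r *\<^sub>R (x \<otimes>\<^sub>q w)" "w \<otimes>\<^sub>q (r *\<^sub>R x) = r *\<^sub>R (w \<otimes>\<^sub>q x)"
  by (auto simp: qmul_def prod_eq_iff cross3_simps forall_3)

lemma qmul_assoc: "(x \<otimes>\<^sub>q y) \<otimes>\<^sub>q w = x \<otimes>\<^sub>q (y \<otimes>\<^sub>q w)"
  by (auto simp: qmul_def prod_eq_iff cross3_simps forall_3)

lemma qcnj_linear: "qcnj (x + y) = qcnj x + qcnj y" "qcnj (r *\<^sub>R x) = r *\<^sub>R qcnj x"
  by (simp_all add: qcnj_def prod_eq_iff)

lemma qcnj_qmul: "qcnj (x \<otimes>\<^sub>q y) = qcnj y \<otimes>\<^sub>q qcnj x"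
  by (auto simp: qmul_def qcnj_def prod_eq_iff cross3_simps forall_3)

lemma qmul_one [simp]: "(1, 0) \<otimes>\<^sub>q x = x"
  by (auto simp: qmul_def prod_eq_iff)

lemma norm_quat: "(norm (x :: quat))\<^sup>2 = fst x * fst x + snd x \<bullet> snd x"
  by (simp add: power2_norm_eq_inner inner_prod_def)

lemma qcnj_qmul_self: "norm p = 1 \<Longrightarrow> qcnj p \<otimes>\<^sub>q p = (1, 0)" "norm p = 1 \<Longrightarrow> p \<otimes>\<^sub>q qcnj p = (1, 0)"
  using norm_quat[of p] by (auto simp: qmul_def qcnj_def)

lemma qcnj_qmul_cancel: "norm p = 1 \<Longrightarrow> qcnj p \<otimes>\<^sub>q (p \<otimes>\<^sub>q x) = x" "norm p = 1 \<Longrightarrow> p \<otimes>\<^sub>q (qcnj p \<otimes>\<^sub>q x) = x"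
  by (simp_all add: qmul_assoc[symmetric] qcnj_qmul_self)

lemma fst_qcnj_qmul: "fst (qcnj p \<otimes>\<^sub>q x) = p \<bullet> x"
  by (simp add: qmul_def qcnj_def inner_prod_def)

lemma imq_linear: "imq (a + b) = imq a + imq b" "imq (r *\<^sub>R a) = r *\<^sub>R imq a" "imq (a - b) = imq a - imq b"
  by (simp_all add: imq_def)

lemma imq_commutator: "imq a \<otimes>\<^sub>q imq b - imq b \<otimes>\<^sub>q imq a = imq (2 *\<^sub>R cross3 a b)"
  by (auto simp: qmul_def imq_def prod_eq_iff cross3_simps forall_3)

lemma lt_linear:
  "lt z (a + b) = lt z a + lt z b" "lt z (r *\<^sub>R a) = r *\<^sub>R lt z a" "lt z (a - b) = lt z a - lt z b"
  by (simp_all add: lt_def imq_linear qmul_linear)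

lemma lt_inv_linear:
  "lt_inv z (a + b) = lt_inv z a + lt_inv z b" "lt_inv z (r *\<^sub>R a) = r *\<^sub>R lt_inv z a"
  "lt_inv z (a - b) = lt_inv z a - lt_inv z b"
  "lt_inv (z + z') a = lt_inv z a + lt_inv z' a" "lt_inv (r *\<^sub>R z) a = r *\<^sub>R lt_inv z a"
  by (simp_all add: lt_inv_def qmul_linear qcnj_linear)

lemma bounded_bilinear_lt_inv: "bounded_bilinear lt_inv"
  by (simp add: bilinear_conv_bounded_bilinear[symmetric] bilinear_def linear_iff lt_inv_linear)

lemma lt_inv_lt [simp]: "z \<in> S3S3 \<Longrightarrow> lt_inv z (lt z e) = e"
  by (auto simp: S3S3_def lt_inv_def lt_def qcnj_qmul_cancel imq_def)

lemma TS_iff: "w \<in> TS z \<longleftrightarrow> (\<exists>e. w = lt z e)"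
  by (auto simp: TS_def)

lemma lt_lt_inv: "z \<in> S3S3 \<Longrightarrow> w \<in> TS z \<Longrightarrow> lt z (lt_inv z w) = w"
  by (auto simp: TS_iff)

text \<open>The real part of \<open>qcnj p \<otimes>\<^sub>q w\<close> is
  \<open>p \<bullet> w\<close>, so orthogonality makes the left-translated vector imaginary.\<close>

lemma TS_I:
  assumes z: "z \<in> S3S3" and "fst z \<bullet> fst w = 0" "snd z \<bullet> snd w = 0"
  shows "w \<in> TS z"
proof -
  have "imq (snd (qcnj (fst z) \<otimes>\<^sub>q fst w)) = qcnj (fst z) \<otimes>\<^sub>q fst w"
    "imq (snd (qcnj (snd z) \<otimes>\<^sub>q snd w)) = qcnj (snd z) \<otimes>\<^sub>q snd w"
    using assms by (auto simp: imq_def prod_eq_iff fst_qcnj_qmul)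
  then have "lt z (lt_inv z w) = w"
    using z by (auto simp: lt_def lt_inv_def S3S3_def qcnj_qmul_cancel)
  then show ?thesis using TS_iff by metis
qed

lemma lt_orthogonal: "fst z \<bullet> fst (lt z e) = 0" "snd z \<bullet> snd (lt z e) = 0"
  by (simp_all add: lt_def qmul_def imq_def inner_prod_def dot_cross_self inner_add_right inner_commute)

lemma g_lt: "z \<in> S3S3 \<Longrightarrow> g z (lt z a) (lt z b) = gi a b"
  by (simp add: g_def gi_def split: prod.split)

lemma g_lt_inv: "g z w w' = gi (lt_inv z w) (lt_inv z w')"
  by (simp add: g_def gi_def split: prod.split)

lemma J_lt_inv: "J z w = lt z (Ji (lt_inv z w))"
  unfolding J_def Ji_def lt_linear by (simp add: case_prod_beta)

section \<open>The radial retraction and left-invariant vector fields\<close>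

definition nzS :: "quat2 set" where "nzS = {(p, q). p \<noteq> 0 \<and> q \<noteq> 0}"

lemma open_nzS: "open nzS"
proof -
  have "nzS = (- {0}) \<times> (- {0})" by (auto simp: nzS_def)
  then show ?thesis by (metis open_Times open_Compl closed_singleton)
qed

lemma S3S3_subset_nzS: "S3S3 \<subseteq> nzS"
  by (auto simp: S3S3_def nzS_def)

lemma retr_S3S3: "z \<in> nzS \<Longrightarrow> retr z \<in> S3S3"
  by (auto simp: nzS_def S3S3_def retr_def)

text \<open>At a unit vector, normalizing removes the radial component to first order; on tangent
  vectors nothing is removed, which makes \<open>dS\<close> of a linear map explicit.\<close>

lemma retr_derivative:
  assumes z: "z \<in> S3S3"
  shows "(retr has_derivative (\<lambda>v. (fst v - (fst z \<bullet> fst v) *\<^sub>R fst z, snd v - (snd z \<bullet> snd v) *\<^sub>R snd z))) (at z)"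
proof -
  have *: "((\<lambda>p. p /\<^sub>R norm p) has_derivative (\<lambda>v. v - (p \<bullet> v) *\<^sub>R p)) (at p)" if "norm p = 1" for p :: quat
  proof -
    have p: "p \<noteq> 0" using that by auto
    have "((\<lambda>p. inverse (norm p)) has_derivative (\<lambda>v. - (inverse (norm p) * (v \<bullet> sgn p) * inverse (norm p)))) (at p)"
      by (rule Deriv.has_derivative_inverse[OF _ has_derivative_norm[OF p]]) (use p in simp)
    from has_derivative_scaleR[OF this has_derivative_ident] show ?thesis
      using that by (simp add: sgn_div_norm inner_commute)
  qed
  have "((\<lambda>z. (fst z /\<^sub>R norm (fst z), snd z /\<^sub>R norm (snd z))) has_derivative
      (\<lambda>v. (fst v - (fst z \<bullet> fst v) *\<^sub>R fst z, snd v - (snd z \<bullet> snd v) *\<^sub>R snd z))) (at z)"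
    by (intro has_derivative_Pair has_derivative_compose[OF has_derivative_fst[OF has_derivative_ident] *]
        has_derivative_compose[OF has_derivative_snd[OF has_derivative_ident] *]) (use z in \<open>auto simp: S3S3_def\<close>)
  then show ?thesis unfolding retr_def[abs_def] .
qed

lemma dS_lt:
  assumes z: "z \<in> S3S3"
  shows "dS (\<lambda>z. lt z b) z (lt z a) =
    (fst z \<otimes>\<^sub>q imq (fst a) \<otimes>\<^sub>q imq (fst b), snd z \<otimes>\<^sub>q imq (snd a) \<otimes>\<^sub>q imq (snd b))"
proof -
  have rz: "retr z = z" using z by (auto simp: retr_def S3S3_def)
  have lin: "linear (\<lambda>z. lt z b)"
    by (auto simp: linear_iff lt_def qmul_linear)
  have "((\<lambda>x. lt (retr x) b) has_derivative
      (\<lambda>v. lt (fst v - (fst z \<bullet> fst v) *\<^sub>R fst z, snd v - (snd z \<bullet> snd v) *\<^sub>R snd z) b)) (at z)"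
    by (rule bounded_linear.has_derivative[OF _ retr_derivative[OF z]])
      (use lin linear_conv_bounded_linear in blast)
  then have "frechet_derivative ((\<lambda>z. lt z b) \<circ> retr) (at z) =
      (\<lambda>v. lt (fst v - (fst z \<bullet> fst v) *\<^sub>R fst z, snd v - (snd z \<bullet> snd v) *\<^sub>R snd z) b)"
    unfolding o_def by (rule frechet_derivative_at[symmetric])
  then show ?thesis unfolding dS_def by (simp add: lt_orthogonal) (simp add: lt_def)
qed

lemma lie_bracket_lt:
  assumes z: "z \<in> S3S3"
  shows "lie_bracket (\<lambda>z. lt z a) (\<lambda>z. lt z b) z = lt z (brk a b)"
  unfolding lie_bracket_def dS_lt[OF z]
  by (simp add: lt_def brk_def qmul_assoc qmul_linear(4)[symmetric] imq_commutator)

lemma vfield_lt: "vfield (\<lambda>z. lt z e)"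
proof -
  have bl: "bounded_linear (\<lambda>x::quat. (x \<otimes>\<^sub>q imq a, 0::quat))" "bounded_linear (\<lambda>x::quat. (0::quat, x \<otimes>\<^sub>q imq a))" for a
    by (auto simp: linear_conv_bounded_linear[symmetric] linear_iff qmul_linear)
  have id: "Ck_on k W (\<lambda>x. x)" if "open W" for k and W :: "quat2 set"
    using that by (cases k) (auto intro!: Ck_on_SucI[of W "\<lambda>x. x" "\<lambda>_ v. v"] Ck_on_const)
  \<comment> \<open>Splitting into the two quaternion factors makes each summand a linear image of a
    vector scaled by its inverse norm.\<close>
  have "Ck_on k nzS (\<lambda>x. (inverse (norm (fst x)) *\<^sub>R fst x \<otimes>\<^sub>q imq (fst e), 0) +
      (0, inverse (norm (snd x)) *\<^sub>R snd x \<otimes>\<^sub>q imq (snd e)))" for k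
  proof (intro Ck_on_add open_nzS)
    show "Ck_on k nzS (\<lambda>x. (inverse (norm (fst x)) *\<^sub>R fst x \<otimes>\<^sub>q imq (fst e), 0::quat))"
      by (intro Ck_on_bounded_linear[OF bl(1)] Ck_on_bounded_bilinear[OF bounded_bilinear_scaleR]
          Ck_on_inverse_norm bounded_linear_fst open_nzS Ck_on_bounded_linear[OF bounded_linear_fst] id)
        (auto simp: nzS_def)
    show "Ck_on k nzS (\<lambda>x. (0::quat, inverse (norm (snd x)) *\<^sub>R snd x \<otimes>\<^sub>q imq (snd e)))"
      by (intro Ck_on_bounded_linear[OF bl(2)] Ck_on_bounded_bilinear[OF bounded_bilinear_scaleR]
          Ck_on_inverse_norm bounded_linear_snd open_nzS Ck_on_bounded_linear[OF bounded_linear_snd] id)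
        (auto simp: nzS_def)
  qed
  then have "smooth_S (\<lambda>z. lt z e)"
    unfolding smooth_S_def smooth_on_def nzS_def[symmetric] by (simp add: o_def lt_def retr_def)
  then show ?thesis unfolding vfield_def TS_iff by blast
qed

text \<open>Left-invariant fields have constant inner products, so metric compatibility has no
  derivative term on them and \<open>koszul_lc\<close> applies to the coefficients
  \<open>n\<close>.\<close>

lemma levi_civita_lt:
  assumes lev: "levi_civita nabla" and z: "z \<in> S3S3"
  shows "nabla (\<lambda>z. lt z a) (\<lambda>z. lt z b) z = lt z (cz_inv (lc (cz a) (cz b)))"
proof -
  define n where "n a b = lt_inv z (nabla (\<lambda>z. lt z a) (\<lambda>z. lt z b) z)" for a b
  have aff: "affine_connection nabla"
    and tor: "\<forall>X Y. vfield X \<longrightarrow> vfield Y \<longrightarrow> (\<forall>z\<in>S3S3. nabla X Y z - nabla Y X z = lie_bracket X Y z)"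
    and met: "\<forall>X Y Z. vfield X \<longrightarrow> vfield Y \<longrightarrow> vfield Z \<longrightarrow> (\<forall>z\<in>S3S3.
        dS (\<lambda>z. g z (Y z) (Z z)) z (X z) = g z (nabla X Y z) (Z z) + g z (Y z) (nabla X Z z))"
    using lev unfolding levi_civita_def by blast+
  have "vfield (nabla (\<lambda>z. lt z a) (\<lambda>z. lt z b))" for a b
    using aff vfield_lt unfolding affine_connection_def by blast
  then have nab: "nabla (\<lambda>z. lt z a) (\<lambda>z. lt z b) z = lt z (n a b)" for a b
    unfolding n_def using lt_lt_inv z by (auto simp: vfield_def)
  have "cz (n a b) = lc (cz a) (cz b)"
  proof (rule koszul_lc)
    fix a b c
    have "nabla (\<lambda>z. lt z a) (\<lambda>z. lt z b) z - nabla (\<lambda>z. lt z b) (\<lambda>z. lt z a) z = lt z (brk a b)"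
      using tor[rule_format, OF vfield_lt vfield_lt z] lie_bracket_lt[OF z] by simp
    then have "lt_inv z (lt z (n a b - n b a)) = lt_inv z (lt z (brk a b))" by (simp add: nab lt_linear)
    then show "n a b - n b a = brk a b" using z by simp
    have "dS (\<lambda>z. g z (lt z b) (lt z c)) z (lt z a) = gi (n a b) c + gi b (n a c)"
      using met[rule_format, OF vfield_lt vfield_lt vfield_lt z] by (simp add: nab g_lt[OF z])
    moreover have "((\<lambda>z. g z (lt z b) (lt z c)) \<circ> retr has_derivative (\<lambda>v. 0)) (at z)"
      by (rule has_derivative_transform_within_open[of "\<lambda>_. gi b c" _ _ _ nzS])
        (use z S3S3_subset_nzS open_nzS in \<open>auto simp: g_lt retr_S3S3\<close>)
    then have "frechet_derivative ((\<lambda>z. g z (lt z b) (lt z c)) \<circ> retr) (at z) = (\<lambda>v. 0)"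
      by (rule frechet_derivative_at[symmetric])
    ultimately show "gi (n a b) c + gi b (n a c) = 0" by (simp add: dS_def)
  qed
  then have "n a b = cz_inv (lc (cz a) (cz b))" by (metis cz_inv_cz)
  then show ?thesis using nab by simp
qed

section \<open>Structure equations of a unitary frame\<close>

abbreviation fd :: "('a::real_normed_vector \<Rightarrow> 'b::real_normed_vector) \<Rightarrow> 'a \<Rightarrow> 'a \<Rightarrow> 'b" where
  "fd f u \<equiv> frechet_derivative f (at u)"

text \<open>For \<open>k = 1 / sqrt 3\<close>, the vector \<open>k *\<^sub>R X\<close> is the
  Maurer-Cartan differential of \<open>om\<close>. The first identity evaluates the curvature of the
  rotation form \<open>rr\<close>, the second the torsion of \<open>om\<close> relative to
  \<open>rr\<close>.\<close>

lemma flat_curvature_cancel: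
  fixes a b :: "complex^3"
  defines "X \<equiv> 2 *\<^sub>R ccross a b + ccross a (vcnj b) + ccross (vcnj a) b - ccross (vcnj a) (vcnj b)"
  shows "k *\<^sub>R (k *\<^sub>R X + vcnj (k *\<^sub>R X)) - ccross (k *\<^sub>R (a + vcnj a)) (k *\<^sub>R (b + vcnj b))
      = (k * k) *\<^sub>R (ccross a (vcnj b) + ccross (vcnj a) b)"
    and "k *\<^sub>R X - ccross (k *\<^sub>R (a + vcnj a)) b + ccross (k *\<^sub>R (b + vcnj b)) a = (- k) *\<^sub>R vcnj (ccross a b)"
proof -
  have "X + vcnj X - ccross (a + vcnj a) (b + vcnj b) = ccross a (vcnj b) + ccross (vcnj a) b"
    unfolding X_def vcnj_linear vcnj_ccross ccross_linear vcnj_vcnj scaleR_2 by (simp add: algebra_simps)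
  then show "k *\<^sub>R (k *\<^sub>R X + vcnj (k *\<^sub>R X)) - ccross (k *\<^sub>R (a + vcnj a)) (k *\<^sub>R (b + vcnj b))
      = (k * k) *\<^sub>R (ccross a (vcnj b) + ccross (vcnj a) b)"
    by (simp only: vcnj_linear ccross_linear(7,8) scaleR_scaleR scaleR_add_right[symmetric] scaleR_diff_right[symmetric])
  have "X - ccross (a + vcnj a) b + ccross (b + vcnj b) a = - vcnj (ccross a b)"
    unfolding X_def by (simp add: vcnj_linear vcnj_ccross ccross_linear scaleR_2 ccross_skew[of b a] ccross_skew[of "vcnj b" a])
  then show "k *\<^sub>R X - ccross (k *\<^sub>R (a + vcnj a)) b + ccross (k *\<^sub>R (b + vcnj b)) a = (- k) *\<^sub>R vcnj (ccross a b)"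
    by (simp only: ccross_linear(7,8) scaleR_add_right[symmetric] scaleR_diff_right[symmetric]) simp
qed

text \<open>Here \<open>z\<close> is the frame and \<open>om \<eta>\<close> the differential of the
  immersion along the constant direction \<eta>, both in complex coordinates. The Lagrangian
  condition enters as \<open>om_real\<close>: tangent vectors have real coefficients in the unitary
  frame.\<close>

locale unitary_frame =
  fixes W :: "(real^3) set" and z :: "3 \<Rightarrow> real^3 \<Rightarrow> complex^3" and om :: "real^3 \<Rightarrow> real^3 \<Rightarrow> complex^3"
  assumes W: "open W"
    and z_smooth: "\<And>j. smooth_on W (z j)" and om_smooth: "\<And>\<eta>. smooth_on W (om \<eta>)"
    and unitary: "\<And>u. u \<in> W \<Longrightarrow> unitary_basis (\<lambda>j. z j u)"
    and om_real: "\<And>u \<eta> k. u \<in> W \<Longrightarrow> Im (bdot (om \<eta> u) (vcnj (z k u))) = 0"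
    and om_linear: "\<And>u. u \<in> W \<Longrightarrow> linear (\<lambda>\<eta>. om \<eta> u)"
    and om_inj: "\<And>u \<eta>. u \<in> W \<Longrightarrow> om \<eta> u = 0 \<Longrightarrow> \<eta> = 0"
    and om_surj: "\<And>u k. u \<in> W \<Longrightarrow> \<exists>\<xi>. om \<xi> u = z k u"
    and maurer_cartan: "\<And>u \<eta> \<eta>'. u \<in> W \<Longrightarrow> fd (om \<eta>') u \<eta> - fd (om \<eta>) u \<eta>' =
      (1 / sqrt 3) *\<^sub>R (2 *\<^sub>R ccross (om \<eta> u) (om \<eta>' u) + ccross (om \<eta> u) (vcnj (om \<eta>' u))
        + ccross (vcnj (om \<eta> u)) (om \<eta>' u) - ccross (vcnj (om \<eta> u)) (vcnj (om \<eta>' u)))"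
begin

text \<open>Rotation by this real vector is minus the rotation part of
  \<open>lc (om \<eta> u)\<close>.\<close>

definition rr :: "real^3 \<Rightarrow> real^3 \<Rightarrow> complex^3" where
  "rr \<eta> u = (1 / sqrt 3) *\<^sub>R (om \<eta> u + vcnj (om \<eta> u))"

text \<open>The dual coframe, evaluated on a constant direction \<eta> so that it can be
  differentiated in \<open>u\<close>.\<close>

definition \<theta> :: "3 \<Rightarrow> real^3 \<Rightarrow> real^3 \<Rightarrow> real" where
  "\<theta> k \<eta> u = Re (bdot (om \<eta> u) (vcnj (z k u)))"

text \<open>The connection matrix left after removing the rotation \<open>rr\<close>; it differs
  from the Levi-Civita coefficients by the torsion term in \<open>gauss_\<Psi>\<close>.\<close>

definition \<Psi> :: "3 \<Rightarrow> 3 \<Rightarrow> real^3 \<Rightarrow> real^3 \<Rightarrow> complex" where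
  "\<Psi> j l \<eta> u = bdot (fd (z j) u \<eta> - ccross (rr \<eta> u) (z j u)) (vcnj (z l u))"

definition S :: "3 \<Rightarrow> 3 \<Rightarrow> real^3 \<Rightarrow> complex" where
  "S i j u = bdot (z i u) (z j u)"

lemma z_der: "u \<in> W \<Longrightarrow> (z j has_derivative fd (z j) u) (at u)"
  by (rule smooth_onD[OF z_smooth])

lemma om_der: "u \<in> W \<Longrightarrow> (om \<eta> has_derivative fd (om \<eta>) u) (at u)"
  by (rule smooth_onD[OF om_smooth])

lemma vcnj_rr: "vcnj (rr \<eta> u) = rr \<eta> u"
  by (simp add: rr_def vcnj_linear add.commute)

lemma om_eq_sum: "u \<in> W \<Longrightarrow> om \<eta> u = (\<Sum>k\<in>UNIV. of_real (\<theta> k \<eta> u) *s z k u)"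
proof -
  assume u: "u \<in> W"
  have "bdot (om \<eta> u) (vcnj (z k u)) = of_real (\<theta> k \<eta> u)" for k
    using om_real[OF u] by (simp add: \<theta>_def complex_eq_iff)
  then show ?thesis using unitary_basis_expand[OF unitary[OF u], of "om \<eta> u"] by simp
qed

lemma \<theta>_dual: "u \<in> W \<Longrightarrow> om \<xi> u = z k u \<Longrightarrow> \<theta> l \<xi> u = (if k = l then 1 else 0)"
  using unitary[of u] by (simp add: \<theta>_def unitary_basis_def)

lemma direction_eq_sum:
  assumes u: "u \<in> W" and \<xi>: "\<And>k. om (\<xi> k) u = z k u"
  shows "\<eta> = (\<Sum>k\<in>UNIV. \<theta> k \<eta> u *\<^sub>R \<xi> k)"
proof -
  interpret l: linear "\<lambda>\<eta>. om \<eta> u" by (rule om_linear[OF u])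
  have "om (\<eta> - (\<Sum>k\<in>UNIV. \<theta> k \<eta> u *\<^sub>R \<xi> k)) u = om \<eta> u - (\<Sum>k\<in>UNIV. \<theta> k \<eta> u *\<^sub>R z k u)"
    by (simp add: l.diff l.sum l.scale \<xi>)
  also have "\<dots> = 0"
    by (subst om_eq_sum[OF u]) (simp add: vec_eq_iff scaleR_conv_of_real[where 'a = complex])
  finally show ?thesis using om_inj[OF u] by fastforce
qed

lemma z_der_eq: "u \<in> W \<Longrightarrow> fd (z j) u \<eta> = ccross (rr \<eta> u) (z j u) + (\<Sum>m\<in>UNIV. \<Psi> j m \<eta> u *s z m u)"
  using unitary_basis_expand[OF unitary, of u "fd (z j) u \<eta> - ccross (rr \<eta> u) (z j u)"]
  by (simp add: \<Psi>_def algebra_simps)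

text \<open>Differentiate the constant Hermitian products of the frame; rotation by the real vector
  \<open>rr\<close> preserves them and drops out.\<close>

lemma \<Psi>_skew: assumes u: "u \<in> W" shows "cnj (\<Psi> l m \<eta> u) = - \<Psi> m l \<eta> u"
proof -
  have "((\<lambda>u. bdot (z l u) (vcnj (z m u))) has_derivative
      (\<lambda>v. bdot (z l u) (vcnj (fd (z m) u v)) + bdot (fd (z l) u v) (vcnj (z m u)))) (at u)"
    by (intro bounded_bilinear.FDERIV[OF bounded_bilinear_bdot] bounded_linear.has_derivative[OF bounded_linear_vcnj] z_der u)
  moreover have "((\<lambda>u. bdot (z l u) (vcnj (z m u))) has_derivative (\<lambda>v. 0)) (at u)"
    by (rule has_derivative_transform_within_open[of "\<lambda>_. if l = m then 1 else 0" _ _ _ W])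
      (use u W unitary in \<open>auto simp: unitary_basis_def\<close>)
  ultimately have "(\<lambda>v. bdot (z l u) (vcnj (fd (z m) u v)) + bdot (fd (z l) u v) (vcnj (z m u))) = (\<lambda>v. 0)"
    by (rule has_derivative_unique)
  then have eq: "bdot (z l u) (vcnj (fd (z m) u \<eta>)) + bdot (fd (z l) u \<eta>) (vcnj (z m u)) = 0"
    by (rule fun_cong)
  have "cnj (\<Psi> l m \<eta> u) + \<Psi> m l \<eta> u = cnj (bdot (z l u) (vcnj (fd (z m) u \<eta>)) + bdot (fd (z l) u \<eta>) (vcnj (z m u)))"
    using bdot_ccross_skew[of "rr \<eta> u" "vcnj (z l u)" "z m u"] bdot_commute[of "vcnj (z l u)"]
    unfolding \<Psi>_def cnj_bdot complex_cnj_add bdot_linear vcnj_linear vcnj_ccross vcnj_rr vcnj_vcnj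
    by (simp add: cnj_bdot vcnj_ccross vcnj_rr)
  then show ?thesis using eq by (simp add: add_eq_0_iff)
qed

text \<open>The rotation \<open>rr\<close> also preserves the bilinear product, so only
  \<open>\<Psi>\<close> contributes.\<close>

lemma S_der:
  assumes u: "u \<in> W"
  shows "((\<lambda>u. S i j u) has_derivative (\<lambda>\<eta>. \<Sum>m\<in>UNIV. \<Psi> i m \<eta> u * S m j u + \<Psi> j m \<eta> u * S i m u)) (at u)"
proof -
  have "((\<lambda>u. bdot (z i u) (z j u)) has_derivative
      (\<lambda>v. bdot (z i u) (fd (z j) u v) + bdot (fd (z i) u v) (z j u))) (at u)"
    by (intro bounded_bilinear.FDERIV[OF bounded_bilinear_bdot] z_der u)
  moreover have "bdot (z i u) (fd (z j) u \<eta>) + bdot (fd (z i) u \<eta>) (z j u) =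
      (\<Sum>m\<in>UNIV. \<Psi> i m \<eta> u * S m j u + \<Psi> j m \<eta> u * S i m u)" for \<eta>
    unfolding z_der_eq[OF u]
    by (simp add: bdot_linear sum_3 S_def bdot_ccross_skew)
  ultimately show ?thesis unfolding S_def by simp
qed

lemma \<Psi>_der:
  assumes u: "u \<in> W"
  shows "((\<lambda>u. \<Psi> j l \<eta> u) has_derivative (\<lambda>v.
    bdot (fd (\<lambda>u. fd (z j) u \<eta>) u v - ccross ((1 / sqrt 3) *\<^sub>R (fd (om \<eta>) u v + vcnj (fd (om \<eta>) u v))) (z j u)
      - ccross (rr \<eta> u) (fd (z j) u v)) (vcnj (z l u))
    + bdot (fd (z j) u \<eta> - ccross (rr \<eta> u) (z j u)) (vcnj (fd (z l) u v)))) (at u)"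
proof -
  have r: "(rr \<eta> has_derivative (\<lambda>v. (1 / sqrt 3) *\<^sub>R (fd (om \<eta>) u v + vcnj (fd (om \<eta>) u v)))) (at u)"
    unfolding rr_def[abs_def]
    by (intro bounded_linear.has_derivative[OF bounded_linear_scaleR_right] has_derivative_add
        bounded_linear.has_derivative[OF bounded_linear_vcnj] om_der u)
  have d: "((\<lambda>u. fd (z j) u \<eta>) has_derivative fd (\<lambda>u. fd (z j) u \<eta>) u) (at u)"
    by (rule smooth_onD[OF smooth_on_frechet_derivative[OF z_smooth] u])
  have "((\<lambda>u. bdot (fd (z j) u \<eta> - ccross (rr \<eta> u) (z j u)) (vcnj (z l u))) has_derivative (\<lambda>v.
    bdot (fd (z j) u \<eta> - ccross (rr \<eta> u) (z j u)) (vcnj (fd (z l) u v)) +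
    bdot (fd (\<lambda>u. fd (z j) u \<eta>) u v - (ccross (rr \<eta> u) (fd (z j) u v) +
        ccross ((1 / sqrt 3) *\<^sub>R (fd (om \<eta>) u v + vcnj (fd (om \<eta>) u v))) (z j u))) (vcnj (z l u)))) (at u)"
    by (intro bounded_bilinear.FDERIV[OF bounded_bilinear_bdot] has_derivative_diff d
        bounded_bilinear.FDERIV[OF bounded_bilinear_ccross] r
        bounded_linear.has_derivative[OF bounded_linear_vcnj] z_der u)
  then show ?thesis unfolding \<Psi>_def by (simp add: algebra_simps)
qed

text \<open>The second derivatives of the frame cancel by symmetry. What remains is the commutator
  of \<open>\<Psi>\<close> and the curvature of \<open>rr\<close>, which the Maurer-Cartan equation
  evaluates.\<close>

lemma codazzi:
  assumes u: "u \<in> W" and a: "om \<xi> u = z a u" and b: "om \<xi>' u = z b u"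
  shows "fd (\<lambda>u. \<Psi> j l \<xi>' u) u \<xi> - fd (\<lambda>u. \<Psi> j l \<xi> u) u \<xi>' =
    (\<Sum>m\<in>UNIV. \<Psi> j m \<xi> u * \<Psi> m l \<xi>' u - \<Psi> j m \<xi>' u * \<Psi> m l \<xi> u)
    - (1 / 3) * (S a j u * cnj (S b l u) - S b j u * cnj (S a l u)
      + (if a = j \<and> b = l then 1 else 0) - (if a = l \<and> b = j then 1 else 0))"
proof -
  let ?s = "\<lambda>\<eta> v. (1 / sqrt 3) *\<^sub>R (fd (om \<eta>) u v + vcnj (fd (om \<eta>) u v))"
  let ?x = "fd (\<lambda>u. fd (z j) u \<xi>) u \<xi>'"
  have sym2: "fd (\<lambda>u. fd (z j) u \<xi>') u \<xi> = ?x"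
    by (rule smooth_on_second_derivative_symmetric[OF W u z_smooth])
  have 1: "fd (\<lambda>u. \<Psi> j l \<xi>' u) u \<xi> - fd (\<lambda>u. \<Psi> j l \<xi> u) u \<xi>' =
    bdot (?x - ccross (?s \<xi>' \<xi>) (z j u) - ccross (rr \<xi>' u) (fd (z j) u \<xi>)) (vcnj (z l u))
      + bdot (fd (z j) u \<xi>' - ccross (rr \<xi>' u) (z j u)) (vcnj (fd (z l) u \<xi>))
    - (bdot (?x - ccross (?s \<xi> \<xi>') (z j u) - ccross (rr \<xi> u) (fd (z j) u \<xi>')) (vcnj (z l u))
      + bdot (fd (z j) u \<xi> - ccross (rr \<xi> u) (z j u)) (vcnj (fd (z l) u \<xi>')))"
    unfolding frechet_derivative_at[OF \<Psi>_der[OF u], symmetric] sym2 ..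
  also have "\<dots> = (\<Sum>m\<in>UNIV. \<Psi> j m \<xi> u * \<Psi> m l \<xi>' u - \<Psi> j m \<xi>' u * \<Psi> m l \<xi> u)
    - bdot (ccross (?s \<xi>' \<xi> - ?s \<xi> \<xi>' - ccross (rr \<xi> u) (rr \<xi>' u)) (z j u)) (vcnj (z l u))"
    by (rule curvature_algebra[OF unitary[OF u] z_der_eq[OF u] z_der_eq[OF u] \<Psi>_skew[OF u] \<Psi>_skew[OF u] vcnj_rr vcnj_rr])
  also have "?s \<xi>' \<xi> - ?s \<xi> \<xi>' - ccross (rr \<xi> u) (rr \<xi>' u) =
      (1 / 3) *\<^sub>R (ccross (z a u) (vcnj (z b u)) + ccross (vcnj (z a u)) (z b u))"
  proof -
    have "?s \<xi>' \<xi> - ?s \<xi> \<xi>' = (1 / sqrt 3) *\<^sub>R ((fd (om \<xi>') u \<xi> - fd (om \<xi>) u \<xi>') + vcnj (fd (om \<xi>') u \<xi> - fd (om \<xi>) u \<xi>'))"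
      by (simp add: vcnj_linear algebra_simps)
    moreover have "1 / sqrt 3 * (1 / sqrt 3) = 1 / (3 :: real)" by simp
    ultimately show ?thesis
      unfolding maurer_cartan[OF u] rr_def a b by (simp only: flat_curvature_cancel)
  qed
  \<comment> \<open>The Lagrange identity turns the nested cross products into products of entries
    of \<open>S\<close> and Kronecker symbols.\<close>
  also have "bdot (ccross ((1 / 3) *\<^sub>R (ccross (z a u) (vcnj (z b u)) + ccross (vcnj (z a u)) (z b u))) (z j u)) (vcnj (z l u))
    = (1 / 3) * (S a j u * cnj (S b l u) - S b j u * cnj (S a l u)
      + (if a = j \<and> b = l then 1 else 0) - (if a = l \<and> b = j then 1 else 0))"
  proof -
    have hz: "bdot (z x u) (vcnj (z y u)) = (if x = y then 1 else 0)" "bdot (vcnj (z x u)) (z y u) = (if x = y then 1 else 0)" for x y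
      using unitary[OF u] bdot_commute[of "vcnj (z x u)" "z y u"] by (auto simp: unitary_basis_def)
    have "(if a = j \<and> b = l then 1 else 0) = bdot (vcnj (z a u)) (z j u) * bdot (z b u) (vcnj (z l u))"
      "(if a = l \<and> b = j then 1 else 0) = bdot (z a u) (vcnj (z l u)) * bdot (vcnj (z b u)) (z j u)"
      by (simp_all add: hz)
    then show ?thesis
      unfolding S_def cnj_bdot ccross_linear bdot_linear bdot_ccross_left[of _ "z j u"] bdot_ccross_ccross
      by (simp only:) (simp add: algebra_simps)
  qed
  finally show ?thesis .
qed

lemma \<theta>_der:
  assumes u: "u \<in> W"
  shows "(\<theta> l \<eta> has_derivative (\<lambda>v. Re (bdot (om \<eta> u) (vcnj (fd (z l) u v)) + bdot (fd (om \<eta>) u v) (vcnj (z l u))))) (at u)"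
  unfolding \<theta>_def[abs_def]
  by (intro bounded_linear.has_derivative[OF bounded_linear_Re] bounded_bilinear.FDERIV[OF bounded_bilinear_bdot]
      bounded_linear.has_derivative[OF bounded_linear_vcnj] z_der om_der u)

text \<open>First structure equation of the coframe. The rotation terms cancel against part of the
  Maurer-Cartan differential, leaving the connection terms and the nearly Kaehler torsion.\<close>

lemma torsion:
  assumes u: "u \<in> W" and a: "om \<xi> u = z a u" and b: "om \<xi>' u = z b u"
  shows "fd (\<theta> l \<xi>') u \<xi> - fd (\<theta> l \<xi>) u \<xi>' =
    Re (\<Psi> a l \<xi>' u) - Re (\<Psi> b l \<xi> u) - (1 / sqrt 3) * Re (bdot (ccross (z a u) (z b u)) (z l u))"
proof -
  have hz: "bdot (z x u) (vcnj (z y u)) = (if x = y then 1 else 0)" for x y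
    using unitary[OF u] by (auto simp: unitary_basis_def)
  have dz: "bdot (z x u) (vcnj (fd (z l) u \<eta>)) = - bdot (ccross (rr \<eta> u) (z x u)) (vcnj (z l u)) - \<Psi> x l \<eta> u" for x \<eta>
  proof -
    have "bdot (z x u) (vcnj (fd (z l) u \<eta>)) = bdot (z x u) (ccross (rr \<eta> u) (vcnj (z l u))) + cnj (\<Psi> l x \<eta> u)"
      using exhaust_3[of x] unfolding z_der_eq[OF u]
      by (auto simp: vcnj_linear vcnj_ccross vcnj_rr bdot_linear sum_3 hz)
    then show ?thesis by (simp add: \<Psi>_skew[OF u] bdot_ccross_skew)
  qed
  have "fd (\<theta> l \<xi>') u \<xi> - fd (\<theta> l \<xi>) u \<xi>' = Re (bdot (z b u) (vcnj (fd (z l) u \<xi>)) - bdot (z a u) (vcnj (fd (z l) u \<xi>'))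
      + bdot (fd (om \<xi>') u \<xi> - fd (om \<xi>) u \<xi>') (vcnj (z l u)))"
    unfolding frechet_derivative_at[OF \<theta>_der[OF u], symmetric] a b by (simp add: bdot_linear)
  also have "\<dots> = Re (\<Psi> a l \<xi>' u) - Re (\<Psi> b l \<xi> u)
      + Re (bdot ((fd (om \<xi>') u \<xi> - fd (om \<xi>) u \<xi>') - ccross (rr \<xi> u) (z b u) + ccross (rr \<xi>' u) (z a u)) (vcnj (z l u)))"
    unfolding dz by (simp add: bdot_linear)
  also have "(fd (om \<xi>') u \<xi> - fd (om \<xi>) u \<xi>') - ccross (rr \<xi> u) (z b u) + ccross (rr \<xi>' u) (z a u)
      = (- 1 / sqrt 3) *\<^sub>R vcnj (ccross (z a u) (z b u))"
    unfolding maurer_cartan[OF u] rr_def a b flat_curvature_cancel by simp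
  finally show ?thesis unfolding bdot_linear by (simp add: cnj_bdot[symmetric])
qed

end

section \<open>Umbilical frames\<close>

lemma triple_product_cases:
  fixes f :: "3 \<Rightarrow> complex^3"
  defines "D \<equiv> bdot (ccross (f 1) (f 2)) (f 3)"
  shows "bdot (ccross (f k) (f j)) (f l) \<in> {0, D, - D}"
  using exhaust_3[of k] exhaust_3[of j] exhaust_3[of l] unfolding D_def
  by (elim disjE; simp add: cvec_simps algebra_simps)

text \<open>A generator of rotations has trace zero, so it preserves the determinant to first
  order.\<close>

lemma bdot_ccross_derivation:
  "bdot (ccross (ccross r a) b) c + bdot (ccross a (ccross r b)) c + bdot (ccross a b) (ccross r c) = 0"
  by (simp add: cvec_simps algebra_simps)

lemma of_real_if_diff:
  "x + (if A then 1 else 0) - (if B then 1 else 0) = x + complex_of_real ((if A then 1 else 0) - (if B then 1 else 0))"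
  by simp

text \<open>Since \<open>J\<close> is multiplication by \<open>\<i>\<close>, the imaginary part of
  the Hermitian product with \<open>z l\<close> is the component along \<open>J\<close> of the l-th
  frame vector. The last three assumptions are thus the \<open>H\<close>-umbilical equations in
  complex coordinates.\<close>

locale umbilical_frame = unitary_frame +
  fixes lam mu :: "real^3 \<Rightarrow> real"
  assumes mu_smooth: "smooth_on W mu"
    and gauss11: "\<And>u \<xi> l. u \<in> W \<Longrightarrow> om \<xi> u = z 1 u \<Longrightarrow>
      Im (bdot (fd (z 1) u \<xi> + lc (z 1 u) (z 1 u)) (vcnj (z l u))) = (if l = 1 then lam u else 0)"
    and gauss1: "\<And>u \<xi> j l. u \<in> W \<Longrightarrow> om \<xi> u = z 1 u \<Longrightarrow> j \<noteq> 1 \<Longrightarrow>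
      Im (bdot (fd (z j) u \<xi> + lc (z 1 u) (z j u)) (vcnj (z l u))) = (if l = j then mu u else 0)"
    and gauss: "\<And>u \<xi> k j l. u \<in> W \<Longrightarrow> om \<xi> u = z k u \<Longrightarrow> k \<noteq> 1 \<Longrightarrow> j \<noteq> 1 \<Longrightarrow>
      Im (bdot (fd (z j) u \<xi> + lc (z k u) (z j u)) (vcnj (z l u))) = (if k = j \<and> l = 1 then mu u else 0)"
begin

section \<open>The frame determinant and the shape of \<open>Im \<Psi>\<close>\<close>

definition \<delta> :: "real^3 \<Rightarrow> complex" where
  "\<delta> u = bdot (ccross (z 1 u) (z 2 u)) (z 3 u)"

text \<open>The rotation part of \<open>lc\<close> is absorbed into \<open>\<Psi>\<close>; the
  torsion part of \<open>lc\<close> contributes the conjugate triple product.\<close>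

lemma gauss_\<Psi>:
  assumes "om \<xi> u = z k u"
  shows "bdot (fd (z j) u \<xi> + lc (z k u) (z j u)) (vcnj (z l u)) =
    \<Psi> j l \<xi> u + of_real (1 / (2 * sqrt 3)) * cnj (bdot (ccross (z k u) (z j u)) (z l u))"
proof -
  have "fd (z j) u \<xi> + lc (z k u) (z j u) = (fd (z j) u \<xi> - ccross (rr \<xi> u) (z j u))
      + (1 / (2 * sqrt 3)) *\<^sub>R vcnj (ccross (z k u) (z j u))"
    unfolding lc_def rr_def assms ccross_linear vcnj_ccross by (simp add: algebra_simps)
  then show ?thesis unfolding \<Psi>_def by (simp only: bdot_linear cnj_bdot)
qed

lemma Im_\<Psi>_sym: "u \<in> W \<Longrightarrow> Im (\<Psi> j l \<eta> u) = Im (\<Psi> l j \<eta> u)"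
  using arg_cong[OF \<Psi>_skew[of u j l \<eta>], of Im] by simp

lemma Re_\<Psi>_skew: "u \<in> W \<Longrightarrow> Re (\<Psi> j l \<eta> u) = - Re (\<Psi> l j \<eta> u)"
  using arg_cong[OF \<Psi>_skew[of u j l \<eta>], of Re] by simp

text \<open>The components of h(U1,U2) along J U3 and of h(U1,U3) along J U2 both vanish. The
  symmetric \<open>Im \<Psi>\<close> enters them with equal signs, the torsion with opposite
  signs.\<close>

lemma Im_\<delta>: assumes u: "u \<in> W" shows "Im (\<delta> u) = 0"
proof -
  obtain \<xi> where \<xi>: "om \<xi> u = z 1 u" using om_surj[OF u] by blast
  have neg: "bdot (ccross (z 1 u) (z 3 u)) (z 2 u) = - \<delta> u"
    unfolding \<delta>_def by (simp add: cvec_simps algebra_simps)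
  have "Im (\<Psi> 2 3 \<xi> u) - 1 / (2 * sqrt 3) * Im (\<delta> u) = 0"
    using gauss1[OF u \<xi>, of 2 3] unfolding gauss_\<Psi>[OF \<xi>] \<delta>_def[symmetric] by simp
  moreover have "Im (\<Psi> 3 2 \<xi> u) + 1 / (2 * sqrt 3) * Im (\<delta> u) = 0"
    using gauss1[OF u \<xi>, of 3 2] unfolding gauss_\<Psi>[OF \<xi>] neg by simp
  ultimately have "1 / (2 * sqrt 3) * Im (\<delta> u) = 0" using Im_\<Psi>_sym[OF u, of 2 3 \<xi>] by linarith
  then show ?thesis by simp
qed

lemma \<delta>_sq: assumes u: "u \<in> W" shows "\<delta> u * \<delta> u = 1"
proof -
  have "cnj (\<delta> u) = \<delta> u" using Im_\<delta>[OF u] by (simp add: complex_eq_iff)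
  then show ?thesis using unitary_basis_cross(4)[OF unitary[OF u]] by (simp add: \<delta>_def)
qed

text \<open>The logarithmic derivative of the determinant is the trace of \<open>\<Psi>\<close>, and
  \<open>\<delta>_sq\<close> makes the determinant locally constant.\<close>

lemma trace_\<Psi>: assumes u: "u \<in> W" shows "\<Psi> 1 1 \<eta> u + \<Psi> 2 2 \<eta> u + \<Psi> 3 3 \<eta> u = 0"
proof -
  have "(\<delta> has_derivative (\<lambda>v. bdot (ccross (z 1 u) (z 2 u)) (fd (z 3) u v)
      + bdot (ccross (z 1 u) (fd (z 2) u v) + ccross (fd (z 1) u v) (z 2 u)) (z 3 u))) (at u)"
    unfolding \<delta>_def[abs_def]
    by (intro bounded_bilinear.FDERIV[OF bounded_bilinear_bdot] bounded_bilinear.FDERIV[OF bounded_bilinear_ccross] z_der u)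
  moreover have "bdot (ccross (z 1 u) (z 2 u)) (fd (z 3) u v)
      + bdot (ccross (z 1 u) (fd (z 2) u v) + ccross (fd (z 1) u v) (z 2 u)) (z 3 u)
      = (\<Psi> 1 1 v u + \<Psi> 2 2 v u + \<Psi> 3 3 v u) * \<delta> u" for v
  proof -
    have "bdot (ccross (z 1 u) (z 2 u)) (fd (z 3) u v)
      + bdot (ccross (z 1 u) (fd (z 2) u v) + ccross (fd (z 1) u v) (z 2 u)) (z 3 u) =
      (bdot (ccross (ccross (rr v u) (z 1 u)) (z 2 u)) (z 3 u) + bdot (ccross (z 1 u) (ccross (rr v u) (z 2 u))) (z 3 u)
       + bdot (ccross (z 1 u) (z 2 u)) (ccross (rr v u) (z 3 u))) + (\<Psi> 1 1 v u + \<Psi> 2 2 v u + \<Psi> 3 3 v u) * \<delta> u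
      + (\<Psi> 3 1 v u * bdot (ccross (z 1 u) (z 2 u)) (z 1 u) + \<Psi> 3 2 v u * bdot (ccross (z 1 u) (z 2 u)) (z 2 u)
       + \<Psi> 2 1 v u * bdot (ccross (z 1 u) (z 1 u)) (z 3 u) + \<Psi> 2 3 v u * bdot (ccross (z 1 u) (z 3 u)) (z 3 u)
       + \<Psi> 1 2 v u * bdot (ccross (z 2 u) (z 2 u)) (z 3 u) + \<Psi> 1 3 v u * bdot (ccross (z 3 u) (z 2 u)) (z 3 u))"
      unfolding z_der_eq[OF u] sum_3 ccross_linear bdot_linear \<delta>_def by (simp add: algebra_simps)
    moreover have "bdot (ccross a b) a = 0" "bdot (ccross a b) b = 0" "bdot (ccross a a) b = 0" for a b
      by (simp_all add: cvec_simps algebra_simps)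
    ultimately show ?thesis by (simp add: bdot_ccross_derivation)
  qed
  ultimately have d: "(\<delta> has_derivative (\<lambda>v. (\<Psi> 1 1 v u + \<Psi> 2 2 v u + \<Psi> 3 3 v u) * \<delta> u)) (at u)" by simp
  have "((\<lambda>u. \<delta> u * \<delta> u) has_derivative (\<lambda>v. 0)) (at u)"
    by (rule has_derivative_transform_within_open[of "\<lambda>_. 1" _ _ _ W]) (use u W \<delta>_sq in auto)
  then have "(\<lambda>v. \<delta> u * ((\<Psi> 1 1 v u + \<Psi> 2 2 v u + \<Psi> 3 3 v u) * \<delta> u)
      + (\<Psi> 1 1 v u + \<Psi> 2 2 v u + \<Psi> 3 3 v u) * \<delta> u * \<delta> u) = (\<lambda>v. 0)"
    using has_derivative_unique[OF has_derivative_mult[OF d d]] by simp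
  then have "2 * ((\<delta> u * \<delta> u) * (\<Psi> 1 1 \<eta> u + \<Psi> 2 2 \<eta> u + \<Psi> 3 3 \<eta> u)) = 0"
    by (drule_tac fun_cong[of _ _ \<eta>]) (simp add: algebra_simps)
  then show ?thesis unfolding \<delta>_sq[OF u] mult_1 mult_eq_0_iff by simp
qed

lemma Im_\<Psi>_gauss:
  assumes u: "u \<in> W" and \<xi>: "om \<xi> u = z k u"
  shows "Im (\<Psi> j l \<xi> u) = Im (bdot (fd (z j) u \<xi> + lc (z k u) (z j u)) (vcnj (z l u)))"
proof -
  have "Im (bdot (ccross (z k u) (z j u)) (z l u)) = 0"
    using triple_product_cases[of "\<lambda>i. z i u" k j l] Im_\<delta>[OF u] unfolding \<delta>_def by auto
  then show ?thesis unfolding gauss_\<Psi>[OF \<xi>] by simp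
qed

lemma linear_\<Psi>: assumes u: "u \<in> W" shows "linear (\<lambda>\<eta>. \<Psi> j l \<eta> u)"
proof -
  interpret om: linear "\<lambda>\<eta>. om \<eta> u" by (rule om_linear[OF u])
  interpret z: linear "fd (z j) u" by (rule has_derivative_linear[OF z_der[OF u]])
  show ?thesis
    by (rule linearI) (simp_all add: \<Psi>_def rr_def om.add om.scale z.add z.scale vcnj_linear ccross_linear bdot_linear
        scaleR_conv_of_real[where 'a = complex] algebra_simps)
qed

text \<open>All triple products are real, so the Gauss equations read off \<open>Im \<Psi>\<close>
  directly for \<open>j \<noteq> 1\<close>; symmetry supplies the first row, and the zero trace its
  diagonal entry, that is, \<lambda> = -2\<mu>.\<close>

lemma Im_\<Psi>_frame:
  assumes u: "u \<in> W" and \<xi>: "om \<xi> u = z k u"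
  shows "Im (\<Psi> 1 1 \<xi> u) = (if k = 1 then - 2 * mu u else 0)"
    "j \<noteq> 1 \<Longrightarrow> Im (\<Psi> 1 j \<xi> u) = (if k = j then mu u else 0)"
    "j \<noteq> 1 \<Longrightarrow> l \<noteq> 1 \<Longrightarrow> Im (\<Psi> j l \<xi> u) = (if k = 1 \<and> j = l then mu u else 0)"
proof -
  have 1: "Im (\<Psi> j l \<xi> u) = (if k = 1 then if l = j then mu u else 0 else if k = j \<and> l = 1 then mu u else 0)"
    if "j \<noteq> 1" for j l
    using gauss1[OF u, of \<xi> j l] gauss[OF u \<xi>, of j l] that \<xi> by (simp add: Im_\<Psi>_gauss[OF u \<xi>])
  show "j \<noteq> 1 \<Longrightarrow> l \<noteq> 1 \<Longrightarrow> Im (\<Psi> j l \<xi> u) = (if k = 1 \<and> j = l then mu u else 0)"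
    using 1[of j l] by auto
  show "j \<noteq> 1 \<Longrightarrow> Im (\<Psi> 1 j \<xi> u) = (if k = j then mu u else 0)"
    using 1[of j 1] Im_\<Psi>_sym[OF u, of 1 j] by auto
  have "Im (\<Psi> 1 1 \<xi> u) = - Im (\<Psi> 2 2 \<xi> u) - Im (\<Psi> 3 3 \<xi> u)"
    using arg_cong[OF trace_\<Psi>[OF u, of \<xi>], of Im] by simp
  then show "Im (\<Psi> 1 1 \<xi> u) = (if k = 1 then - 2 * mu u else 0)"
    using 1[of 2 2] 1[of 3 3] by simp
qed

text \<open>The frame directions vary with the point while \<open>codazzi\<close> differentiates
  along fixed ones, so linearity is used to extend the values to constant \<eta>.\<close>

lemma Im_\<Psi>:
  assumes u: "u \<in> W"
  shows "Im (\<Psi> 1 1 \<eta> u) = - 2 * (mu u * \<theta> 1 \<eta> u)" "j \<noteq> 1 \<Longrightarrow> Im (\<Psi> 1 j \<eta> u) = mu u * \<theta> j \<eta> u"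
    "j \<noteq> 1 \<Longrightarrow> l \<noteq> 1 \<Longrightarrow> Im (\<Psi> j l \<eta> u) = (if j = l then mu u * \<theta> 1 \<eta> u else 0)"
proof -
  obtain \<xi> where \<xi>: "\<And>k. om (\<xi> k) u = z k u" using om_surj[OF u] by metis
  have "\<Psi> j l \<eta> u = (\<Sum>k\<in>UNIV. \<theta> k \<eta> u *\<^sub>R \<Psi> j l (\<xi> k) u)" for j l
    using arg_cong[OF direction_eq_sum[OF u \<xi>, of \<eta>], of "\<lambda>\<eta>. \<Psi> j l \<eta> u"]
    by (simp add: linear_sum[OF linear_\<Psi>[OF u]] linear_cmul[OF linear_\<Psi>[OF u]])
  then have I: "Im (\<Psi> j l \<eta> u) = (\<Sum>k\<in>UNIV. \<theta> k \<eta> u * Im (\<Psi> j l (\<xi> k) u))" for j l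
    by simp
  note f = Im_\<Psi>_frame[OF u \<xi>]
  show "Im (\<Psi> 1 1 \<eta> u) = - 2 * (mu u * \<theta> 1 \<eta> u)" by (simp add: I f sum_3)
  show "j \<noteq> 1 \<Longrightarrow> Im (\<Psi> 1 j \<eta> u) = mu u * \<theta> j \<eta> u"
    using exhaust_3[of j] by (auto simp: I f sum_3)
  show "j \<noteq> 1 \<Longrightarrow> l \<noteq> 1 \<Longrightarrow> Im (\<Psi> j l \<eta> u) = (if j = l then mu u * \<theta> 1 \<eta> u else 0)"
    by (auto simp: I f sum_3)
qed

lemma Im_\<Psi>_derivative:
  assumes u: "u \<in> W" and eq: "\<And>u. u \<in> W \<Longrightarrow> Im (\<Psi> j l \<eta> u) = c * (mu u * \<theta> k \<eta> u)"
  shows "Im (fd (\<lambda>u. \<Psi> j l \<eta> u) u v) = c * (fd mu u v * \<theta> k \<eta> u + mu u * fd (\<theta> k \<eta>) u v)"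
proof -
  have \<theta>: "(\<theta> k \<eta> has_derivative fd (\<theta> k \<eta>) u) (at u)"
    using \<theta>_der[OF u, of k \<eta>] frechet_derivative_works differentiableI by blast
  have \<Psi>: "((\<lambda>u. \<Psi> j l \<eta> u) has_derivative fd (\<lambda>u. \<Psi> j l \<eta> u) u) (at u)"
    using \<Psi>_der[OF u, of j l \<eta>] frechet_derivative_works differentiableI by blast
  have "((\<lambda>u. c * (mu u * \<theta> k \<eta> u)) has_derivative (\<lambda>v. c * (mu u * fd (\<theta> k \<eta>) u v + fd mu u v * \<theta> k \<eta> u))) (at u)"
    by (intro has_derivative_mult_right has_derivative_mult \<theta> smooth_onD[OF mu_smooth u])
  then have "((\<lambda>u. Im (\<Psi> j l \<eta> u)) has_derivative (\<lambda>v. c * (mu u * fd (\<theta> k \<eta>) u v + fd mu u v * \<theta> k \<eta> u))) (at u)"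
    by (rule has_derivative_transform_within_open[OF _ W u]) (simp add: eq)
  moreover have "((\<lambda>u. Im (\<Psi> j l \<eta> u)) has_derivative (\<lambda>v. Im (fd (\<lambda>u. \<Psi> j l \<eta> u) u v))) (at u)"
    by (rule bounded_linear.has_derivative[OF bounded_linear_Im \<Psi>])
  ultimately have "(\<lambda>v. c * (mu u * fd (\<theta> k \<eta>) u v + fd mu u v * \<theta> k \<eta> u)) = (\<lambda>v. Im (fd (\<lambda>u. \<Psi> j l \<eta> u) u v))"
    by (rule has_derivative_unique)
  from fun_cong[OF this, of v] show ?thesis by (simp add: algebra_simps)
qed

text \<open>The imaginary part of \<open>codazzi\<close>, with \<open>torsion\<close> replacing the
  derivatives of the coframe, is a linear system in the derivative of \<open>mu\<close> and the
  connection coefficients. The first four conclusions are relations of the curvature terms after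
  eliminating these unknowns; the fifth retains the coefficients of U1 in the plane of U2,
  U3.\<close>

lemma codazzi_umbilical:
  assumes u: "u \<in> W" and \<xi>: "\<And>k. om (\<xi> k) u = z k u"
  defines "a \<equiv> S 1 1 u" and "m \<equiv> S 2 2 u + S 3 3 u" and "d \<equiv> S 2 2 u - S 3 3 u"
  shows "Im ((a + 2 * m) * cnj d) = 0" "Im ((a + 2 * m) * cnj (S 2 3 u)) = 0"
    "Im (S 1 2 u * cnj d) = 2 * Im (S 1 3 u * cnj (S 2 3 u))"
    "Im (S 1 3 u * cnj d) = - 2 * Im (S 1 2 u * cnj (S 2 3 u))"
    "12 * mu u * (Re (\<Psi> 1 3 (\<xi> 2) u) - Re (\<Psi> 1 2 (\<xi> 3) u)) - 6 * mu u * (Re (\<delta> u) / sqrt 3)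
      = 2 * Im (S 1 2 u * cnj (S 1 3 u))"
proof -
  \<comment> \<open>The imaginary part of the curvature term in \<open>codazzi\<close>, up to the
    factor -1/3.\<close>
  define E where "E p q j l = Im (S p j u * cnj (S q l u) - S q j u * cnj (S p l u))" for p q j l
  have Ssym: "S i j u = S j i u" for i j by (simp add: S_def bdot_commute)
  have th: "\<theta> l (\<xi> k) u = (if k = l then 1 else 0)" for k l
    by (rule \<theta>_dual[OF u \<xi>])
  have cod: "Im (fd (\<lambda>u. \<Psi> j l (\<xi> q) u) u (\<xi> p)) - Im (fd (\<lambda>u. \<Psi> j l (\<xi> p) u) u (\<xi> q)) =
    (\<Sum>m\<in>UNIV. Re (\<Psi> j m (\<xi> p) u) * Im (\<Psi> m l (\<xi> q) u) + Im (\<Psi> j m (\<xi> p) u) * Re (\<Psi> m l (\<xi> q) u)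
      - (Re (\<Psi> j m (\<xi> q) u) * Im (\<Psi> m l (\<xi> p) u) + Im (\<Psi> j m (\<xi> q) u) * Re (\<Psi> m l (\<xi> p) u))) - E p q j l / 3"
    for p q j l
  proof -
    \<comment> \<open>The Kronecker symbols are gathered into one real number, which the imaginary
      part discards.\<close>
    define c :: real where "c = (if p = j \<and> q = l then 1 else 0) - (if p = l \<and> q = j then 1 else 0)"
    have c: "x + (if p = j \<and> q = l then 1 else 0) - (if p = l \<and> q = j then 1 else 0) = x + complex_of_real c" for x
      unfolding c_def of_real_if_diff ..
    show ?thesis
      using arg_cong[OF codazzi[OF u \<xi>[of p] \<xi>[of q], of j l], of Im] unfolding c by (simp add: E_def)
  qed
  \<comment> \<open>Coefficient 0 expresses that this entry has no imaginary part; the coframe index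
    1 is then arbitrary.\<close>
  have I23: "Im (fd (\<lambda>u. \<Psi> 2 3 \<eta> u) u v) = 0" for \<eta> v
    by (subst Im_\<Psi>_derivative[OF u, of 2 3 \<eta> 0 1 v]) (simp_all add: Im_\<Psi>)
  have I22: "Im (fd (\<lambda>u. \<Psi> 2 2 \<eta> u) u v) = Im (fd (\<lambda>u. \<Psi> 3 3 \<eta> u) u v)" for \<eta> v
    by (subst Im_\<Psi>_derivative[OF u, of 2 2 \<eta> 1 1 v], simp add: Im_\<Psi>,
        subst Im_\<Psi>_derivative[OF u, of 3 3 \<eta> 1 1 v]) (simp_all add: Im_\<Psi>)
  have I1: "Im (fd (\<lambda>u. \<Psi> 1 j \<eta> u) u v) = fd mu u v * \<theta> j \<eta> u + mu u * fd (\<theta> j \<eta>) u v" if "j \<noteq> 1" for j \<eta> v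
    by (subst Im_\<Psi>_derivative[OF u, of 1 j \<eta> 1 j v]) (simp_all add: Im_\<Psi> that)
  have I11: "Im (fd (\<lambda>u. \<Psi> 1 1 \<eta> u) u v) = - 2 * (fd mu u v * \<theta> 1 \<eta> u + mu u * fd (\<theta> 1 \<eta>) u v)" for \<eta> v
    by (subst Im_\<Psi>_derivative[OF u, of 1 1 \<eta> "-2" 1 v]) (simp_all add: Im_\<Psi>)
  have ImP: "Im (\<Psi> 1 1 (\<xi> k) u) = (if k = 1 then - 2 * mu u else 0)"
    "Im (\<Psi> 1 2 (\<xi> k) u) = (if k = 2 then mu u else 0)" "Im (\<Psi> 2 1 (\<xi> k) u) = (if k = 2 then mu u else 0)"
    "Im (\<Psi> 1 3 (\<xi> k) u) = (if k = 3 then mu u else 0)" "Im (\<Psi> 3 1 (\<xi> k) u) = (if k = 3 then mu u else 0)"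
    "Im (\<Psi> 2 2 (\<xi> k) u) = (if k = 1 then mu u else 0)" "Im (\<Psi> 3 3 (\<xi> k) u) = (if k = 1 then mu u else 0)"
    "Im (\<Psi> 2 3 (\<xi> k) u) = 0" "Im (\<Psi> 3 2 (\<xi> k) u) = 0" for k
    using Im_\<Psi>_frame[OF u \<xi>[of k]] Im_\<Psi>_sym[OF u, of 2 1 "\<xi> k"] Im_\<Psi>_sym[OF u, of 3 1 "\<xi> k"] by simp_all
  have ReP: "Re (\<Psi> 1 1 \<eta> u) = 0" "Re (\<Psi> 2 2 \<eta> u) = 0" "Re (\<Psi> 3 3 \<eta> u) = 0" "Re (\<Psi> 2 1 \<eta> u) = - Re (\<Psi> 1 2 \<eta> u)"
    "Re (\<Psi> 3 1 \<eta> u) = - Re (\<Psi> 1 3 \<eta> u)" "Re (\<Psi> 3 2 \<eta> u) = - Re (\<Psi> 2 3 \<eta> u)" for \<eta>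
    using Re_\<Psi>_skew[OF u, of 1 1 \<eta>] Re_\<Psi>_skew[OF u, of 2 2 \<eta>] Re_\<Psi>_skew[OF u, of 3 3 \<eta>]
      Re_\<Psi>_skew[OF u, of 2 1 \<eta>] Re_\<Psi>_skew[OF u, of 3 1 \<eta>] Re_\<Psi>_skew[OF u, of 3 2 \<eta>] by simp_all
  \<comment> \<open>Scaling by \<open>mu u\<close> makes the equations below linear in
    \<open>v\<close>, \<open>\<kappa>\<close> and \<open>m1\<close>.\<close>
  define v where "v k i = mu u * Re (\<Psi> 1 i (\<xi> k) u)" for k i
  define \<kappa> where "\<kappa> = mu u * (Re (\<delta> u) / sqrt 3)"
  define m1 where "m1 = fd mu u (\<xi> 1)"
  have tor: "mu u * fd (\<theta> l (\<xi> q)) u (\<xi> p) - mu u * fd (\<theta> l (\<xi> p)) u (\<xi> q) = 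
    mu u * Re (\<Psi> p l (\<xi> q) u) - mu u * Re (\<Psi> q l (\<xi> p) u) - mu u * (Re (bdot (ccross (z p u) (z q u)) (z l u)) / sqrt 3)" for p q l
    using arg_cong[OF torsion[OF u \<xi>[of p] \<xi>[of q], of l], of "\<lambda>x. mu u * x"] by (simp add: algebra_simps)
  have det: "bdot (ccross (z 1 u) (z 3 u)) (z 2 u) = - \<delta> u" "bdot (ccross (z 1 u) (z 2 u)) (z 3 u) = \<delta> u"
    "bdot (ccross (z 2 u) (z 3 u)) (z 1 u) = \<delta> u"
    "bdot (ccross (z 1 u) (z 2 u)) (z 2 u) = 0" "bdot (ccross (z 1 u) (z 3 u)) (z 3 u) = 0"
    unfolding \<delta>_def by (simp_all add: cvec_simps algebra_simps)
  note ev = sum_3 ImP ReP th I23 I1 I11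
  \<comment> \<open>The (2,3) entries carry no derivative terms.\<close>
  have e: "E 1 2 2 3 = - 3 * v 1 3" "E 1 3 2 3 = - 3 * v 1 2" "E 2 3 2 3 = 3 * (v 3 3 - v 2 2)"
    using cod[where p = 1 and q = 2 and j = 2 and l = 3] cod[where p = 1 and q = 3 and j = 2 and l = 3] 
      cod[where p = 2 and q = 3 and j = 2 and l = 3]
    by (simp_all add: ev v_def algebra_simps)
  \<comment> \<open>Subtracting the (3,3) from the (2,2) entries cancels the derivative terms by
    \<open>I22\<close>.\<close>
  have f: "E 1 2 2 2 - E 1 2 3 3 = - 6 * v 1 2" "E 1 3 2 2 - E 1 3 3 3 = 6 * v 1 3"
    "E 2 3 2 2 - E 2 3 3 3 = 6 * (v 2 3 + v 3 2)"
    using cod[where p = 1 and q = 2 and j = 2 and l = 2] cod[where p = 1 and q = 3 and j = 2 and l = 2] 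
      cod[where p = 2 and q = 3 and j = 2 and l = 2] cod[where p = 1 and q = 2 and j = 3 and l = 3]
      cod[where p = 1 and q = 3 and j = 3 and l = 3] cod[where p = 2 and q = 3 and j = 3 and l = 3]
    by (simp_all add: ev I22 v_def algebra_simps)
  \<comment> \<open>The first-row entries involve derivatives of \<open>mu\<close> and of the
    coframe; \<open>tor\<close> removes the latter, and duality leaves at most \<open>m1\<close> of
    the former.\<close>
  have h: "m1 + 4 * v 2 2 = - E 1 2 1 2 / 3" "4 * v 3 2 + \<kappa> = - E 1 3 1 2 / 3"
    "m1 + 4 * v 3 3 = - E 1 3 1 3 / 3" "4 * v 2 3 - \<kappa> = - E 1 2 1 3 / 3"
    "- 4 * (v 2 3 - v 3 2) + 2 * \<kappa> = - E 2 3 1 1 / 3"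
    using cod[where p = 1 and q = 2 and j = 1 and l = 2] tor[where p = 1 and q = 2 and l = 2]
      cod[where p = 1 and q = 3 and j = 1 and l = 2] tor[where p = 1 and q = 3 and l = 2]
      cod[where p = 1 and q = 3 and j = 1 and l = 3] tor[where p = 1 and q = 3 and l = 3]
      cod[where p = 1 and q = 2 and j = 1 and l = 3] tor[where p = 1 and q = 2 and l = 3]
      cod[where p = 2 and q = 3 and j = 1 and l = 1] tor[where p = 2 and q = 3 and l = 1]
    by (simp_all add: ev det v_def \<kappa>_def m1_def algebra_simps)
  have h': "E 1 2 1 2 = - 3 * (m1 + 4 * v 2 2)" "E 1 3 1 2 = - 3 * (4 * v 3 2 + \<kappa>)"
    "E 1 3 1 3 = - 3 * (m1 + 4 * v 3 3)" "E 1 2 1 3 = - 3 * (4 * v 2 3 - \<kappa>)"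
    "E 2 3 1 1 = - 3 * (- 4 * (v 2 3 - v 3 2) + 2 * \<kappa>)"
    unfolding h by simp_all
  show "Im ((a + 2 * m) * cnj d) = 0"
  proof -
    have "E 1 2 1 2 - E 1 3 1 3 = 4 * E 2 3 2 3" unfolding e h' by (simp add: algebra_simps)
    then show ?thesis unfolding E_def a_def m_def d_def by (simp add: Ssym[of 2 1] Ssym[of 3 1] Ssym[of 3 2] algebra_simps)
  qed
  show "Im ((a + 2 * m) * cnj (S 2 3 u)) = 0"
  proof -
    have "E 1 3 1 2 + E 1 2 1 3 = - 2 * (E 2 3 2 2 - E 2 3 3 3)" unfolding f h' by (simp add: algebra_simps)
    then show ?thesis unfolding E_def a_def m_def d_def by (simp add: Ssym[of 2 1] Ssym[of 3 1] Ssym[of 3 2] algebra_simps)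
  qed
  show "Im (S 1 2 u * cnj d) = 2 * Im (S 1 3 u * cnj (S 2 3 u))"
  proof -
    have "E 1 2 2 2 - E 1 2 3 3 = 2 * E 1 3 2 3" unfolding e f by (simp add: algebra_simps)
    then show ?thesis unfolding E_def a_def m_def d_def by (simp add: Ssym[of 2 1] Ssym[of 3 1] Ssym[of 3 2] algebra_simps)
  qed
  show "Im (S 1 3 u * cnj d) = - 2 * Im (S 1 2 u * cnj (S 2 3 u))"
  proof -
    have "E 1 3 2 2 - E 1 3 3 3 = - 2 * E 1 2 2 3" unfolding e f by (simp add: algebra_simps)
    then show ?thesis unfolding E_def a_def m_def d_def by (simp add: Ssym[of 2 1] Ssym[of 3 1] Ssym[of 3 2] algebra_simps)
  qed
  have "E 2 3 1 1 = 2 * Im (S 1 2 u * cnj (S 1 3 u))"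
    unfolding E_def by (simp add: Ssym[of 2 1] Ssym[of 3 1] algebra_simps)
  then show "12 * mu u * (Re (\<Psi> 1 3 (\<xi> 2) u) - Re (\<Psi> 1 2 (\<xi> 3) u)) - 6 * mu u * (Re (\<delta> u) / sqrt 3)
      = 2 * Im (S 1 2 u * cnj (S 1 3 u))"
    using h'(5) unfolding v_def \<kappa>_def by (simp add: algebra_simps)
qed

section \<open>Vanishing of \<open>mu\<close>\<close>

lemma S_continuous: "continuous_on W (S i j)"
  by (intro continuous_at_imp_continuous_on ballI has_derivative_continuous[OF S_der])

theorem mu_eq_0:
  assumes u: "u \<in> W"
  shows "mu u = 0"
proof (rule ccontr)
  assume mu0: "mu u \<noteq> 0"
  \<comment> \<open>Openness of this set permits differentiating identities that hold wherever
    \<open>mu\<close> is nonzero.\<close>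
  define W' where "W' = {u \<in> W. mu u \<noteq> 0}"
  have oW': "open W'"
  proof -
    have "W' = W \<inter> mu -` (- {0})" by (auto simp: W'_def)
    then show ?thesis using continuous_open_preimage[OF smooth_on_continuous_on[OF mu_smooth] W, of "- {0}"] by (simp add: open_Compl)
  qed
  have Ssym: "S i j u = S j i u" for i j u by (simp add: S_def bdot_commute)
  have Sunit: "(\<Sum>l\<in>UNIV. S i l u * cnj (S j l u)) = (if i = j then 1 else 0)" if "u \<in> W" for i j u
    using gram_unitary[OF unitary[OF that]] by (simp add: S_def)
  have zero: "S 1 2 u = 0 \<and> S 1 3 u = 0" if u: "u \<in> W'" for u
  proof (rule ccontr)
    assume nz: "\<not> (S 1 2 u = 0 \<and> S 1 3 u = 0)"
    define V where "V = {u \<in> W'. S 1 2 u \<noteq> 0 \<or> S 1 3 u \<noteq> 0}"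
    have c: "continuous_on W' (S i j)" for i j
      using continuous_on_subset[OF S_continuous] W'_def by auto
    have "V = (W' \<inter> S 1 2 -` (- {0})) \<union> (W' \<inter> S 1 3 -` (- {0}))" by (auto simp: V_def)
    then have oV: "open V"
      using continuous_open_preimage[OF c oW', of "- {0}"] by (simp add: open_Un open_Compl)
    have uV: "u \<in> V" using u nz by (auto simp: V_def)
    have phase: "\<exists>\<epsilon> R. \<epsilon> * cnj \<epsilon> = 1 \<and> (\<forall>i j. S i j w = \<epsilon> * complex_of_real (R i j))" if w: "w \<in> V" for w
    proof -
      have wW: "w \<in> W" and nzw: "S 1 2 w \<noteq> 0 \<or> S 1 3 w \<noteq> 0" using w by (auto simp: V_def W'_def)
      obtain \<xi> where \<xi>: "\<And>k. om (\<xi> k) w = z k w" using om_surj[OF wW] by metis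
      show ?thesis
        by (rule gram_common_phase[of "\<lambda>i j. S i j w", OF Ssym Sunit[OF wW] codazzi_umbilical(1-4)[OF wW \<xi>] nzw]) blast
    qed
    \<comment> \<open>The phase and the real factors are only chosen pointwise; the reality of these
      products expresses the common phase in a form that can be differentiated.\<close>
    have im: "Im (S i j w * cnj (S k l w)) = 0" if w: "w \<in> V" for w i j k l
    proof -
      obtain \<epsilon> R where "\<epsilon> * cnj \<epsilon> = 1" "\<And>i j. S i j w = \<epsilon> * complex_of_real (R i j)" using phase[OF w] by blast
      then have "S i j w * cnj (S k l w) = (\<epsilon> * cnj \<epsilon>) * of_real (R i j * R k l)" by simp
      then show ?thesis unfolding \<open>\<epsilon> * cnj \<epsilon> = 1\<close> by simp
    qed
    have uW: "u \<in> W" using u by (simp add: W'_def)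
    obtain \<xi> where \<xi>: "om \<xi> u = z 1 u" using om_surj[OF uW] by blast
    obtain \<epsilon> R where R: "\<epsilon> * cnj \<epsilon> = 1" "\<And>i j. S i j u = \<epsilon> * complex_of_real (R i j)" using phase[OF uV] by blast
    define D where "D i j \<eta> = (\<Sum>m\<in>UNIV. \<Psi> i m \<eta> u * S m j u + \<Psi> j m \<eta> u * S i m u)" for i j \<eta>
    have der: "Im (D i j \<eta> * cnj (S k l u) + S i j u * cnj (D k l \<eta>)) = 0" for i j k l \<eta>
    proof -
      have "((\<lambda>w. Im (S i j w * cnj (S k l w))) has_derivative
          (\<lambda>\<eta>. Im (S i j u * cnj (D k l \<eta>) + D i j \<eta> * cnj (S k l u)))) (at u)"
        unfolding D_def
        by (intro bounded_linear.has_derivative[OF bounded_linear_Im] has_derivative_mult S_der[OF uW]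
            bounded_linear.has_derivative[OF bounded_linear_cnj])
      moreover have "((\<lambda>w. Im (S i j w * cnj (S k l w))) has_derivative (\<lambda>\<eta>. 0)) (at u)"
        by (rule has_derivative_transform_within_open[of "\<lambda>_. 0" _ _ _ V]) (use uV oV im in auto)
      ultimately have "(\<lambda>\<eta>. Im (S i j u * cnj (D k l \<eta>) + D i j \<eta> * cnj (S k l u))) = (\<lambda>\<eta>. 0)"
        by (rule has_derivative_unique)
      from fun_cong[OF this, of \<eta>] show ?thesis by (simp add: add.commute)
    qed
    have "Im (\<Psi> i j \<xi> u) = (if i = j then (if i = 1 then - 2 * mu u else mu u) else 0)" for i j
      using Im_\<Psi>_frame[OF uW \<xi>] Im_\<Psi>_sym[OF uW, of i j \<xi>] by (cases "i = 1"; cases "j = 1") auto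
    then have "mu u = 0"
      using common_phase_derivative[of "\<lambda>i j. S i j u" \<epsilon> R "\<lambda>i j. D i j \<xi>" "\<lambda>i j. \<Psi> i j \<xi> u" "mu u",
          OF Ssym Sunit[OF uW] R(2,1) _ _ der] nz D_def by blast
    then show False using u by (simp add: W'_def)
  qed
  have uW': "u \<in> W'" using u mu0 by (simp add: W'_def)
  obtain \<xi> where \<xi>: "\<And>k. om (\<xi> k) u = z k u" using om_surj[OF u] by metis
  have S0: "S 1 2 u = 0" "S 1 3 u = 0" "S 2 1 u = 0" "S 3 1 u = 0" using zero[OF uW'] Ssym by metis+
  \<comment> \<open>The entries \<open>S 1 2\<close> and \<open>S 1 3\<close> vanish on the open set
    \<open>W'\<close>, hence so do their derivatives from \<open>S_der\<close>.\<close>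
  have dz: "(\<Sum>m\<in>UNIV. \<Psi> 1 m \<eta> u * S m j u + \<Psi> j m \<eta> u * S 1 m u) = 0" if j: "j = 2 \<or> j = 3" for j \<eta>
  proof -
    have "((\<lambda>u. S 1 j u) has_derivative (\<lambda>\<eta>. 0)) (at u)"
      by (rule has_derivative_transform_within_open[of "\<lambda>_. 0" _ _ _ W']) (use uW' oW' zero j in auto)
    then have "(\<lambda>\<eta>. \<Sum>m\<in>UNIV. \<Psi> 1 m \<eta> u * S m j u + \<Psi> j m \<eta> u * S 1 m u) = (\<lambda>\<eta>. 0)"
      using has_derivative_unique[OF S_der[OF u, of 1 j]] by blast
    then show ?thesis by (rule fun_cong)
  qed
  define v where "v k j = Re (\<Psi> 1 j (\<xi> k) u)" for k j
  have P1: "\<Psi> 1 j (\<xi> k) u = of_real (v k j) + \<i> * of_real (if k = j then mu u else 0)" if "j \<noteq> 1" for j k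
    using Im_\<Psi>_frame(2)[OF u \<xi>, of j k] that by (auto simp: complex_eq_iff v_def)
  have P2: "\<Psi> j 1 (\<xi> k) u = - of_real (v k j) + \<i> * of_real (if k = j then mu u else 0)" if "j \<noteq> 1" for j k
    using Im_\<Psi>_frame(2)[OF u \<xi>, of j k] Im_\<Psi>_sym[OF u, of j 1 "\<xi> k"] Re_\<Psi>_skew[OF u, of j 1 "\<xi> k"] that
    by (auto simp: complex_eq_iff v_def)
  have row: "\<Psi> 1 2 (\<xi> k) u * S 2 j u + \<Psi> 1 3 (\<xi> k) u * S 3 j u + \<Psi> j 1 (\<xi> k) u * S 1 1 u = 0" if "j = 2 \<or> j = 3" for j k
    using dz[OF that, of "\<xi> k"] S0 that by (auto simp: sum_3 ac_simps)
  have "complex_of_real (v 2 3) = of_real (v 3 2)"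
  proof (rule eigenvector_frame_symmetric)
    show "complex_of_real (v 2 2) * (S 2 2 u - S 1 1 u) + of_real (v 2 3) * S 2 3 u
        + \<i> * of_real (mu u) * (S 2 2 u + S 1 1 u) = 0"
      using row[of 2 2] by (simp add: P1 P2 Ssym[of 3 2] algebra_simps)
    show "complex_of_real (v 2 2) * S 2 3 u + of_real (v 2 3) * (S 3 3 u - S 1 1 u)
        + \<i> * of_real (mu u) * S 2 3 u = 0"
      using row[of 3 2] by (simp add: P1 P2 Ssym[of 3 2] algebra_simps)
    show "complex_of_real (v 3 2) * (S 2 2 u - S 1 1 u) + of_real (v 3 3) * S 2 3 u
        + \<i> * of_real (mu u) * S 2 3 u = 0"
      using row[of 2 3] by (simp add: P1 P2 Ssym[of 3 2] algebra_simps)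
    show "complex_of_real (v 3 2) * S 2 3 u + of_real (v 3 3) * (S 3 3 u - S 1 1 u)
        + \<i> * of_real (mu u) * (S 3 3 u + S 1 1 u) = 0"
      using row[of 3 3] by (simp add: P1 P2 Ssym[of 3 2] algebra_simps)
    show "complex_of_real (mu u) \<noteq> 0" using mu0 by simp
    \<comment> \<open>The first row of the unitary matrix has unit length and no other nonzero
      entry.\<close>
    show "S 1 1 u \<noteq> 0" using Sunit[OF u, of 1 1] S0 by (auto simp: sum_3)
  qed
  then have "v 2 3 = v 3 2" by (simp only: of_real_eq_iff)
  \<comment> \<open>With equal coefficients and \<open>S 1 2 u = 0\<close>, the last Codazzi
    relation reduces to its determinant term.\<close>
  then have "Re (\<delta> u) = 0" using codazzi_umbilical(5)[OF u \<xi>] S0 mu0 unfolding v_def by simp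
  then have "\<delta> u = 0" using Im_\<delta>[OF u] by (simp add: complex_eq_iff)
  then show False using \<delta>_sq[OF u] by simp
qed

section \<open>Consequences of the vanishing of \<open>mu\<close>\<close>

lemma \<Psi>_real: assumes u: "u \<in> W" shows "Im (\<Psi> j l \<eta> u) = 0"
  using Im_\<Psi>_sym[OF u, of j 1 \<eta>]
  by (cases "j = 1"; cases "l = 1") (simp_all add: Im_\<Psi>[OF u] mu_eq_0[OF u])

text \<open>Both vectors are real combinations of the frame, whose triple products are all
  real.\<close>

lemma triple_product_real:
  assumes u: "u \<in> W" and x: "\<And>k. Im (bdot x (vcnj (z k u))) = 0" and y: "\<And>k. Im (bdot y (vcnj (z k u))) = 0"
  shows "Im (bdot (ccross x y) (z l u)) = 0"
proof -
  have r: "bdot w (vcnj (z k u)) = of_real (Re (bdot w (vcnj (z k u))))" if "\<And>k. Im (bdot w (vcnj (z k u))) = 0" for w k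
    using that by (simp add: complex_eq_iff)
  have e: "w = (\<Sum>k\<in>UNIV. Re (bdot w (vcnj (z k u))) *\<^sub>R z k u)" if "\<And>k. Im (bdot w (vcnj (z k u))) = 0" for w
    using unitary_basis_expand[OF unitary[OF u], of w] r[OF that]
    by (simp add: vec_eq_iff scaleR_conv_of_real[where 'a = complex])
  have t: "Im (bdot (ccross (z k u) (z j u)) (z l u)) = 0" for k j l
    using triple_product_cases[of "\<lambda>i. z i u" k j l] Im_\<delta>[OF u] unfolding \<delta>_def by auto
  obtain a b where "x = (\<Sum>k\<in>UNIV. a k *\<^sub>R z k u)" "y = (\<Sum>k\<in>UNIV. b k *\<^sub>R z k u)"
    by (rule that[OF e[OF x] e[OF y]])
  then show ?thesis by (simp add: sum_3 ccross_linear bdot_linear t)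
qed

text \<open>Since \<open>\<Psi>\<close> is real, the frame is parallel up to tangential terms, so a field \<open>y\<close> that stays tangent,
  with derivative \<open>d\<close> in direction \<open>\<eta>\<close>, has tangential covariant derivative.\<close>

lemma covariant_derivative_tangential:
  assumes u: "u \<in> W" and y: "\<And>k. Im (bdot y (vcnj (z k u))) = 0"
    and d: "Im (bdot y (vcnj (fd (z l) u \<eta>)) + bdot d (vcnj (z l u))) = 0"
  shows "Im (bdot (d + lc (om \<eta> u) y) (vcnj (z l u))) = 0"
proof -
  have "bdot y (vcnj (fd (z l) u \<eta>)) = - bdot (ccross (rr \<eta> u) y) (vcnj (z l u))
      + (\<Sum>m\<in>UNIV. cnj (\<Psi> l m \<eta> u) * bdot y (vcnj (z m u)))"
    unfolding z_der_eq[OF u] by (simp add: sum_3 vcnj_linear vcnj_ccross vcnj_rr bdot_linear bdot_ccross_skew)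
  then have "Im (bdot y (vcnj (fd (z l) u \<eta>))) = - Im (bdot (ccross (rr \<eta> u) y) (vcnj (z l u)))"
    by (simp add: \<Psi>_real[OF u] y)
  \<comment> \<open>The rotation part cancels the rotation in the derivative of the frame; the
    torsion part is real on tangent vectors.\<close>
  moreover have "lc (om \<eta> u) y = (1 / (2 * sqrt 3)) *\<^sub>R vcnj (ccross (om \<eta> u) y) - ccross (rr \<eta> u) y"
    unfolding lc_def rr_def ccross_linear vcnj_ccross by (simp add: algebra_simps)
  moreover have "Im (bdot (vcnj (ccross (om \<eta> u) y)) (vcnj (z l u))) = 0"
    using triple_product_real[OF u om_real[OF u] y] by (simp add: cnj_bdot[symmetric])
  ultimately show ?thesis using d by (simp add: bdot_linear)
qed

end

section \<open>Lagrangian immersions\<close>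

lemma lt_inv_J: "z \<in> S3S3 \<Longrightarrow> lt_inv z (J z w) = Ji (lt_inv z w)"
  by (simp add: J_lt_inv)

lemma S3S3_inner: "p \<in> S3S3 \<Longrightarrow> fst p \<bullet> fst p = 1" "p \<in> S3S3 \<Longrightarrow> snd p \<bullet> snd p = 1"
  by (auto simp: S3S3_def norm_eq_1)

lemma lc_linear:
  "lc x (y + y') = lc x y + lc x y'" "lc x (r *\<^sub>R y) = r *\<^sub>R lc x y"
  unfolding lc_def vcnj_linear ccross_linear by (simp_all add: algebra_simps)

lemma linear_cz_inv: "cz_inv (x + y) = cz_inv x + cz_inv y" "cz_inv (r *\<^sub>R x) = r *\<^sub>R cz_inv x"
  by (metis cz_linear(1) cz_cz_inv cz_inv_cz, metis cz_linear(3) cz_cz_inv cz_inv_cz)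

text \<open>Evaluates the basis sum in \<open>cov_deriv\<close>, using linearity of
  \<open>lc\<close> in its second argument.\<close>

lemma levi_civita_lt_sum:
  assumes "levi_civita nabla" "z \<in> S3S3"
  shows "(\<Sum>b\<in>Basis. (y \<bullet> b) *\<^sub>R nabla (\<lambda>z. lt z x) (\<lambda>z. lt z b) z) = lt z (cz_inv (lc (cz x) (cz y)))"
proof -
  have lin: "linear (\<lambda>y. lt z (cz_inv (lc (cz x) (cz y))))"
    by (auto simp: linear_iff cz_linear lc_linear linear_cz_inv lt_linear)
  have "lt z (cz_inv (lc (cz x) (cz y))) = lt z (cz_inv (lc (cz x) (cz (\<Sum>b\<in>Basis. (y \<bullet> b) *\<^sub>R b))))"
    by (simp add: euclidean_representation)
  also have "\<dots> = (\<Sum>b\<in>Basis. (y \<bullet> b) *\<^sub>R lt z (cz_inv (lc (cz x) (cz b))))"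
    by (simp only: linear_sum[OF lin] linear_cmul[OF lin])
  finally show ?thesis by (simp add: levi_civita_lt[OF assms])
qed

text \<open>The left-trivialized complex coordinate, defined for all ambient vectors and bilinear in
  base point and vector, so the product rule applies to it along a map.\<close>

definition cl :: "quat2 \<Rightarrow> quat2 \<Rightarrow> complex^3" where
  "cl p w = cz (lt_inv p w)"

lemma cl_linear: "cl p (v + w) = cl p v + cl p w" "cl p (v - w) = cl p v - cl p w" "cl p (r *\<^sub>R w) = r *\<^sub>R cl p w"
  by (simp_all add: cl_def lt_inv_linear cz_linear)

lemma cl_lt: "p \<in> S3S3 \<Longrightarrow> cl p (lt p e) = cz e"
  by (simp add: cl_def)

lemma cl_J: "p \<in> S3S3 \<Longrightarrow> cl p (J p w) = \<i> *s cl p w"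
  by (simp add: cl_def lt_inv_J cz_Ji)

lemma g_cl: "g p v w = Re (bdot (cl p v) (vcnj (cl p w)))"
  by (simp add: cl_def g_lt_inv gi_cz)

lemma g_linear: "g p (v + w) x = g p v x + g p w x" "g p (r *\<^sub>R v) x = r * g p v x" "g p 0 x = 0"
  using cl_linear(2)[of p 0 0] by (simp_all add: g_cl cl_linear bdot_linear) (simp add: bdot_def)

lemma cl_inj: "p \<in> S3S3 \<Longrightarrow> v \<in> TS p \<Longrightarrow> w \<in> TS p \<Longrightarrow> cl p v = cl p w \<Longrightarrow> v = w"
  by (metis cl_def cz_eq_iff lt_lt_inv)

lemma bounded_bilinear_cl: "bounded_bilinear cl"
  by (simp add: bilinear_conv_bounded_bilinear[symmetric] bilinear_def linear_iff cl_def lt_inv_linear cz_linear)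

lemma subspace_TS: "subspace (TS p)"
proof -
  have "TS p = range (lt p)" unfolding set_eq_iff TS_iff image_iff by blast
  moreover have "linear (lt p)" by (rule linearI) (simp_all add: lt_linear)
  ultimately show ?thesis using linear_subspace_image subspace_UNIV by metis
qed

text \<open>The unit base points cancel, leaving a commutator of imaginary quaternions. This is the
  term in the Maurer-Cartan equation that comes from differentiating the base point.\<close>

lemma lt_inv_lt_lt:
  assumes "p \<in> S3S3"
  shows "lt_inv (lt p a) (lt p b) - lt_inv (lt p b) (lt p a) = (- 1) *\<^sub>R brk a b"
proof -
  have "qcnj (x \<otimes>\<^sub>q imq c) \<otimes>\<^sub>q (x \<otimes>\<^sub>q imq d) = qcnj (imq c) \<otimes>\<^sub>q imq d" if "norm x = 1" for x c d
    by (simp add: qcnj_qmul qmul_assoc qcnj_qmul_cancel(1)[OF that])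
  moreover have "snd (qcnj (imq c) \<otimes>\<^sub>q imq d) - snd (qcnj (imq d) \<otimes>\<^sub>q imq c) = (- 2) *\<^sub>R cross3 c d" for c d
    by (simp add: qmul_def qcnj_def imq_def cross_skew[of d c] scaleR_2)
  ultimately show ?thesis
    using assms by (auto simp: lt_inv_def lt_def brk_def S3S3_def)
qed

locale immersion3 =
  fixes V :: "(real^3) set" and \<phi> :: "real^3 \<Rightarrow> quat2"
  assumes V: "open V" and \<phi>_smooth: "smooth_on V \<phi>" and \<phi>_S: "\<And>u. u \<in> V \<Longrightarrow> \<phi> u \<in> S3S3"
    and \<phi>_inj: "\<And>u. u \<in> V \<Longrightarrow> inj (fd \<phi> u)"
    and lag: "\<And>u. u \<in> V \<Longrightarrow> J (\<phi> u) ` tangent_space \<phi> u \<subseteq> normal_space \<phi> u"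
begin

lemma \<phi>_der: "u \<in> V \<Longrightarrow> (\<phi> has_derivative fd \<phi> u) (at u)"
  by (rule smooth_onD[OF \<phi>_smooth])

lemma fd_in_TS: assumes u: "u \<in> V" shows "fd \<phi> u \<eta> \<in> TS (\<phi> u)"
proof (rule TS_I[OF \<phi>_S[OF u]])
  \<comment> \<open>Differentiates the constant norm of one quaternion factor; \<open>T\<close> is
    either projection.\<close>
  have *: "T (\<phi> u) \<bullet> T (fd \<phi> u \<eta>) = 0"
    if T: "bounded_linear T" and one: "\<And>u. u \<in> V \<Longrightarrow> T (\<phi> u) \<bullet> T (\<phi> u) = 1" for T :: "quat2 \<Rightarrow> quat"
  proof -
    have d: "((\<lambda>u. T (\<phi> u)) has_derivative (\<lambda>v. T (fd \<phi> u v))) (at u)"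
      by (rule bounded_linear.has_derivative[OF T \<phi>_der[OF u]])
    have "((\<lambda>u. T (\<phi> u) \<bullet> T (\<phi> u)) has_derivative (\<lambda>v. 0)) (at u)"
      by (rule has_derivative_transform_within_open[of "\<lambda>_. 1" _ _ _ V]) (use u V one in auto)
    from fun_cong[OF has_derivative_unique[OF bounded_bilinear.FDERIV[OF bounded_bilinear_inner d d] this], of \<eta>]
    show ?thesis by (simp add: inner_commute)
  qed
  show "fst (\<phi> u) \<bullet> fst (fd \<phi> u \<eta>) = 0"
    by (rule *[OF bounded_linear_fst]) (simp add: S3S3_inner \<phi>_S)
  show "snd (\<phi> u) \<bullet> snd (fd \<phi> u \<eta>) = 0"
    by (rule *[OF bounded_linear_snd]) (simp add: S3S3_inner \<phi>_S)
qed

lemma tangent_in_TS: "u \<in> V \<Longrightarrow> v \<in> tangent_space \<phi> u \<Longrightarrow> v \<in> TS (\<phi> u)"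
  using fd_in_TS by (auto simp: tangent_space_def)

lemma subspace_tangent: "u \<in> V \<Longrightarrow> subspace (tangent_space \<phi> u)"
  unfolding tangent_space_def by (intro linear_subspace_image has_derivative_linear[OF \<phi>_der] subspace_UNIV)

lemma subspace_normal: "subspace (normal_space \<phi> u)"
  unfolding normal_space_def using subspace_TS[of "\<phi> u"]
  by (intro subspaceI) (simp_all add: g_linear subspace_0 subspace_add subspace_scale del: split_paired_All)

text \<open>The metric is the real part of the Hermitian form and \<open>J\<close> multiplies by
  \<open>\<i>\<close>, so orthogonality of \<open>J v\<close> and \<open>w\<close> is the vanishing
  of this imaginary part.\<close>

lemma tangent_real:
  assumes u: "u \<in> V" and "v \<in> tangent_space \<phi> u" "w \<in> tangent_space \<phi> u"
  shows "Im (bdot (cl (\<phi> u) v) (vcnj (cl (\<phi> u) w))) = 0"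
proof -
  have "J (\<phi> u) v \<in> normal_space \<phi> u" using lag[OF u] assms by blast
  then have "g (\<phi> u) (J (\<phi> u) v) w = 0" using assms by (auto simp: normal_space_def)
  then show ?thesis by (simp add: g_cl cl_J[OF \<phi>_S[OF u]] bdot_linear)
qed

text \<open>Two candidates differ by a vector both normal and tangent, which has zero length and
  hence vanishes.\<close>

lemma second_ff_eqI:
  assumes u: "u \<in> V" and n: "n \<in> normal_space \<phi> u" "cov_deriv nabla \<phi> X Y u - n \<in> tangent_space \<phi> u"
  shows "second_ff nabla \<phi> X Y u = n"
  unfolding second_ff_def
proof (rule the_equality)
  fix n' assume n': "n' \<in> normal_space \<phi> u \<and> cov_deriv nabla \<phi> X Y u - n' \<in> tangent_space \<phi> u"
  have "n' - n \<in> normal_space \<phi> u" using subspace_diff[OF subspace_normal] n n' by blast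
  moreover have "(cov_deriv nabla \<phi> X Y u - n) - (cov_deriv nabla \<phi> X Y u - n') \<in> tangent_space \<phi> u"
    using subspace_diff[OF subspace_tangent[OF u]] n n' by blast
  ultimately have "g (\<phi> u) (n' - n) (n' - n) = 0" by (simp add: normal_space_def)
  then have "(\<Sum>i\<in>UNIV. (cmod (cl (\<phi> u) (n' - n) $ i))\<^sup>2) = 0"
    by (simp add: g_cl bdot_def complex_norm_square[symmetric] cmod_power2)
  then have "cl (\<phi> u) (n' - n) = 0" by (simp add: sum_nonneg_eq_0_iff vec_eq_iff)
  then have "cl (\<phi> u) n' = cl (\<phi> u) n" by (simp add: cl_linear)
  then show "n' = n" using cl_inj[OF \<phi>_S[OF u]] n n' by (auto simp: normal_space_def)
qed (use n in blast)

text \<open>The pullback of the left-invariant Maurer-Cartan form in complex coordinates.\<close>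

definition om :: "real^3 \<Rightarrow> real^3 \<Rightarrow> complex^3" where
  "om \<eta> u = cl (\<phi> u) (fd \<phi> u \<eta>)"

lemma om_smooth: "smooth_on V (om \<eta>)"
  unfolding om_def[abs_def]
  by (intro smooth_on_bounded_bilinear[OF bounded_bilinear_cl V] \<phi>_smooth smooth_on_frechet_derivative)

text \<open>In the product rule for \<open>cl\<close>, the second derivatives of
  \<open>\<phi>\<close> cancel by symmetry; the derivatives of the base point give minus the
  bracket.\<close>

lemma om_maurer_cartan:
  assumes u: "u \<in> V"
  shows "fd (om \<eta>') u \<eta> - fd (om \<eta>) u \<eta>' =
      (1 / sqrt 3) *\<^sub>R (2 *\<^sub>R ccross (om \<eta> u) (om \<eta>' u) + ccross (om \<eta> u) (vcnj (om \<eta>' u))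
        + ccross (vcnj (om \<eta> u)) (om \<eta>' u) - ccross (vcnj (om \<eta> u)) (vcnj (om \<eta>' u)))"
proof -
  have d: "fd (om \<eta>) u v = cl (\<phi> u) (fd (\<lambda>u. fd \<phi> u \<eta>) u v) + cl (fd \<phi> u v) (fd \<phi> u \<eta>)" for \<eta> v
  proof -
    have "(om \<eta> has_derivative (\<lambda>v. cl (\<phi> u) (fd (\<lambda>u. fd \<phi> u \<eta>) u v) + cl (fd \<phi> u v) (fd \<phi> u \<eta>))) (at u)"
      unfolding om_def[abs_def]
      by (intro bounded_bilinear.FDERIV[OF bounded_bilinear_cl] \<phi>_der u
          smooth_onD[OF smooth_on_frechet_derivative[OF \<phi>_smooth] u])
    from fun_cong[OF frechet_derivative_at[OF this], of v] show ?thesis by (rule sym)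
  qed
  have sy: "fd (\<lambda>u. fd \<phi> u \<eta>') u \<eta> = fd (\<lambda>u. fd \<phi> u \<eta>) u \<eta>'"
    by (rule smooth_on_second_derivative_symmetric[OF V u \<phi>_smooth])
  obtain a b where ab: "fd \<phi> u \<eta> = lt (\<phi> u) a" "fd \<phi> u \<eta>' = lt (\<phi> u) b"
    using fd_in_TS[OF u] TS_iff by metis
  have "fd (om \<eta>') u \<eta> - fd (om \<eta>) u \<eta>' = cz (lt_inv (lt (\<phi> u) a) (lt (\<phi> u) b) - lt_inv (lt (\<phi> u) b) (lt (\<phi> u) a))"
    unfolding d sy ab by (simp add: cl_def cz_linear)
  also have "\<dots> = (- 1) *\<^sub>R cz (brk a b)"
    unfolding lt_inv_lt_lt[OF \<phi>_S[OF u]] cz_linear ..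
  finally show ?thesis unfolding cz_brk om_def ab cl_lt[OF \<phi>_S[OF u]] by simp
qed

lemma om_inj: assumes u: "u \<in> V" and "om \<eta> u = 0" shows "\<eta> = 0"
proof -
  have "cl (\<phi> u) 0 = 0" using cl_linear(2)[of "\<phi> u" 0 0] by simp
  then have "fd \<phi> u \<eta> = 0"
    using cl_inj[OF \<phi>_S[OF u] fd_in_TS[OF u] subspace_0[OF subspace_TS]] assms by (simp add: om_def)
  moreover have "fd \<phi> u 0 = 0" using linear_0[OF has_derivative_linear[OF \<phi>_der[OF u]]] .
  ultimately show ?thesis using \<phi>_inj[OF u] by (metis injD)
qed

text \<open>Injectivity of the differential resolves the description operator in
  \<open>cov_deriv\<close>, and \<open>lc\<close> replaces the sum of connection terms.\<close>

lemma cl_cov_deriv: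
  assumes lev: "levi_civita nabla" and u: "u \<in> V" and Y: "smooth_on V Y" and X: "fd \<phi> u \<xi> = X u"
  shows "cl (\<phi> u) (cov_deriv nabla \<phi> X Y u) = fd (\<lambda>u. cl (\<phi> u) (Y u)) u \<xi> + lc (om \<xi> u) (cl (\<phi> u) (Y u))"
    and "cov_deriv nabla \<phi> X Y u \<in> TS (\<phi> u)"
proof -
  let ?y = "\<lambda>u. lt_inv (\<phi> u) (Y u)"
  have the: "(THE \<xi>. fd \<phi> u \<xi> = X u) = \<xi>"
  proof (rule the_equality, rule X)
    fix \<xi>' assume "fd \<phi> u \<xi>' = X u"
    then have "fd \<phi> u \<xi>' = fd \<phi> u \<xi>" by (simp only: X)
    then show "\<xi>' = \<xi>" by (rule injD[OF \<phi>_inj[OF u]])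
  qed
  have cov: "cov_deriv nabla \<phi> X Y u = lt (\<phi> u) (fd ?y u \<xi> + cz_inv (lc (cz (lt_inv (\<phi> u) (X u))) (cz (?y u))))"
    unfolding cov_deriv_def Let_def the levi_civita_lt_sum[OF lev \<phi>_S[OF u]] lt_linear ..
  have "smooth_on V ?y"
    by (intro smooth_on_bounded_bilinear[OF bounded_bilinear_lt_inv V] \<phi>_smooth Y)
  then have "((\<lambda>u. cz (?y u)) has_derivative (\<lambda>v. cz (fd ?y u v))) (at u)"
    using u by (intro bounded_linear.has_derivative[OF bounded_linear_cz] smooth_onD)
  then have "fd (\<lambda>u. cz (?y u)) u = (\<lambda>v. cz (fd ?y u v))" by (rule frechet_derivative_at[symmetric])
  then show "cl (\<phi> u) (cov_deriv nabla \<phi> X Y u) = fd (\<lambda>u. cl (\<phi> u) (Y u)) u \<xi> + lc (om \<xi> u) (cl (\<phi> u) (Y u))"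
    unfolding cov cl_lt[OF \<phi>_S[OF u]] cz_linear cz_cz_inv unfolding om_def cl_def X by simp
  show "cov_deriv nabla \<phi> X Y u \<in> TS (\<phi> u)" using cov TS_iff by blast
qed

end

section \<open>Orthonormal frames and the Gauss formula\<close>

text \<open>Links the index type \<open>3\<close>, whose numeral 3 denotes 0, with the
  natural-number labels 1, 2, 3 of the frame.\<close>

definition idx :: "3 \<Rightarrow> nat" where
  "idx j = (if j = 1 then 1 else if j = 2 then 2 else 3)"

lemma idx_simps [simp]: "idx 1 = 1" "idx 2 = 2" "idx 3 = 3"
  by (simp_all add: idx_def)

lemma idx_eq_iff: "idx i = idx j \<longleftrightarrow> i = j"
  using exhaust_3[of i] exhaust_3[of j] by auto

lemma idx_range: "idx j \<in> {1..3}" "j \<noteq> 1 \<Longrightarrow> idx j \<in> {2..3}"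
  using exhaust_3[of j] by auto

locale framed_immersion = immersion3 +
  fixes U :: "nat \<Rightarrow> real^3 \<Rightarrow> quat2"
  assumes frame: "orthonormal_frame \<phi> V U"
begin

definition zf :: "3 \<Rightarrow> real^3 \<Rightarrow> complex^3" where
  "zf j u = cl (\<phi> u) (U (idx j) u)"

lemma U_tangent: "u \<in> V \<Longrightarrow> U (idx j) u \<in> tangent_space \<phi> u"
  using frame idx_range unfolding orthonormal_frame_def tangent_field_def by blast

lemma U_smooth: "smooth_on V (U (idx j))"
  using frame idx_range unfolding orthonormal_frame_def tangent_field_def by blast

text \<open>Orthonormality gives the real part of each Hermitian product, the Lagrangian condition
  the imaginary part.\<close>

lemma zf_unitary: assumes u: "u \<in> V" shows "unitary_basis (\<lambda>j. zf j u)"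
  unfolding unitary_basis_def
proof (intro allI)
  fix i j
  have "g (\<phi> u) (U (idx i) u) (U (idx j) u) = (if i = j then 1 else 0)"
    using frame idx_range(1) u unfolding orthonormal_frame_def by (metis idx_eq_iff)
  then have "Re (bdot (zf i u) (vcnj (zf j u))) = (if i = j then 1 else 0)" by (simp add: g_cl zf_def)
  moreover have "Im (bdot (zf i u) (vcnj (zf j u))) = 0"
    unfolding zf_def by (intro tangent_real U_tangent u)
  ultimately show "bdot (zf i u) (vcnj (zf j u)) = (if i = j then 1 else 0)"
    by (simp add: complex_eq_iff)
qed

sublocale unitary_frame V zf om
proof (rule unitary_frame.intro)
  show "smooth_on V (zf j)" for j
    unfolding zf_def[abs_def]
    by (intro smooth_on_bounded_bilinear[OF bounded_bilinear_cl V] \<phi>_smooth U_smooth)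
  show "Im (bdot (om \<eta> u) (vcnj (zf k u))) = 0" if "u \<in> V" for u \<eta> k
    unfolding zf_def om_def by (intro tangent_real U_tangent that) (simp add: tangent_space_def)
  show "linear (\<lambda>\<eta>. om \<eta> u)" if "u \<in> V" for u
    using linear_add[OF has_derivative_linear[OF \<phi>_der[OF that]]] linear_cmul[OF has_derivative_linear[OF \<phi>_der[OF that]]]
    by (intro linearI) (simp_all add: om_def cl_linear)
  show "\<exists>\<xi>. om \<xi> u = zf k u" if "u \<in> V" for u k
    using U_tangent[OF that, of k] unfolding om_def zf_def tangent_space_def by force
qed (fact V om_smooth zf_unitary om_inj om_maurer_cartan)+

text \<open>Real coefficients in the unitary basis exhibit the vector as a real combination of the
  tangent frame.\<close>

lemma tangentI:
  assumes u: "u \<in> V" and w: "w \<in> TS (\<phi> u)" and im: "\<And>l. Im (bdot (cl (\<phi> u) w) (vcnj (zf l u))) = 0"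
  shows "w \<in> tangent_space \<phi> u"
proof -
  define c where "c l = Re (bdot (cl (\<phi> u) w) (vcnj (zf l u)))" for l
  define w' where "w' = c 1 *\<^sub>R U (idx 1) u + c 2 *\<^sub>R U (idx 2) u + c 3 *\<^sub>R U (idx 3) u"
  have t: "w' \<in> tangent_space \<phi> u"
    unfolding w'_def using subspace_tangent[OF u] U_tangent[OF u] subspace_add subspace_scale by metis
  have "bdot (cl (\<phi> u) w) (vcnj (zf l u)) = of_real (c l)" for l
    using im by (simp add: c_def complex_eq_iff)
  then have "cl (\<phi> u) w = (\<Sum>l\<in>UNIV. of_real (c l) *s zf l u)"
    using unitary_basis_expand[OF zf_unitary[OF u], of "cl (\<phi> u) w"] by simp
  also have "\<dots> = cl (\<phi> u) w'"
    unfolding w'_def cl_linear sum_3 zf_def by (simp add: vec_eq_iff scaleR_conv_of_real[where 'a = complex])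
  finally have "w = w'" using cl_inj[OF \<phi>_S[OF u] w tangent_in_TS[OF u t]] by blast
  then show ?thesis using t by simp
qed

text \<open>Existence of the splitting behind the description operator: the normal part is built
  from the imaginary frame coefficients and the vectors \<open>J\<close> U.\<close>

lemma second_ff_tangent:
  assumes lev: "levi_civita nabla" and u: "u \<in> V" and X: "X u \<in> tangent_space \<phi> u" and Y: "smooth_on V Y"
  shows "cov_deriv nabla \<phi> X Y u - second_ff nabla \<phi> X Y u \<in> tangent_space \<phi> u"
proof -
  let ?c = "cov_deriv nabla \<phi> X Y u"
  obtain \<xi> where \<xi>: "fd \<phi> u \<xi> = X u" using X by (auto simp: tangent_space_def)
  have cT: "?c \<in> TS (\<phi> u)" by (rule cl_cov_deriv(2)[where X = X, OF lev u Y \<xi>])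
  define b where "b l = Im (bdot (cl (\<phi> u) ?c) (vcnj (zf l u)))" for l
  define n where "n = b 1 *\<^sub>R J (\<phi> u) (U (idx 1) u) + b 2 *\<^sub>R J (\<phi> u) (U (idx 2) u) + b 3 *\<^sub>R J (\<phi> u) (U (idx 3) u)"
  have JN: "J (\<phi> u) (U (idx j) u) \<in> normal_space \<phi> u" for j using lag[OF u] U_tangent[OF u] by blast
  have n: "n \<in> normal_space \<phi> u"
    unfolding n_def using subspace_normal JN subspace_add subspace_scale by metis
  have nT: "n \<in> TS (\<phi> u)" using n by (simp add: normal_space_def)
  have "cl (\<phi> u) n = (\<Sum>l\<in>UNIV. (\<i> * of_real (b l)) *s zf l u)"
    unfolding n_def cl_linear cl_J[OF \<phi>_S[OF u]] sum_3 zf_def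
    by (simp add: vec_eq_iff scaleR_conv_of_real[where 'a = complex])
  then have "Im (bdot (cl (\<phi> u) n) (vcnj (zf l u))) = b l" for l
    using zf_unitary[OF u] exhaust_3[of l] by (auto simp: sum_3 bdot_linear unitary_basis_def)
  then have "?c - n \<in> tangent_space \<phi> u"
    by (intro tangentI[OF u subspace_diff[OF subspace_TS cT nT]]) (simp add: cl_linear bdot_linear b_def)
  then show ?thesis using second_ff_eqI[OF u n] by simp
qed

text \<open>Subtracting the second fundamental form leaves a tangent vector, whose frame
  coefficients are real; the imaginary part therefore sees only the given normal term.\<close>

lemma gauss_formula:
  assumes lev: "levi_civita nabla" and u: "u \<in> V" and \<xi>: "om \<xi> u = zf k u"
    and h: "second_ff nabla \<phi> (U (idx k)) (U (idx j)) u = c *\<^sub>R J (\<phi> u) (U (idx m) u)"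
  shows "Im (bdot (fd (zf j) u \<xi> + lc (zf k u) (zf j u)) (vcnj (zf l u))) = (if l = m then c else 0)"
proof -
  have X: "fd \<phi> u \<xi> = U (idx k) u"
    using cl_inj[OF \<phi>_S[OF u] fd_in_TS[OF u] tangent_in_TS[OF u U_tangent[OF u]]] \<xi> unfolding om_def zf_def by blast
  have "Im (bdot (cl (\<phi> u) (cov_deriv nabla \<phi> (U (idx k)) (U (idx j)) u - c *\<^sub>R J (\<phi> u) (U (idx m) u))) (vcnj (zf l u))) = 0"
    using second_ff_tangent[where X = "U (idx k)" and Y = "U (idx j)", OF lev u U_tangent[OF u] U_smooth] U_tangent[OF u, of l]
    unfolding h zf_def by (intro tangent_real u)
  then have "Im (bdot (cl (\<phi> u) (cov_deriv nabla \<phi> (U (idx k)) (U (idx j)) u)) (vcnj (zf l u))) = 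
      Im (of_real c * (\<i> * bdot (zf m u) (vcnj (zf l u))))"
    unfolding cl_linear cl_J[OF \<phi>_S[OF u]] bdot_linear zf_def by simp
  also have "\<dots> = (if l = m then c else 0)" using zf_unitary[OF u] by (auto simp: unitary_basis_def)
  also have "cl (\<phi> u) (cov_deriv nabla \<phi> (U (idx k)) (U (idx j)) u) = fd (zf j) u \<xi> + lc (zf k u) (zf j u)"
    using cl_cov_deriv(1)[where X = "U (idx k)" and Y = "U (idx j)", OF lev u U_smooth X] \<xi> unfolding zf_def[abs_def] by simp
  finally show ?thesis .
qed

end

section \<open>Changes of parametrization\<close>

text \<open>A left inverse \<open>L\<close> of the injective differential makes
  \<open>L (f y)\<close> agree with \<open>y\<close> to first order at \<open>\<tau> x0\<close>. So
  \<open>\<tau>\<close> is differentiable like \<open>L (h x)\<close>, once continuity localizes the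
  estimate.\<close>

lemma has_derivative_lift_immersion:
  fixes f :: "'a::euclidean_space \<Rightarrow> 'b::euclidean_space" and h :: "'c::euclidean_space \<Rightarrow> 'b"
  assumes f: "(f has_derivative f') (at (\<tau> x0))" and inj: "inj f'"
    and h: "(h has_derivative h') (at x0)" and \<tau>: "isCont \<tau> x0"
    and N: "open N" "x0 \<in> N" "\<And>x. x \<in> N \<Longrightarrow> h x = f (\<tau> x)"
  obtains T where "(\<tau> has_derivative T) (at x0)"
proof -
  obtain L where L: "linear L" "L \<circ> f' = id"
    using linear_injective_left_inverse[OF has_derivative_linear[OF f] inj] by blast
  have bL: "bounded_linear L" using L linear_conv_bounded_linear by blast
  define T where "T v = L (h' v)" for v
  have G: "((\<lambda>y. L (f y)) has_derivative (\<lambda>v. v)) (at (\<tau> x0))"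
    using bounded_linear.has_derivative[OF bL f] fun_cong[OF L(2)] by (simp add: o_def)
  have H: "((\<lambda>x. L (h x)) has_derivative T) (at x0)"
    unfolding T_def by (rule bounded_linear.has_derivative[OF bL h])
  then have bT: "bounded_linear T" by (rule has_derivative_bounded_linear)
  then obtain B where B: "B > 0" "\<And>v. norm (T v) \<le> norm v * B" using bounded_linear.pos_bounded by blast
  have "(\<tau> has_derivative T) (at x0)"
    unfolding has_derivative_at_alt
  proof (intro conjI allI impI bT)
    fix e :: real assume e: "e > 0"
    \<comment> \<open>The bound 1/2 lets the increment of \<open>\<tau>\<close> be absorbed, giving
      the factor \<open>2 * B + 1\<close>; the other bound then pays for that factor plus
      one.\<close>
    define e1 where "e1 = min (1 / 2) (e / (2 * B + 2))"
    have e1: "e1 > 0" "e1 \<le> 1 / 2" "e1 * (2 * B + 2) \<le> e"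
    proof -
      show "e1 > 0" using e B by (simp add: e1_def)
      show "e1 \<le> 1 / 2" unfolding e1_def by (rule min.cobounded1)
      have "e1 \<le> e / (2 * B + 2)" by (simp add: e1_def)
      then show "e1 * (2 * B + 2) \<le> e" using B by (simp add: pos_le_divide_eq)
    qed
    obtain d1 where d1: "d1 > 0" "\<And>y. norm (y - \<tau> x0) < d1 \<Longrightarrow>
        norm (L (f y) - L (f (\<tau> x0)) - (y - \<tau> x0)) \<le> e1 * norm (y - \<tau> x0)"
      using G e1(1) unfolding has_derivative_at_alt by blast
    obtain d2 where d2: "d2 > 0" "\<And>x. norm (x - x0) < d2 \<Longrightarrow> norm (\<tau> x - \<tau> x0) < d1"
      using \<tau> d1(1) unfolding continuous_at_eps_delta dist_norm by blast
    obtain d3 where d3: "d3 > 0" "\<And>x. norm (x - x0) < d3 \<Longrightarrow>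
        norm (L (h x) - L (h x0) - T (x - x0)) \<le> e1 * norm (x - x0)"
      using H e1(1) unfolding has_derivative_at_alt by blast
    obtain d4 where d4: "d4 > 0" "\<And>x. norm (x - x0) < d4 \<Longrightarrow> x \<in> N"
      using N(1,2) unfolding open_dist dist_norm by blast
    show "\<exists>d>0. \<forall>y. norm (y - x0) < d \<longrightarrow> norm (\<tau> y - \<tau> x0 - T (y - x0)) \<le> e * norm (y - x0)"
    proof (intro exI[of _ "min d2 (min d3 d4)"] conjI allI impI)
      show "0 < min d2 (min d3 d4)" using d2 d3 d4 by simp
      fix x assume x: "norm (x - x0) < min d2 (min d3 d4)"
      let ?D = "\<tau> x - \<tau> x0"
      have 1: "norm (L (h x) - L (h x0) - ?D) \<le> e1 * norm ?D"
        using d1(2)[OF d2(2)] x d4(2) N by simp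
      have 2: "norm (L (h x) - L (h x0) - T (x - x0)) \<le> e1 * norm (x - x0)" using d3(2) x by simp
      have 3: "norm (?D - T (x - x0)) \<le> e1 * norm ?D + e1 * norm (x - x0)"
      proof -
        have "?D - T (x - x0) = (L (h x) - L (h x0) - T (x - x0)) - (L (h x) - L (h x0) - ?D)" by simp
        then have "norm (?D - T (x - x0)) \<le> norm (L (h x) - L (h x0) - T (x - x0)) + norm (L (h x) - L (h x0) - ?D)"
          by (simp only: norm_triangle_ineq4)
        then show ?thesis using 1 2 by linarith
      qed
      have "norm ?D \<le> norm (?D - T (x - x0)) + norm (T (x - x0))" using norm_triangle_ineq[of "?D - T (x - x0)" "T (x - x0)"] by simp
      also have "\<dots> \<le> e1 * norm ?D + e1 * norm (x - x0) + norm (x - x0) * B" using 3 B(2) add_mono by blast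
      also have "\<dots> \<le> 1 / 2 * norm ?D + 1 / 2 * norm (x - x0) + norm (x - x0) * B"
        using e1(2) by (intro add_mono mult_right_mono order_refl) auto
      finally have 4: "norm ?D \<le> (2 * B + 1) * norm (x - x0)" by (simp add: algebra_simps)
      have "e1 * norm ?D + e1 * norm (x - x0) \<le> e1 * ((2 * B + 1) * norm (x - x0)) + e1 * norm (x - x0)"
        using 4 e1(1) by (simp add: mult_left_mono)
      also have "\<dots> = (e1 * (2 * B + 2)) * norm (x - x0)" by (simp add: algebra_simps)
      also have "\<dots> \<le> e * norm (x - x0)" using e1(3) by (simp add: mult_right_mono)
      finally show "norm (?D - T (x - x0)) \<le> e * norm (x - x0)" using 3 by simp
    qed
  qed
  then show thesis by (rule that)
qed

lemma local_param_transition: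
  assumes P: "local_param M F V \<psi>" and P': "local_param M F V' \<psi>'"
    and u: "u \<in> V" and u': "\<psi> u \<in> \<psi>' ` V'"
  obtains N \<tau> where "open N" "u \<in> N" "N \<subseteq> V" "continuous_on N \<tau>" "\<tau> ` N \<subseteq> V'"
    "\<And>x. x \<in> N \<Longrightarrow> \<psi>' (\<tau> x) = \<psi> x"
proof -
  define N where "N = {x \<in> V. \<psi> x \<in> \<psi>' ` V'}"
  have V: "open V" and o': "openin M (\<psi>' ` V')" using P P' by (auto simp: local_param_def)
  have "continuous_map (top_of_set V) (subtopology M (\<psi> ` V)) \<psi>"
    using P by (simp add: local_param_def homeomorphic_imp_continuous_map)
  then have c: "continuous_map (top_of_set V) M \<psi>" by (simp add: continuous_map_in_subtopology)
  have "openin (top_of_set V) N"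
    using openin_continuous_map_preimage[OF c o'] by (simp add: N_def)
  then have oN: "open N" using V openin_open_trans by blast
  obtain h where h: "homeomorphic_maps (top_of_set V') (subtopology M (\<psi>' ` V')) \<psi>' h"
    using P' unfolding local_param_def homeomorphic_map_maps by blast
  have NV: "N \<subseteq> V" by (auto simp: N_def)
  have "continuous_map (top_of_set N) M \<psi>"
    using continuous_map_from_subtopology[OF c, of N] NV by (simp add: subtopology_subtopology inf.absorb2)
  then have "continuous_map (top_of_set N) (subtopology M (\<psi>' ` V')) \<psi>"
    by (auto simp: continuous_map_in_subtopology N_def)
  then have hc: "continuous_map (top_of_set N) (top_of_set V') (h \<circ> \<psi>)"
    using h unfolding homeomorphic_maps_def by (blast intro: continuous_map_compose)
  show thesis
  proof
    show "open N" "N \<subseteq> V" by (fact oN NV)+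
    show "u \<in> N" using u u' by (simp add: N_def)
    show "continuous_on N (h \<circ> \<psi>)" "(h \<circ> \<psi>) ` N \<subseteq> V'"
      using hc by (auto simp: continuous_map_in_subtopology)
    show "\<psi>' ((h \<circ> \<psi>) x) = \<psi> x" if "x \<in> N" for x
      using h that openin_subset[OF o'] unfolding homeomorphic_maps_def N_def by auto
  qed
qed

lemma lagrangian_immersion3:
  assumes "lagrangian M F" "local_param M F V \<psi>"
  shows "immersion3 V (F \<circ> \<psi>)"
proof
  show "(F \<circ> \<psi>) u \<in> S3S3" if "u \<in> V" for u
    using assms that openin_subset unfolding lagrangian_def submanifold3_def local_param_def by fastforce
qed (use assms in \<open>auto simp: lagrangian_def local_param_def\<close>)

lemma H_umbilical_frame:
  assumes lev: "levi_civita nabla" and lag: "lagrangian M F" and P: "local_param M F V \<psi>"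
    and fr: "orthonormal_frame (F \<circ> \<psi>) V U" and m: "smooth_on V m"
    and h: "\<forall>u\<in>V.
            second_ff nabla (F \<circ> \<psi>) (U 1) (U 1) u = l u *\<^sub>R J (F (\<psi> u)) (U 1 u) \<and>
            (\<forall>i\<in>{2..3}.
               second_ff nabla (F \<circ> \<psi>) (U 1) (U i) u = m u *\<^sub>R J (F (\<psi> u)) (U i u)) \<and>
            (\<forall>i\<in>{2..3}. \<forall>j\<in>{2..3}.
               second_ff nabla (F \<circ> \<psi>) (U i) (U j) u =
                 (m u * (if i = j then 1 else 0)) *\<^sub>R J (F (\<psi> u)) (U 1 u))"
  shows "framed_immersion V (F \<circ> \<psi>) U"
    and "umbilical_frame V (framed_immersion.zf (F \<circ> \<psi>) U) (immersion3.om (F \<circ> \<psi>)) l m"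
proof -
  interpret immersion3 V "F \<circ> \<psi>" by (rule lagrangian_immersion3[OF lag P])
  interpret framed_immersion V "F \<circ> \<psi>" U by unfold_locales (rule fr)
  show "framed_immersion V (F \<circ> \<psi>) U" by unfold_locales
  show "umbilical_frame V zf om l m"
  proof (unfold_locales, rule m)
    fix u \<xi> i assume u: "u \<in> V"
    have h: "second_ff nabla (F \<circ> \<psi>) (U (idx 1)) (U (idx 1)) u = l u *\<^sub>R J ((F \<circ> \<psi>) u) (U (idx 1) u)"
      "j \<noteq> 1 \<Longrightarrow> second_ff nabla (F \<circ> \<psi>) (U (idx 1)) (U (idx j)) u = m u *\<^sub>R J ((F \<circ> \<psi>) u) (U (idx j) u)"
      "k \<noteq> 1 \<Longrightarrow> j \<noteq> 1 \<Longrightarrow> second_ff nabla (F \<circ> \<psi>) (U (idx k)) (U (idx j)) u =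
        (if k = j then m u else 0) *\<^sub>R J ((F \<circ> \<psi>) u) (U (idx 1) u)" for j k
      using h u idx_range(2)[of j] idx_range(2)[of k] by (auto simp: idx_eq_iff)
    show "om \<xi> u = zf 1 u \<Longrightarrow> Im (bdot (fd (zf 1) u \<xi> + lc (zf 1 u) (zf 1 u)) (vcnj (zf i u))) = (if i = 1 then l u else 0)"
      by (rule gauss_formula[OF lev u _ h(1)])
    fix j :: 3
    show "om \<xi> u = zf 1 u \<Longrightarrow> j \<noteq> 1 \<Longrightarrow>
        Im (bdot (fd (zf j) u \<xi> + lc (zf 1 u) (zf j u)) (vcnj (zf i u))) = (if i = j then m u else 0)"
      by (rule gauss_formula[OF lev u _ h(2)])
    fix k
    show "om \<xi> u = zf k u \<Longrightarrow> k \<noteq> 1 \<Longrightarrow> j \<noteq> 1 \<Longrightarrow>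
        Im (bdot (fd (zf j) u \<xi> + lc (zf k u) (zf j u)) (vcnj (zf i u))) = (if k = j \<and> i = 1 then m u else 0)"
      using gauss_formula[OF lev u _ h(3), of \<xi> k j i] by auto
  qed
qed

theorem theorem1:
  fixes nabla :: connection
    and M :: "'m topology" and F :: "'m \<Rightarrow> quat2"
  assumes "levi_civita nabla"
    and "lagrangian M F"
    and "H_umbilical nabla M F"
  shows "totally_geodesic nabla M F"
  unfolding totally_geodesic_def
proof (intro allI impI ballI)
  fix V \<psi> X Y u
  assume P: "local_param M F V \<psi>" and X: "tangent_field (F \<circ> \<psi>) V X" and Y: "tangent_field (F \<circ> \<psi>) V Y" and u: "u \<in> V"
  have "\<psi> u \<in> topspace M" using P u openin_subset unfolding local_param_def by fastforce
  \<comment> \<open>The umbilical frame lives in a second parametrization around the same point,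
    generally different from the one carrying \<open>X\<close> and \<open>Y\<close>.\<close>
  then obtain V' \<psi>' U l m where P': "local_param M F V' \<psi>'" and u'0: "\<psi> u \<in> \<psi>' ` V'"
    and fr: "orthonormal_frame (F \<circ> \<psi>') V' U" and m: "smooth_on V' m"
    and h: "\<forall>u\<in>V'.
            second_ff nabla (F \<circ> \<psi>') (U 1) (U 1) u = l u *\<^sub>R J (F (\<psi>' u)) (U 1 u) \<and>
            (\<forall>i\<in>{2..3}.
               second_ff nabla (F \<circ> \<psi>') (U 1) (U i) u = m u *\<^sub>R J (F (\<psi>' u)) (U i u)) \<and>
            (\<forall>i\<in>{2..3}. \<forall>j\<in>{2..3}.
               second_ff nabla (F \<circ> \<psi>') (U i) (U j) u =
                 (m u * (if i = j then 1 else 0)) *\<^sub>R J (F (\<psi>' u)) (U 1 u))"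
    using assms(3) unfolding H_umbilical_def by blast
  interpret A: immersion3 V "F \<circ> \<psi>" by (rule lagrangian_immersion3[OF assms(2) P])
  interpret B: framed_immersion V' "F \<circ> \<psi>'" U by (rule H_umbilical_frame(1)[OF assms(1,2) P' fr m h])
  interpret C: umbilical_frame V' B.zf B.om l m by (rule H_umbilical_frame(2)[OF assms(1,2) P' fr m h])
  obtain N \<tau> where N: "open N" "u \<in> N" "N \<subseteq> V" and \<tau>: "continuous_on N \<tau>" "\<tau> ` N \<subseteq> V'"
    "\<And>x. x \<in> N \<Longrightarrow> \<psi>' (\<tau> x) = \<psi> x"
    using local_param_transition[OF P P' u u'0] by blast
  let ?\<phi> = "F \<circ> \<psi>" and ?\<phi>' = "F \<circ> \<psi>'"
  have eq: "?\<phi> x = ?\<phi>' (\<tau> x)" if "x \<in> N" for x using \<tau>(3)[OF that] by simp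
  \<comment> \<open>The continuous transition is differentiable because
    \<open>F \<circ> \<psi>'\<close> is an immersion, and its derivative is bijective by equality of
    dimensions, so both parametrizations have the same tangent spaces.\<close>
  have tr: "\<exists>T. (\<tau> has_derivative T) (at x) \<and> (\<forall>v. fd ?\<phi> x v = fd ?\<phi>' (\<tau> x) (T v)) \<and>
      tangent_space ?\<phi> x = tangent_space ?\<phi>' (\<tau> x)" if x: "x \<in> N" for x
  proof -
    have xV: "x \<in> V" "\<tau> x \<in> V'" using x N \<tau> by auto
    have "isCont \<tau> x" using \<tau>(1) N(1) x continuous_on_eq_continuous_at by blast
    then obtain T where T: "(\<tau> has_derivative T) (at x)"
      using has_derivative_lift_immersion[OF B.\<phi>_der[OF xV(2)] B.\<phi>_inj[OF xV(2)] A.\<phi>_der[OF xV(1)] _ N(1) x eq] by blast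
    have "((\<lambda>x. ?\<phi>' (\<tau> x)) has_derivative (\<lambda>v. fd ?\<phi>' (\<tau> x) (T v))) (at x)"
      by (rule has_derivative_compose[OF T B.\<phi>_der[OF xV(2)]])
    then have "(?\<phi> has_derivative (\<lambda>v. fd ?\<phi>' (\<tau> x) (T v))) (at x)"
      by (rule has_derivative_transform_within_open[OF _ N(1) x]) (simp only: eq)
    then have fdT: "fd ?\<phi> x = (\<lambda>v. fd ?\<phi>' (\<tau> x) (T v))" by (rule frechet_derivative_at[symmetric])
    have "inj T" using A.\<phi>_inj[OF xV(1)] unfolding fdT inj_def by metis
    then have "surj T" using linear_injective_imp_surjective[OF has_derivative_linear[OF T]] by simp
    then have "tangent_space ?\<phi> x = tangent_space ?\<phi>' (\<tau> x)"
      unfolding tangent_space_def fdT by (metis (no_types) image_image)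
    then show ?thesis using T fdT by metis
  qed
  obtain T where T: "(\<tau> has_derivative T) (at u)" "\<And>v. fd ?\<phi> u v = fd ?\<phi>' (\<tau> u) (T v)"
    using tr[OF N(2)] by blast
  have \<tau>u: "\<tau> u \<in> V'" using N \<tau> by auto
  have Xu: "X u \<in> tangent_space ?\<phi> u" and Ys: "smooth_on V Y" and Yt: "\<And>x. x \<in> V \<Longrightarrow> Y x \<in> tangent_space ?\<phi> x"
    using X Y u by (auto simp: tangent_field_def)
  obtain \<xi> where \<xi>: "fd ?\<phi> u \<xi> = X u" using Xu by (auto simp: tangent_space_def)
  let ?y = "\<lambda>x. cl (?\<phi> x) (Y x)"
  let ?c = "cov_deriv nabla ?\<phi> X Y u"
  have ys: "smooth_on V ?y"
    by (intro smooth_on_bounded_bilinear[OF bounded_bilinear_cl A.V] A.\<phi>_smooth Ys)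
  have yt: "Im (bdot (?y x) (vcnj (B.zf k (\<tau> x)))) = 0" if x: "x \<in> N" for x k
  proof -
    have xV: "x \<in> V" "\<tau> x \<in> V'" using x N \<tau> by auto
    have "Y x \<in> tangent_space ?\<phi>' (\<tau> x)" using tr[OF x] Yt[OF xV(1)] by blast
    then show ?thesis
      unfolding B.zf_def eq[OF x] by (intro B.tangent_real xV B.U_tangent)
  qed
  \<comment> \<open>The difference with 0 is the form in which \<open>second_ff_eqI\<close> accepts
    0 as the normal part.\<close>
  have "?c - 0 \<in> tangent_space ?\<phi>' (\<tau> u)"
  proof (rule B.tangentI[OF \<tau>u])
    show "?c - 0 \<in> TS (?\<phi>' (\<tau> u))"
      using A.cl_cov_deriv(2)[where X = X, OF assms(1) u Ys \<xi>] eq[OF N(2)] by simp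
    fix k
    have om: "A.om \<xi> u = B.om (T \<xi>) (\<tau> u)" unfolding A.om_def B.om_def T(2) eq[OF N(2)] ..
    \<comment> \<open>Tangency of \<open>Y\<close> makes these imaginary parts vanish throughout
      \<open>N\<close>; their derivative at \<open>u\<close> supplies the hypothesis of
      \<open>covariant_derivative_tangential\<close>.\<close>
    have "((\<lambda>x. Im (bdot (?y x) (vcnj (B.zf k (\<tau> x))))) has_derivative
        (\<lambda>v. Im (bdot (?y u) (vcnj (fd (B.zf k) (\<tau> u) (T v))) + bdot (fd ?y u v) (vcnj (B.zf k (\<tau> u)))))) (at u)"
      by (intro bounded_linear.has_derivative[OF bounded_linear_Im] bounded_bilinear.FDERIV[OF bounded_bilinear_bdot]
          bounded_linear.has_derivative[OF bounded_linear_vcnj] smooth_onD[OF ys u]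
          has_derivative_compose[OF T(1) B.z_der[OF \<tau>u]])
    moreover have "((\<lambda>x. Im (bdot (?y x) (vcnj (B.zf k (\<tau> x))))) has_derivative (\<lambda>v. 0)) (at u)"
      by (rule has_derivative_transform_within_open[of "\<lambda>_. 0" _ _ _ N]) (use N yt in auto)
    ultimately have "(\<lambda>v. Im (bdot (?y u) (vcnj (fd (B.zf k) (\<tau> u) (T v))) + bdot (fd ?y u v) (vcnj (B.zf k (\<tau> u))))) = (\<lambda>v. 0)"
      by (rule has_derivative_unique)
    then have "Im (bdot (?y u) (vcnj (fd (B.zf k) (\<tau> u) (T \<xi>))) + bdot (fd ?y u \<xi>) (vcnj (B.zf k (\<tau> u)))) = 0"
      by (rule fun_cong)
    then have "Im (bdot (fd ?y u \<xi> + lc (B.om (T \<xi>) (\<tau> u)) (?y u)) (vcnj (B.zf k (\<tau> u)))) = 0"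
      by (rule C.covariant_derivative_tangential[OF \<tau>u yt[OF N(2)]])
    then show "Im (bdot (cl (?\<phi>' (\<tau> u)) (?c - 0)) (vcnj (B.zf k (\<tau> u)))) = 0"
      using A.cl_cov_deriv(1)[where X = X, OF assms(1) u Ys \<xi>] unfolding eq[OF N(2), symmetric] om by simp
  qed
  then have "?c - 0 \<in> tangent_space ?\<phi> u" using tr[OF N(2)] by blast
  then show "second_ff nabla ?\<phi> X Y u = 0"
    by (intro A.second_ff_eqI u subspace_0[OF A.subspace_normal])
qed

end
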